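(* Let $G$ be an infinite finitely generated group such that every proper quotient of $G$ is virtually nilpotent. Then either $G$ is a bireversible group or $$\mathcal{C}_1^X(G)=\mathrm{Comm}_{\mathrm{Aut}(X)}(G)\cap \mathrm{Aut}_1(X)$$ is locally finite for all Cayley graphs $X$ of $G$.
   Context: A proper quotient of $G$ is a quotient $G/N$ with $N$ a non-trivial normal subgroup. Cayley graphs. For a group $G$ with finite generating set $S$, the (unlabelled) Cayley graph $\mathrm{Cay}(G,S)$ is the directed graph with vertex set $G$ and edge set $\{(g,gs)\mid g\in G, s\in S\cup S^{-1}\}$. A Cayley graph of $G$ means $\mathrm{Cay}(G,S)$ for some finite generating set $S$. $\mathrm{Aut}(X)$ is the group of automorphisms of $X$ as an unlabelled graph, $\mathrm{Aut}_1(X)$ is the stabiliser of the vertex $1\in G$, and $G$ is regarded as a subgroup of $\mathrm{Aut}(X)$ through left multiplication. Commensurator. For $H\leq K$, $\mathrm{Comm}_K(H)=\{k\in K\mid [H:H\cap kHk^{-1}]<\infty,\ [kHk^{-1}:H\cap kHk^{-1}]<\infty\}$. A group is locally finite if all its finitely generated subgroups are finite. Bireversible groups. A Mealy automaton is a tuple $\mathcal{M}=(A,Q,\lambda,\rho)$ where $A$ (alphabet) and $Q$ (state set) are finite sets and $\lambda\colon Q\times A\to A$, $\rho\colon Q\times A\to Q$ are maps. It is invertible if $\lambda_q\colon A\to A$, $a\mapsto\lambda(q,a)$ is a bijection for every $q\in Q$; reversible if $\rho_a\colon Q\to Q$, $q\mapsto \rho(q,a)$ is a bijection for every $a\in A$;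 bireversible if it is invertible, reversible and $Q\times A\to A\times Q$, $(q,a)\mapsto(\lambda(q,a),\rho(q,a))$ is a bijection. Let $A^*$ be the free monoid on $A$. Each $\lambda_q$ extends to $A^*$ by $\lambda_q(aw)=\lambda_q(a)\lambda_{\rho(q,a)}(w)$. If $\mathcal{M}$ is invertible, these are bijections of $A^*$, giving a homomorphism $f_Q$ from the free group $F_Q$ to the group of bijections of $A^*$ (acting on the left), and the group generated by $\mathcal{M}$ is $G_{\mathcal{M}}=F_Q/\ker(f_Q)$. A group is called bireversible if it is isomorphic to $G_{\mathcal{M}}$ for some bireversible automaton $\mathcal{M}$. *)

theory Defs
  imports "HOL-Algebra.Generated_Groups" "HOL-Algebra.Group_Action" "Graph_Theory.Pair_Digraph"
begin

section \<open>Finiteness conditions on groups\<close>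

definition finite_generating_set :: "('a, 'b) monoid_scheme \<Rightarrow> 'a set \<Rightarrow> bool" where
  "finite_generating_set G S \<longleftrightarrow> finite S \<and> S \<subseteq> carrier G \<and> generate G S = carrier G"

definition finitely_generated :: "('a, 'b) monoid_scheme \<Rightarrow> bool" where
  "finitely_generated G \<longleftrightarrow> (\<exists>S. finite_generating_set G S)"

definition locally_finite :: "('a, 'b) monoid_scheme \<Rightarrow> bool" where
  "locally_finite G \<longleftrightarrow>
     (\<forall>H. subgroup H G \<and> finitely_generated (G\<lparr>carrier := H\<rparr>) \<longrightarrow> finite H)"

text \<open>\<open>finite_index K H L\<close> states \<open>[H : L] < \<infinity>\<close> for subgroups \<open>L \<le> H\<close> of \<open>K\<close>.\<close>

definition finite_index :: "('a, 'b) monoid_scheme \<Rightarrow> 'a set \<Rightarrow> 'a set \<Rightarrow> bool" where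
  "finite_index K H L \<longleftrightarrow> finite (rcosets\<^bsub>K\<lparr>carrier := H\<rparr>\<^esub> L)"

primrec lower_central :: "('a, 'b) monoid_scheme \<Rightarrow> nat \<Rightarrow> 'a set" where
  "lower_central G 0 = carrier G"
| "lower_central G (Suc n) =
     generate G (\<Union>x \<in> lower_central G n. \<Union>y \<in> carrier G.
       {x \<otimes>\<^bsub>G\<^esub> y \<otimes>\<^bsub>G\<^esub> inv\<^bsub>G\<^esub> x \<otimes>\<^bsub>G\<^esub> inv\<^bsub>G\<^esub> y})"

definition nilpotent :: "('a, 'b) monoid_scheme \<Rightarrow> bool" where
  "nilpotent G \<longleftrightarrow> (\<exists>n. lower_central G n = {\<one>\<^bsub>G\<^esub>})"

definition virtually_nilpotent :: "('a, 'b) monoid_scheme \<Rightarrow> bool" where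
  "virtually_nilpotent G \<longleftrightarrow>
     (\<exists>H. subgroup H G \<and> finite_index G (carrier G) H \<and> nilpotent (G\<lparr>carrier := H\<rparr>))"


section \<open>Cayley graphs and commensurators\<close>

definition Cay :: "('a, 'b) monoid_scheme \<Rightarrow> 'a set \<Rightarrow> 'a pair_pre_digraph" where
  "Cay G S = \<lparr>pverts = carrier G,
     parcs = {(g, g \<otimes>\<^bsub>G\<^esub> s) | g s. g \<in> carrier G \<and> s \<in> S \<union> set_inv\<^bsub>G\<^esub> S}\<rparr>"

definition cayley_graph_of :: "('a, 'b) monoid_scheme \<Rightarrow> 'a pair_pre_digraph \<Rightarrow> bool" where
  "cayley_graph_of G \<Gamma> \<longleftrightarrow> (\<exists>S. finite_generating_set G S \<and> \<Gamma> = Cay G S)"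

definition Aut :: "'v pair_pre_digraph \<Rightarrow> ('v \<Rightarrow> 'v) monoid" where
  "Aut \<Gamma> = BijGroup (pverts \<Gamma>)
     \<lparr>carrier := {f \<in> Bij (pverts \<Gamma>).
        \<forall>x \<in> pverts \<Gamma>. \<forall>y \<in> pverts \<Gamma>. (x, y) \<in> parcs \<Gamma> \<longleftrightarrow> (f x, f y) \<in> parcs \<Gamma>}\<rparr>"

text \<open>The copy of \<open>G\<close> in the automorphism group of any of its Cayley graphs.\<close>

definition left_translations :: "('a, 'b) monoid_scheme \<Rightarrow> ('a \<Rightarrow> 'a) set" where
  "left_translations G = (\<lambda>g. \<lambda>x \<in> carrier G. g \<otimes>\<^bsub>G\<^esub> x) ` carrier G"

definition conj_subgroup :: "('a, 'b) monoid_scheme \<Rightarrow> 'a \<Rightarrow> 'a set \<Rightarrow> 'a set" where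
  "conj_subgroup K k H = (k <#\<^bsub>K\<^esub> H) #>\<^bsub>K\<^esub> inv\<^bsub>K\<^esub> k"

definition Comm :: "('a, 'b) monoid_scheme \<Rightarrow> 'a set \<Rightarrow> 'a set" where
  "Comm K H = {k \<in> carrier K.
     finite_index K H (H \<inter> conj_subgroup K k H) \<and>
     finite_index K (conj_subgroup K k H) (H \<inter> conj_subgroup K k H)}"

definition comm_stabilizer ::
    "('a, 'b) monoid_scheme \<Rightarrow> 'a pair_pre_digraph \<Rightarrow> ('a \<Rightarrow> 'a) set" where
  "comm_stabilizer G \<Gamma> =
     Comm (Aut \<Gamma>) (left_translations G) \<inter> stabilizer (Aut \<Gamma>) (\<lambda>f. f) \<one>\<^bsub>G\<^esub>"

lemma subgroup_Aut:
  "subgroup (carrier (Aut \<Gamma>)) (BijGroup (pverts \<Gamma>))"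
proof -
  interpret B: group "BijGroup (pverts \<Gamma>)" by (rule group_BijGroup)
  show ?thesis
  proof (rule B.subgroupI)
    show "carrier (Aut \<Gamma>) \<subseteq> carrier (BijGroup (pverts \<Gamma>))"
      by (auto simp: Aut_def BijGroup_def)
    have "\<one>\<^bsub>BijGroup (pverts \<Gamma>)\<^esub> \<in> carrier (Aut \<Gamma>)"
      by (simp add: Aut_def BijGroup_def id_Bij)
    then show "carrier (Aut \<Gamma>) \<noteq> {}" by blast
  next
    fix f assume f: "f \<in> carrier (Aut \<Gamma>)"
    then have fB: "f \<in> Bij (pverts \<Gamma>)" by (simp add: Aut_def)
    then have im: "f ` pverts \<Gamma> = pverts \<Gamma>" by (simp add: Bij_def bij_betw_def)
    have "(inv_into (pverts \<Gamma>) f x, inv_into (pverts \<Gamma>) f y) \<in> parcs \<Gamma> \<longleftrightarrow> (x, y) \<in> parcs \<Gamma>"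
      if "x \<in> pverts \<Gamma>" "y \<in> pverts \<Gamma>" for x y
      using f that Bij_inv_into_mem[OF fB] f_inv_into_f[of _ f "pverts \<Gamma>"]
      by (simp add: Aut_def im)
    then show "inv\<^bsub>BijGroup (pverts \<Gamma>)\<^esub> f \<in> carrier (Aut \<Gamma>)"
      using fB by (simp add: Aut_def inv_BijGroup restrict_inv_into_Bij)
  next
    fix f g assume fg: "f \<in> carrier (Aut \<Gamma>)" "g \<in> carrier (Aut \<Gamma>)"
    then have B: "f \<in> Bij (pverts \<Gamma>)" "g \<in> Bij (pverts \<Gamma>)" by (simp_all add: Aut_def)
    have g: "g x \<in> pverts \<Gamma>" if "x \<in> pverts \<Gamma>" for x
      using Bij_imp_funcset[OF B(2)] that by blast
    have "(compose (pverts \<Gamma>) f g x, compose (pverts \<Gamma>) f g y) \<in> parcs \<Gamma> \<longleftrightarrow> (x, y) \<in> parcs \<Gamma>"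
      if "x \<in> pverts \<Gamma>" "y \<in> pverts \<Gamma>" for x y
    proof -
      have "(f (g x), f (g y)) \<in> parcs \<Gamma> \<longleftrightarrow> (g x, g y) \<in> parcs \<Gamma>"
        using fg(1) g that by (simp add: Aut_def)
      also have "\<dots> \<longleftrightarrow> (x, y) \<in> parcs \<Gamma>" using fg(2) that by (simp add: Aut_def)
      finally show ?thesis using that by (simp add: compose_eq)
    qed
    then show "f \<otimes>\<^bsub>BijGroup (pverts \<Gamma>)\<^esub> g \<in> carrier (Aut \<Gamma>)"
      using B by (simp add: Aut_def BijGroup_def compose_Bij)
  qed
qed

lemma group_Aut: "group (Aut \<Gamma>)"
  using subgroup.subgroup_is_group[OF subgroup_Aut group_BijGroup, of \<Gamma>] by (simp add: Aut_def)

lemma subgroup_left_translations: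
  fixes G (structure)
  assumes "group G" "cayley_graph_of G \<Gamma>"
  shows "subgroup (left_translations G) (Aut \<Gamma>)"
    and "(\<lambda>g. \<lambda>x \<in> carrier G. g \<otimes> x) \<in> iso G (Aut \<Gamma>\<lparr>carrier := left_translations G\<rparr>)"
proof -
  interpret group G by fact
  interpret A: group "Aut \<Gamma>" by (rule group_Aut)
  let ?l = "\<lambda>g. \<lambda>x \<in> carrier G. g \<otimes> x"
  obtain S where S: "S \<subseteq> carrier G" and \<Gamma>: "\<Gamma> = Cay G S"
    using assms(2) by (auto simp: cayley_graph_of_def finite_generating_set_def)
  have S': "S \<union> set_inv S \<subseteq> carrier G" using S by (auto simp: SET_INV_def)
  have mult: "?l (g \<otimes> h) = compose (carrier G) (?l g) (?l h)"
    if "g \<in> carrier G" "h \<in> carrier G" for g h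
    using that by (auto simp: compose_def m_assoc)
  have bij: "?l g \<in> Bij (carrier G)" if g: "g \<in> carrier G" for g
  proof -
    have "bij_betw (?l g) (carrier G) (carrier G)"
      by (rule bij_betw_byWitness[where f' = "?l (inv g)"]) (use g in \<open>auto simp flip: m_assoc\<close>)
    then show ?thesis by (simp add: Bij_def)
  qed
  have arc: "(x, y) \<in> parcs \<Gamma> \<longleftrightarrow> inv x \<otimes> y \<in> S \<union> set_inv S"
    if "x \<in> carrier G" "y \<in> carrier G" for x y
  proof
    assume "(x, y) \<in> parcs \<Gamma>"
    then obtain s where "s \<in> S \<union> set_inv S" "y = x \<otimes> s" by (auto simp: \<Gamma> Cay_def)
    with that S' show "inv x \<otimes> y \<in> S \<union> set_inv S" by (auto simp flip: m_assoc)
  next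
    assume *: "inv x \<otimes> y \<in> S \<union> set_inv S"
    have "y = x \<otimes> (inv x \<otimes> y)" using that by (simp flip: m_assoc)
    with * that show "(x, y) \<in> parcs \<Gamma>" unfolding \<Gamma> Cay_def by auto
  qed
  have aut: "?l g \<in> carrier (Aut \<Gamma>)" if g: "g \<in> carrier G" for g
  proof -
    have *: "inv (g \<otimes> x) \<otimes> (g \<otimes> y) = inv x \<otimes> y" if "x \<in> carrier G" "y \<in> carrier G" for x y
    proof -
      have "inv g \<otimes> (g \<otimes> y) = y" using g that by (simp flip: m_assoc)
      then show ?thesis using g that by (simp add: inv_mult_group m_assoc)
    qed
    have "(x, y) \<in> parcs \<Gamma> \<longleftrightarrow> (g \<otimes> x, g \<otimes> y) \<in> parcs \<Gamma>"
      if "x \<in> carrier G" "y \<in> carrier G" for x y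
      using g that by (simp only: arc m_closed *)
    moreover have "pverts \<Gamma> = carrier G" by (simp add: \<Gamma> Cay_def)
    ultimately show ?thesis using bij[OF g] by (simp add: Aut_def)
  qed
  have hom: "?l \<in> hom G (Aut \<Gamma>)"
  proof (rule homI)
    fix g h assume gh: "g \<in> carrier G" "h \<in> carrier G"
    have "pverts \<Gamma> = carrier G" by (simp add: \<Gamma> Cay_def)
    with bij gh show "?l (g \<otimes> h) = ?l g \<otimes>\<^bsub>Aut \<Gamma>\<^esub> ?l h"
      by (simp only: mult) (simp add: Aut_def BijGroup_def)
  qed (rule aut)
  interpret group_hom G "Aut \<Gamma>" ?l
    by unfold_locales (rule hom)
  show "subgroup (left_translations G) (Aut \<Gamma>)"
    using img_is_subgroup by (simp add: left_translations_def)
  have "inj_on ?l (carrier G)"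
  proof (rule inj_onI)
    fix g h assume gh: "g \<in> carrier G" "h \<in> carrier G" and eq: "?l g = ?l h"
    from fun_cong[OF eq, of \<one>] show "g = h" using gh by simp
  qed
  with hom show "?l \<in> iso G (Aut \<Gamma>\<lparr>carrier := left_translations G\<rparr>)"
    by (auto simp: iso_def hom_def bij_betw_def left_translations_def)
qed


section \<open>Free groups\<close>

text \<open>A letter \<open>(x, True)\<close> stands for \<open>x\<close> and \<open>(x, False)\<close> for its inverse; elements are
  freely reduced words. \<open>cancel_cons\<close> multiplies a reduced word by a letter from the left.\<close>

definition cancels :: "'q \<times> bool \<Rightarrow> 'q \<times> bool \<Rightarrow> bool" where
  "cancels l m \<longleftrightarrow> fst l = fst m \<and> snd l \<noteq> snd m"

fun cancel_cons :: "'q \<times> bool \<Rightarrow> ('q \<times> bool) list \<Rightarrow> ('q \<times> bool) list" where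
  "cancel_cons l [] = [l]"
| "cancel_cons l (m # w) = (if cancels l m then w else l # m # w)"

definition free_group :: "'q set \<Rightarrow> ('q \<times> bool) list monoid" where
  "free_group Q =
     \<lparr>carrier = {w \<in> lists (Q \<times> UNIV). successively (\<lambda>l m. \<not> cancels l m) w},
      monoid.mult = (\<lambda>u v. foldr cancel_cons u v),
      one = []\<rparr>"

text \<open>The homomorphism from the free group to \<open>H\<close> extending \<open>\<phi>\<close>.\<close>

fun free_lift :: "('a, 'b) monoid_scheme \<Rightarrow> ('q \<Rightarrow> 'a) \<Rightarrow> ('q \<times> bool) list \<Rightarrow> 'a" where
  "free_lift H \<phi> [] = \<one>\<^bsub>H\<^esub>"
| "free_lift H \<phi> ((x, e) # w) =
     (if e then \<phi> x else inv\<^bsub>H\<^esub> (\<phi> x)) \<otimes>\<^bsub>H\<^esub> free_lift H \<phi> w"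

lemma cancel_cons_closed:
  assumes "l \<in> Q \<times> UNIV" "w \<in> carrier (free_group Q)"
  shows "cancel_cons l w \<in> carrier (free_group Q)"
  using assms by (cases w; cases "tl w") (auto simp: free_group_def)

lemma foldr_cancel_cons_closed:
  assumes "u \<in> lists (Q \<times> UNIV)" "v \<in> carrier (free_group Q)"
  shows "foldr cancel_cons u v \<in> carrier (free_group Q)"
  using assms by (induction u) (auto intro: cancel_cons_closed)

lemma cancel_cons_cancel_cons:
  assumes "w \<in> carrier (free_group Q)" "cancels l m"
  shows "cancel_cons l (cancel_cons m w) = w"
  using assms
  by (cases w; cases "tl w") (auto simp: free_group_def cancels_def prod_eq_iff)

lemma foldr_cancel_cons_assoc:
  assumes "u \<in> lists (Q \<times> UNIV)" "v \<in> lists (Q \<times> UNIV)" "w \<in> carrier (free_group Q)"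
  shows "foldr cancel_cons (foldr cancel_cons u v) w = foldr cancel_cons u (foldr cancel_cons v w)"
proof -
  have *: "foldr cancel_cons (cancel_cons l z) w = cancel_cons l (foldr cancel_cons z w)"
    if "z \<in> lists (Q \<times> UNIV)" for l z
    using that assms(3)
    by (cases z) (auto simp: cancel_cons_cancel_cons[OF foldr_cancel_cons_closed])
  have cl: "cancel_cons l z \<in> lists (Q \<times> UNIV)"
    if "l \<in> Q \<times> UNIV" "z \<in> lists (Q \<times> UNIV)" for l z
    using that by (cases z) auto
  have cl': "foldr cancel_cons u v \<in> lists (Q \<times> UNIV)" if "u \<in> lists (Q \<times> UNIV)" for u
    using that assms(2) by (induction u) (auto simp: cl)
  show ?thesis
    using assms(1) by (induction u) (auto simp: * cl')
qed

lemma group_free_group: "group (free_group Q)"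
proof (rule groupI)
  fix u v assume "u \<in> carrier (free_group Q)" "v \<in> carrier (free_group Q)"
  then show "u \<otimes>\<^bsub>free_group Q\<^esub> v \<in> carrier (free_group Q)"
    using foldr_cancel_cons_closed[of u Q v] by (simp add: free_group_def)
next
  show "\<one>\<^bsub>free_group Q\<^esub> \<in> carrier (free_group Q)" by (simp add: free_group_def)
next
  fix u v w
  assume "u \<in> carrier (free_group Q)" "v \<in> carrier (free_group Q)" "w \<in> carrier (free_group Q)"
  then show "u \<otimes>\<^bsub>free_group Q\<^esub> v \<otimes>\<^bsub>free_group Q\<^esub> w
      = u \<otimes>\<^bsub>free_group Q\<^esub> (v \<otimes>\<^bsub>free_group Q\<^esub> w)"
    using foldr_cancel_cons_assoc[of u Q v w] by (simp add: free_group_def)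
next
  fix u assume "u \<in> carrier (free_group Q)"
  then show "\<one>\<^bsub>free_group Q\<^esub> \<otimes>\<^bsub>free_group Q\<^esub> u = u" by (simp add: free_group_def)
next
  fix u assume u: "u \<in> carrier (free_group Q)"
  let ?flip = "\<lambda>l :: 'a \<times> bool. (fst l, \<not> snd l)"
  let ?v = "rev (map ?flip u)"
  have flip: "cancels (?flip l) (?flip m) = cancels m l" for l m
    by (auto simp: cancels_def)
  have v: "?v \<in> carrier (free_group Q)"
    using u by (fastforce simp: free_group_def successively_map flip)
  have "foldr cancel_cons (rev (map ?flip u)) u = []"
    if "u \<in> carrier (free_group Q)" for u
    using that
  proof (induction u)
    case (Cons l u)
    then have "u \<in> carrier (free_group Q)"
      by (cases u) (auto simp: free_group_def)
    with Cons show ?case by (simp add: cancels_def)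
  qed simp
  with u v show "\<exists>v \<in> carrier (free_group Q). v \<otimes>\<^bsub>free_group Q\<^esub> u = \<one>\<^bsub>free_group Q\<^esub>"
    by (intro bexI[of _ ?v]) (auto simp: free_group_def)
qed

lemma free_lift_hom:
  assumes "group H" "\<phi> \<in> Q \<rightarrow> carrier H"
  shows "free_lift H \<phi> \<in> hom (free_group Q) H"
proof -
  interpret H: group H by fact
  have cl: "free_lift H \<phi> w \<in> carrier H" if "w \<in> lists (Q \<times> UNIV)" for w
    using that assms(2) by (induction w) (auto simp: Pi_iff)
  have canc: "a \<otimes>\<^bsub>H\<^esub> (inv\<^bsub>H\<^esub> a \<otimes>\<^bsub>H\<^esub> b) = b" "inv\<^bsub>H\<^esub> a \<otimes>\<^bsub>H\<^esub> (a \<otimes>\<^bsub>H\<^esub> b) = b"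
    if "a \<in> carrier H" "b \<in> carrier H" for a b
    using that by (simp_all flip: H.m_assoc)
  have cons: "free_lift H \<phi> (cancel_cons l w) = free_lift H \<phi> (l # w)"
    if "l \<in> Q \<times> UNIV" "w \<in> lists (Q \<times> UNIV)" for l w
    using that assms(2) cl[of "tl w"]
    by (cases w; cases l) (auto simp: cancels_def canc Pi_iff)
  have "free_lift H \<phi> (foldr cancel_cons u v) = free_lift H \<phi> u \<otimes>\<^bsub>H\<^esub> free_lift H \<phi> v"
    if "u \<in> lists (Q \<times> UNIV)" and v: "v \<in> carrier (free_group Q)" for u v
    using that(1)
  proof (induction u)
    case Nil
    from v cl[of v] show ?case by (auto simp: free_group_def)
  next
    case (Cons l u)
    have 1: "foldr cancel_cons u v \<in> lists (Q \<times> UNIV)"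
      using foldr_cancel_cons_closed[OF Cons.hyps(2) v] by (simp add: free_group_def)
    have 2: "v \<in> lists (Q \<times> UNIV)" using v by (simp add: free_group_def)
    obtain x e where l: "l = (x, e)" by (cases l)
    then have "\<phi> x \<in> carrier H" using Cons.hyps(1) assms(2) by auto
    with Cons.IH cons[OF Cons.hyps(1) 1] cl[OF Cons.hyps(2)] cl[OF 2] show ?case
      by (simp add: l H.m_assoc)
  qed
  then show ?thesis
    by (intro homI) (use cl in \<open>auto simp: free_group_def\<close>)
qed


section \<open>Mealy automata and bireversible groups\<close>

record ('a, 'q) mealy =
  alphabet :: "'a set"
  states :: "'q set"
  out_letter :: "'q \<Rightarrow> 'a \<Rightarrow> 'a"  \<comment> \<open>the map \<open>\<lambda>\<close>\<close>
  next_state :: "'q \<Rightarrow> 'a \<Rightarrow> 'q"  \<comment> \<open>the map \<open>\<rho>\<close>\<close>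

definition mealy_automaton :: "('a, 'q) mealy \<Rightarrow> bool" where
  "mealy_automaton M \<longleftrightarrow> finite (alphabet M) \<and> finite (states M) \<and>
     out_letter M \<in> states M \<rightarrow> alphabet M \<rightarrow> alphabet M \<and>
     next_state M \<in> states M \<rightarrow> alphabet M \<rightarrow> states M"

definition invertible :: "('a, 'q) mealy \<Rightarrow> bool" where
  "invertible M \<longleftrightarrow> (\<forall>q \<in> states M. bij_betw (out_letter M q) (alphabet M) (alphabet M))"

definition reversible :: "('a, 'q) mealy \<Rightarrow> bool" where
  "reversible M \<longleftrightarrow> (\<forall>a \<in> alphabet M. bij_betw (\<lambda>q. next_state M q a) (states M) (states M))"

definition bireversible :: "('a, 'q) mealy \<Rightarrow> bool" where
  "bireversible M \<longleftrightarrow> invertible M \<and> reversible M \<and>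
     bij_betw (\<lambda>(q, a). (out_letter M q a, next_state M q a))
       (states M \<times> alphabet M) (alphabet M \<times> states M)"

primrec word_out :: "('a, 'q) mealy \<Rightarrow> 'q \<Rightarrow> 'a list \<Rightarrow> 'a list" where
  "word_out M q [] = []"
| "word_out M q (a # w) = out_letter M q a # word_out M (next_state M q a) w"

definition mealy_hom :: "('a, 'q) mealy \<Rightarrow> ('q \<times> bool) list \<Rightarrow> ('a list \<Rightarrow> 'a list)" where
  "mealy_hom M = free_lift (BijGroup (lists (alphabet M)))
     (\<lambda>q. restrict (word_out M q) (lists (alphabet M)))"

definition mealy_group :: "('a, 'q) mealy \<Rightarrow> ('q \<times> bool) list set monoid" where
  "mealy_group M = free_group (states M) Mod
     kernel (free_group (states M)) (BijGroup (lists (alphabet M))) (mealy_hom M)"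

text \<open>Since alphabet and state set are finite, automata over \<open>nat\<close> represent all Mealy automata
  up to renaming of letters and states.\<close>

definition bireversible_group :: "('a, 'b) monoid_scheme \<Rightarrow> bool" where
  "bireversible_group G \<longleftrightarrow>
     (\<exists>M :: (nat, nat) mealy. mealy_automaton M \<and> bireversible M \<and> G \<cong> mealy_group M)"

lemma word_out_Bij:
  assumes M: "mealy_automaton M" "invertible M" and q: "q \<in> states M"
  shows "restrict (word_out M q) (lists (alphabet M)) \<in> Bij (lists (alphabet M))"
proof -
  have cl: "word_out M q w \<in> lists (alphabet M)"
    if "w \<in> lists (alphabet M)" "q \<in> states M" for q w
    using that M(1) by (induction w arbitrary: q) (auto simp: mealy_automaton_def Pi_iff)
  have inj: "v = w"
    if "word_out M q v = word_out M q w" "v \<in> lists (alphabet M)" "w \<in> lists (alphabet M)"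
      "q \<in> states M" for q v w
    using that
  proof (induction v arbitrary: q w)
    case Nil
    then show ?case by (cases w) auto
  next
    case (Cons a v)
    then obtain b w' where w: "w = b # w'" by (cases w) auto
    with Cons.prems have "a = b"
      using M(2) by (auto simp: invertible_def bij_betw_def inj_on_def)
    with Cons w M(1) show ?case by (auto simp: mealy_automaton_def Pi_iff)
  qed
  have surj: "w \<in> word_out M q ` lists (alphabet M)"
    if "w \<in> lists (alphabet M)" "q \<in> states M" for q w
    using that
  proof (induction w arbitrary: q)
    case Nil
    then show ?case by (auto intro: image_eqI[of _ _ "[]"])
  next
    case (Cons b w)
    then have "b \<in> out_letter M q ` alphabet M" using M(2) by (auto simp: invertible_def bij_betw_def)
    then obtain a where a: "a \<in> alphabet M" "b = out_letter M q a" by blast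
    with Cons M(1) have "w \<in> word_out M (next_state M q a) ` lists (alphabet M)"
      by (auto simp: mealy_automaton_def Pi_iff)
    with a show ?case by (auto intro!: image_eqI[of _ _ "a # _"])
  qed
  have "word_out M q ` lists (alphabet M) = lists (alphabet M)"
    using cl[OF _ q] surj[OF _ q] by blast
  moreover have "inj_on (word_out M q) (lists (alphabet M))"
    by (rule inj_onI) (rule inj[OF _ _ _ q])
  ultimately show ?thesis by (simp add: Bij_def bij_betw_def)
qed

lemma mealy_hom_hom:
  assumes "mealy_automaton M" "invertible M"
  shows "mealy_hom M \<in> hom (free_group (states M)) (BijGroup (lists (alphabet M)))"
  unfolding mealy_hom_def
  by (rule free_lift_hom[OF group_BijGroup])
    (use word_out_Bij[OF assms] in \<open>auto simp: BijGroup_def\<close>)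

end

theory Submission
  imports Defs
begin

text \<open>
  Let \<open>X\<close> be a Cayley graph of \<open>G\<close>. For an automorphism \<open>h\<close> of \<open>X\<close> with \<open>h \<one> = \<one>\<close> and \<open>x\<close> in \<open>G\<close>,
  the restriction of \<open>h\<close> at \<open>x\<close> is the automorphism \<open>y \<mapsto> inv (h x) \<otimes> h (x \<otimes> y)\<close>, again with fixed
  point \<open>\<one>\<close>. In \<open>Aut X\<close> it is the only element of the coset \<open>G h x\<close> with this fixed point, so \<open>h\<close>
  commensurates \<open>G\<close> only if it has finitely many restrictions. Given finitely many elements of the
  commensurating stabiliser, their restrictions and those of their inverses therefore form a
  finite set \<open>Q\<close>. It generates a group \<open>L\<close> that contains the given elements, and the claim is that
  \<open>L\<close> is finite or \<open>G\<close> is bireversible.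

  The rule "in state \<open>a\<close>, replace the letter \<open>q\<close> of \<open>Q\<close> by its restriction at \<open>a\<close> and pass to
  state \<open>q a\<close>" is an automaton with alphabet \<open>Q\<close> and the generators of \<open>G\<close> as states. It is
  bireversible, and \<open>G\<close> maps onto its group; the elements of the kernel restrict every element of
  \<open>L\<close> to itself. Let \<open>N\<close>, called \<open>inert\<close> below, be the normal subgroup of all such elements. If
  \<open>N\<close> is trivial, then \<open>G\<close> is bireversible (\<open>bireversible_if_inert_trivial\<close>). Otherwise \<open>G / N\<close> is
  virtually nilpotent, and two steps remain.

  First, a finitely generated \<open>L\<close> acts through a finite group on every finitely generated
  virtually nilpotent \<open>P\<close> on which it acts with finite orbits and restrictions as above
  (\<open>finite_self_similar_action\<close>). All that matters about \<open>P\<close> is that it is, up to finite index, an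
  iterated extension by \<open>\<int>\<close>, and the proof is by induction on the number of these extensions.
  Consider the real functions on \<open>P\<close> that are harmonic and change only by constants under left
  translation by a subgroup of finite index. They form a finite-dimensional space that \<open>L\<close>
  preserves exactly, since \<open>L\<close> acts by graph automorphisms and each of its elements is a
  homomorphism on a subgroup of finite index. A function in this space is determined by its values
  on a finite set, whose points have finite orbits under \<open>L\<close>; so a subgroup of finite index in \<open>L\<close>
  acts trivially on the space. Every homomorphism from a subgroup of finite index to \<open>\<real>\<close> comes
  from a function in the space (\<open>ex_harmonic\<close>), so the elements of \<open>P\<close> on which all of them take
  the same value as at \<open>\<one>\<close> form a subgroup to which the induction hypothesis applies
  (\<open>virtually_poly_Z_Level\<close>). What is left is a subgroup of finite index in \<open>L\<close> that acts
  unipotently in two steps, and finiteness of orbits turns this into triviality on a subgroup of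
  finite index of \<open>P\<close> (\<open>finite_action_step\<close>).

  Second, if \<open>L\<close> acts on \<open>G / N\<close> through a finite group, then \<open>N\<close> has finite index in \<open>G\<close>
  (\<open>inert_finite_index\<close>): the kernel \<open>M\<close> of this action is finitely generated, \<open>G\<close> acts on \<open>M\<close> by
  restriction through automorphisms with finite orbits, hence through a finite group. Now \<open>N\<close> is
  finitely generated, \<open>L\<close> acts on it by automorphisms with finite orbits, and so \<open>L\<close> is finite
  (\<open>finite_action_of_inert\<close>).
\<close>


section \<open>Subgroups of finite index\<close>

definition fi_subgroup :: "('a, 'b) monoid_scheme \<Rightarrow> 'a set \<Rightarrow> 'a set \<Rightarrow> bool" where
  "fi_subgroup G H K \<longleftrightarrow> subgroup K G \<and> K \<subseteq> H \<and> finite_index G H K"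

context group
begin

lemma cancel_left:
  assumes "x \<in> carrier G" "y \<in> carrier G"
  shows "inv x \<otimes> (x \<otimes> y) = y" "x \<otimes> (inv x \<otimes> y) = y"
  using assms by (simp_all flip: m_assoc)

lemma finite_index_iff: "finite_index G H K \<longleftrightarrow> finite ((\<lambda>x. K #> x) ` H)"
  by (simp add: finite_index_def RCOSETS_def UNION_singleton_eq_range)

lemma r_coset_eqI:
  assumes "subgroup K G" "k \<in> K" "x \<in> carrier G"
  shows "K #> (k \<otimes> x) = K #> x"
proof -
  have k: "k \<in> carrier G" and K: "K \<subseteq> carrier G"
    using assms subgroup.subset by auto
  have "K #> (k \<otimes> x) = K #> k #> x" using coset_mult_assoc[OF K k assms(3)] by simp
  also have "K #> k = K" using coset_join2[OF k assms(1,2)] .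
  finally show ?thesis .
qed

lemma r_coset_eq_iff:
  assumes K: "subgroup K G" and x: "x \<in> carrier G" and y: "y \<in> carrier G"
  shows "K #> x = K #> y \<longleftrightarrow> x \<otimes> inv y \<in> K"
proof
  assume "K #> x = K #> y"
  then have "x \<in> K #> y" using rcos_self[OF x K] by simp
  then obtain k where k: "k \<in> K" "x = k \<otimes> y" by (auto simp: r_coset_def)
  then have "x \<otimes> inv y = k" using y subgroup.mem_carrier[OF K] by (simp add: m_assoc)
  then show "x \<otimes> inv y \<in> K" using k by simp
next
  assume *: "x \<otimes> inv y \<in> K"
  have "x = (x \<otimes> inv y) \<otimes> y" using x y by (simp add: m_assoc)
  then show "K #> x = K #> y" using r_coset_eqI[OF K * y] by simp
qed

text \<open>Almost every finiteness of an index below comes from a finite invariant: a function on \<open>H\<close>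
  with finitely many values whose fibres lie in cosets of \<open>K\<close>.\<close>

lemma fi_subgroupI:
  assumes "subgroup K G" "K \<subseteq> H" "H \<subseteq> carrier G" "finite (F ` H)"
    and F: "\<And>x y. x \<in> H \<Longrightarrow> y \<in> H \<Longrightarrow> F x = F y \<Longrightarrow> x \<otimes> inv y \<in> K"
  shows "fi_subgroup G H K"
proof -
  have eq: "K #> x = K #> y" if "x \<in> H" "y \<in> H" "F x = F y" for x y
    using F[OF that] assms that by (subst r_coset_eq_iff) auto
  have "(\<lambda>x. K #> x) ` H \<subseteq> (\<lambda>v. K #> (SOME x. x \<in> H \<and> F x = v)) ` (F ` H)"
  proof
    fix C assume "C \<in> (\<lambda>x. K #> x) ` H"
    then obtain x where x: "x \<in> H" "C = K #> x" by blast
    let ?y = "SOME y. y \<in> H \<and> F y = F x"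
    have "?y \<in> H \<and> F ?y = F x" by (rule someI[of _ x]) (use x in simp)
    then have "C = K #> ?y" using eq[of x ?y] x by simp
    then show "C \<in> (\<lambda>v. K #> (SOME x. x \<in> H \<and> F x = v)) ` (F ` H)" using x by blast
  qed
  then have "finite ((\<lambda>x. K #> x) ` H)" using assms(4) finite_subset by blast
  then show ?thesis using assms by (simp add: fi_subgroup_def finite_index_iff)
qed

lemma fi_subgroupD:
  assumes "fi_subgroup G H K"
  shows "subgroup K G" "K \<subseteq> H" "finite ((\<lambda>x. K #> x) ` H)"
  using assms by (auto simp: fi_subgroup_def finite_index_iff)

lemma fi_subgroup_refl: "subgroup H G \<Longrightarrow> fi_subgroup G H H"
  by (rule fi_subgroupI[where F = "\<lambda>_. ()"])
    (auto simp: subgroup.subset subgroup.m_closed subgroup.m_inv_closed)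

lemma fi_subgroup_transversal:
  assumes "fi_subgroup G H K" "H \<subseteq> carrier G"
  obtains t where "\<And>x. x \<in> H \<Longrightarrow> t x \<in> H" "\<And>x. x \<in> H \<Longrightarrow> x \<otimes> inv (t x) \<in> K"
    "\<And>x y. K #> x = K #> y \<Longrightarrow> t x = t y" "finite (t ` H)"
proof -
  note K = fi_subgroupD[OF assms(1)]
  define t where "t x = (SOME y. y \<in> H \<and> K #> y = K #> x)" for x
  have t: "t x \<in> H \<and> K #> t x = K #> x" if "x \<in> H" for x
    unfolding t_def by (rule someI[of _ x]) (use that in simp)
  have 1: "t x = t y" if "K #> x = K #> y" for x y using that by (simp add: t_def)
  have "t ` H \<subseteq> (\<lambda>C. SOME y. y \<in> H \<and> K #> y = C) ` ((\<lambda>x. K #> x) ` H)"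
    by (auto simp: t_def)
  then have "finite (t ` H)" using K(3) finite_subset by blast
  moreover have "x \<otimes> inv (t x) \<in> K" if "x \<in> H" for x
    using r_coset_eq_iff[OF K(1), of x "t x"] t[OF that] that assms(2) by auto
  ultimately show ?thesis using that[of t] t 1 by blast
qed

lemma fi_subgroup_trans:
  assumes "fi_subgroup G H K" "fi_subgroup G K J" "H \<subseteq> carrier G"
  shows "fi_subgroup G H J"
proof -
  note K = fi_subgroupD[OF assms(1)] and J = fi_subgroupD[OF assms(2)]
  obtain t where t: "\<And>x. x \<in> H \<Longrightarrow> t x \<in> H" "\<And>x. x \<in> H \<Longrightarrow> x \<otimes> inv (t x) \<in> K"
      and fin: "finite (t ` H)"
    using fi_subgroup_transversal[OF assms(1,3)] by metis
  have Kc: "K \<subseteq> carrier G" using K(1) by (rule subgroup.subset)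
  show ?thesis
  proof (rule fi_subgroupI[where F = "\<lambda>x. (t x, J #> (x \<otimes> inv (t x)))"])
    have "(\<lambda>x. (t x, J #> (x \<otimes> inv (t x)))) ` H \<subseteq> t ` H \<times> (\<lambda>x. J #> x) ` K"
      using t by auto
    then show "finite ((\<lambda>x. (t x, J #> (x \<otimes> inv (t x)))) ` H)"
      using fin J(3) finite_subset by blast
  next
    fix x y assume xy: "x \<in> H" "y \<in> H" "(t x, J #> (x \<otimes> inv (t x))) = (t y, J #> (y \<otimes> inv (t y)))"
    then have c: "x \<in> carrier G" "y \<in> carrier G" "t y \<in> carrier G" using t assms(3) by auto
    have "(x \<otimes> inv (t y)) \<otimes> inv (y \<otimes> inv (t y)) \<in> J"
    proof (rule r_coset_eq_iff[OF J(1), THEN iffD1])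
      show "J #> (x \<otimes> inv t y) = J #> (y \<otimes> inv t y)" using xy(3) by (metis prod.inject)
    qed (use c in auto)
    moreover have "(x \<otimes> inv (t y)) \<otimes> inv (y \<otimes> inv (t y)) = x \<otimes> inv y"
    proof -
      have "(x \<otimes> inv (t y)) \<otimes> (t y \<otimes> inv y) = x \<otimes> (inv (t y) \<otimes> (t y \<otimes> inv y))"
        using c by (simp add: m_assoc)
      also have "inv (t y) \<otimes> (t y \<otimes> inv y) = inv y" using c by (simp flip: m_assoc)
      finally show ?thesis using c by (simp add: inv_mult_group)
    qed
    ultimately show "x \<otimes> inv y \<in> J" by simp
  qed (use J K assms in auto)
qed

lemma fi_subgroup_Int_subgroup:
  assumes "fi_subgroup G H K" "subgroup J G" "J \<subseteq> H"
  shows "fi_subgroup G J (J \<inter> K)"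
proof (rule fi_subgroupI[where F = "\<lambda>x. K #> x"])
  note K = fi_subgroupD[OF assms(1)]
  show "subgroup (J \<inter> K) G" using assms(2) K(1) by (rule subgroups_Inter_pair)
  show "finite ((#>) K ` J)" using K(3) assms(3) by (meson finite_subset image_mono)
  show "J \<subseteq> carrier G" using assms(2) by (rule subgroup.subset)
  fix x y assume xy: "x \<in> J" "y \<in> J" "K #> x = K #> y"
  then have "x \<otimes> inv y \<in> K"
    using r_coset_eq_iff[OF K(1)] subgroup.mem_carrier[OF assms(2)] by blast
  then show "x \<otimes> inv y \<in> J \<inter> K"
    using xy assms(2) by (simp add: subgroup.m_closed subgroup.m_inv_closed)
qed auto

lemma fi_subgroup_Int:
  assumes "fi_subgroup G H K" "fi_subgroup G H K'" "H \<subseteq> carrier G"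
  shows "fi_subgroup G H (K \<inter> K')"
  using fi_subgroup_trans[OF assms(1) fi_subgroup_Int_subgroup[OF assms(2)]] assms
  by (simp add: fi_subgroupD)

lemma fi_subgroup_INT:
  assumes "finite I" "subgroup H G" "\<And>i. i \<in> I \<Longrightarrow> fi_subgroup G H (K i)"
  shows "fi_subgroup G H {x \<in> H. \<forall>i\<in>I. x \<in> K i}"
  using assms
proof (induction I)
  case empty
  then show ?case by (simp add: fi_subgroup_refl)
next
  case (insert i I)
  have "{x \<in> H. \<forall>j\<in>insert i I. x \<in> K j} = K i \<inter> {x \<in> H. \<forall>j\<in>I. x \<in> K j}"
    using fi_subgroupD(2)[OF insert.prems(2), of i] by auto
  then show ?case using insert by (simp add: fi_subgroup_Int subgroup.subset)
qed

lemma fi_subgroup_mono: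
  assumes "fi_subgroup G H K" "subgroup J G" "K \<subseteq> J" "J \<subseteq> H" "H \<subseteq> carrier G"
  shows "fi_subgroup G H J"
proof (rule fi_subgroupI[where F = "\<lambda>x. K #> x"])
  fix x y assume "x \<in> H" "y \<in> H" "K #> x = K #> y"
  then show "x \<otimes> inv y \<in> J"
    using r_coset_eq_iff[OF fi_subgroupD(1)[OF assms(1)]] assms by blast
qed (use assms fi_subgroupD in auto)

lemma fi_subgroup_finite:
  assumes "fi_subgroup G H K" "finite K" "H \<subseteq> carrier G"
  shows "finite H"
proof -
  note K = fi_subgroupD[OF assms(1)]
  have "H \<subseteq> \<Union>((\<lambda>x. K #> x) ` H)"
    using rcos_self[OF _ K(1)] assms(3) by auto
  moreover have "finite (K #> x)" for x using assms(2) by (simp add: r_coset_def)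
  then have "finite (\<Union>((\<lambda>x. K #> x) ` H))" using K(3) by blast
  ultimately show ?thesis by (rule finite_subset)
qed

text \<open>\<open>H\<close> permutes the finitely many cosets of \<open>K\<close>, and \<open>N\<close> is the kernel of this permutation
  action, that is, the intersection of the conjugates of \<open>K\<close>.\<close>

lemma fi_subgroup_core:
  assumes "fi_subgroup G H K" "subgroup H G"
  obtains N where "fi_subgroup G H N" "N \<subseteq> K" "\<And>x y. x \<in> H \<Longrightarrow> y \<in> N \<Longrightarrow> x \<otimes> y \<otimes> inv x \<in> N"
proof -
  note K = fi_subgroupD[OF assms(1)]
  interpret H: subgroup H G by fact
  interpret K: subgroup K G by (rule K)
  define N where "N = {n \<in> H. \<forall>x\<in>H. x \<otimes> n \<otimes> inv x \<in> K}"
  have sub: "subgroup N G"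
  proof
    fix a b assume ab: "a \<in> N" "b \<in> N"
    have "x \<otimes> (a \<otimes> b) \<otimes> inv x \<in> K" if x: "x \<in> H" for x
    proof -
      have "(x \<otimes> a \<otimes> inv x) \<otimes> (x \<otimes> b \<otimes> inv x) \<in> K" using ab x by (simp add: N_def)
      moreover have "a \<in> carrier G" "b \<in> carrier G" "x \<in> carrier G"
        using ab x H.subset by (auto simp: N_def)
      then have "(x \<otimes> a \<otimes> inv x) \<otimes> (x \<otimes> b \<otimes> inv x) = x \<otimes> (a \<otimes> b) \<otimes> inv x"
        by (simp add: m_assoc cancel_left)
      ultimately show ?thesis by simp
    qed
    then show "a \<otimes> b \<in> N" using ab by (simp add: N_def)
  next
    fix a assume a: "a \<in> N"
    have "x \<otimes> inv a \<otimes> inv x \<in> K" if x: "x \<in> H" for x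
    proof -
      have "inv (x \<otimes> a \<otimes> inv x) \<in> K" using a x by (simp add: N_def)
      moreover have "a \<in> carrier G" "x \<in> carrier G" using a x H.subset by (auto simp: N_def)
      then have "inv (x \<otimes> a \<otimes> inv x) = x \<otimes> inv a \<otimes> inv x"
        by (simp add: m_assoc inv_mult_group)
      ultimately show ?thesis by simp
    qed
    then show "inv a \<in> N" using a by (simp add: N_def)
  qed (auto simp: N_def)
  have NK: "N \<subseteq> K"
  proof
    fix n assume "n \<in> N"
    then have "\<one> \<otimes> n \<otimes> inv \<one> \<in> K" "n \<in> carrier G"
      unfolding N_def using H.subset H.one_closed by blast+
    then show "n \<in> K" by simp
  qed
  have norm: "x \<otimes> y \<otimes> inv x \<in> N" if x: "x \<in> H" and y: "y \<in> N" for x y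
  proof -
    have "z \<otimes> (x \<otimes> y \<otimes> inv x) \<otimes> inv z \<in> K" if z: "z \<in> H" for z
    proof -
      have "(z \<otimes> x) \<otimes> y \<otimes> inv (z \<otimes> x) \<in> K" using x y z by (simp add: N_def)
      moreover have "x \<in> carrier G" "y \<in> carrier G" "z \<in> carrier G"
        using x y z H.subset by (auto simp: N_def)
      ultimately show ?thesis by (simp add: m_assoc inv_mult_group)
    qed
    then show ?thesis using x y by (simp add: N_def)
  qed
  let ?\<C> = "(\<lambda>x. K #> x) ` H"
  let ?F = "\<lambda>n. \<lambda>C\<in>?\<C>. C #> n"
  have "fi_subgroup G H N"
  proof (rule fi_subgroupI[where F = ?F])
    have "?F ` H \<subseteq> ?\<C> \<rightarrow>\<^sub>E ?\<C>"
      by (auto simp: PiE_iff coset_mult_assoc K.subset)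
    then show "finite (?F ` H)"
      using K(3) by (meson finite_PiE finite_subset)
  next
    fix a b assume ab: "a \<in> H" "b \<in> H" "?F a = ?F b"
    have "x \<otimes> (a \<otimes> inv b) \<otimes> inv x \<in> K" if x: "x \<in> H" for x
    proof -
      have "K #> x #> a = K #> x #> b"
        using fun_cong[OF ab(3), of "K #> x"] x by simp
      then have "K #> (x \<otimes> a) = K #> (x \<otimes> b)" using x ab by (simp add: coset_mult_assoc K.subset)
      then have "(x \<otimes> a) \<otimes> inv (x \<otimes> b) \<in> K" using r_coset_eq_iff[OF K(1)] x ab by simp
      then show ?thesis using x ab by (simp add: inv_mult_group m_assoc)
    qed
    then show "a \<otimes> inv b \<in> N" using ab by (simp add: N_def)
  qed (use sub in \<open>auto simp: N_def\<close>)
  with NK norm that show ?thesis by blast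
qed

lemma fi_subgroup_pow:
  assumes "fi_subgroup G H K" "subgroup H G" "x \<in> H"
  obtains r :: nat where "r > 0" "x [^] r \<in> K"
proof -
  note K = fi_subgroupD[OF assms(1)]
  interpret H: subgroup H G by fact
  have pow: "x [^] n \<in> H" for n :: nat using assms(3) by (induction n) auto
  have "range (\<lambda>n::nat. K #> x [^] n) \<subseteq> (\<lambda>x. K #> x) ` H" using pow by blast
  then have "finite (range (\<lambda>n::nat. K #> x [^] n))" using K(3) finite_subset by blast
  then have "\<not> inj (\<lambda>n::nat. K #> x [^] n)" using finite_imageD infinite_UNIV_nat by blast
  then obtain i j :: nat where ij: "i \<noteq> j" "K #> x [^] i = K #> x [^] j"
    unfolding inj_def by blast
  obtain m n :: nat where mn: "m < n" "K #> x [^] n = K #> x [^] m"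
  proof (cases "i < j")
    case True
    with ij that[of i j] show ?thesis by simp
  next
    case False
    with ij that[of j i] show ?thesis by simp
  qed
  have xc: "x \<in> carrier G" using assms(3) by (rule H.mem_carrier)
  have "x [^] n \<otimes> inv (x [^] m) \<in> K" using r_coset_eq_iff[OF K(1)] mn xc by simp
  moreover have "x [^] n = x [^] (n - m) \<otimes> x [^] m" using mn xc by (simp add: nat_pow_mult)
  then have "x [^] n \<otimes> inv (x [^] m) = x [^] (n - m)" using xc by (simp add: m_assoc)
  ultimately show ?thesis using that[of "n - m"] mn by simp
qed

text \<open>Schreier's lemma: with a transversal \<open>t\<close>, the elements \<open>c \<otimes> s \<otimes> inv (t (c \<otimes> s))\<close>, for
  \<open>c\<close> in the transversal and \<open>s\<close> a generator or the inverse of one, generate \<open>K\<close> up to the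
  representative of \<open>K\<close> itself.\<close>

lemma schreier:
  assumes S: "finite S" "S \<subseteq> carrier G" and fi: "fi_subgroup G (generate G S) K"
  obtains U where "finite U" "U \<subseteq> carrier G" "generate G U = K"
proof -
  let ?H = "generate G S"
  note K = fi_subgroupD[OF fi]
  interpret K: subgroup K G by (rule K)
  interpret H: subgroup ?H G by (rule generate_is_subgroup[OF S(2)])
  obtain t where t: "\<And>x. x \<in> ?H \<Longrightarrow> t x \<in> ?H" "\<And>x. x \<in> ?H \<Longrightarrow> x \<otimes> inv (t x) \<in> K"
      "\<And>x y. K #> x = K #> y \<Longrightarrow> t x = t y" and fin: "finite (t ` ?H)"
    using fi_subgroup_transversal[OF fi H.subset] by metis
  have tt: "t (t x) = t x" if "x \<in> ?H" for x
  proof -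
    have "K #> x = K #> t x" using t(1,2)[OF that] that by (subst r_coset_eq_iff[OF K(1)]) auto
    then show ?thesis using t(3) by metis
  qed
  let ?S = "S \<union> (\<lambda>s. inv s) ` S"
  define V where "V = (\<lambda>(c, s). c \<otimes> s \<otimes> inv (t (c \<otimes> s))) ` (t ` ?H \<times> ?S)"
  have SH: "?S \<subseteq> ?H" by (auto intro: generate.incl generate.inv)
  have VK: "V \<subseteq> K" unfolding V_def using t(1,2) SH by auto
  interpret V: subgroup "generate G V" G
    using VK K.subset by (intro generate_is_subgroup) auto
  define R where "R = (\<lambda>x. \<forall>c \<in> t ` ?H. c \<otimes> x \<otimes> inv (t (c \<otimes> x)) \<in> generate G V)"
  have R_mult: "R (x \<otimes> y)" if xy: "x \<in> ?H" "y \<in> ?H" "R x" "R y" for x y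
    unfolding R_def
  proof
    fix c assume c: "c \<in> t ` ?H"
    then have cH: "c \<in> ?H" using t(1) by auto
    let ?c' = "t (c \<otimes> x)"
    have c': "?c' \<in> t ` ?H" "?c' \<in> ?H" using cH xy t(1) by auto
    note carr = H.mem_carrier[OF cH] H.mem_carrier[OF c'(2)] H.mem_carrier[OF xy(1)] H.mem_carrier[OF xy(2)]
    have "K #> (?c' \<otimes> y) = K #> ?c' #> y" using carr by (simp add: coset_mult_assoc K.subset)
    also have "K #> ?c' = K #> (c \<otimes> x)"
      using t(2)[of "c \<otimes> x"] r_coset_eq_iff[OF K(1), of "c \<otimes> x" ?c'] cH xy carr by simp
    finally have "K #> (?c' \<otimes> y) = K #> (c \<otimes> (x \<otimes> y))"
      using carr by (simp add: coset_mult_assoc K.subset m_assoc)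
    then have eq: "t (?c' \<otimes> y) = t (c \<otimes> (x \<otimes> y))" by (rule t(3))
    have "t (c \<otimes> (x \<otimes> y)) \<in> ?H" using t(1) cH xy by simp
    note carr = carr H.mem_carrier[OF this]
    have "(c \<otimes> x \<otimes> inv ?c') \<otimes> (?c' \<otimes> y \<otimes> inv (t (?c' \<otimes> y))) \<in> generate G V"
      using xy(3,4) c c'(1) unfolding R_def by (blast intro!: V.m_closed[of "c \<otimes> x \<otimes> inv (t (c \<otimes> x))"])
    also have "(c \<otimes> x \<otimes> inv ?c') \<otimes> (?c' \<otimes> y \<otimes> inv (t (?c' \<otimes> y)))
        = c \<otimes> x \<otimes> (inv ?c' \<otimes> (?c' \<otimes> (y \<otimes> inv (t (c \<otimes> (x \<otimes> y))))))"
      using carr by (simp add: eq m_assoc)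
    also have "inv ?c' \<otimes> (?c' \<otimes> (y \<otimes> inv (t (c \<otimes> (x \<otimes> y))))) = y \<otimes> inv (t (c \<otimes> (x \<otimes> y)))"
      using carr by (simp flip: m_assoc)
    finally show "c \<otimes> (x \<otimes> y) \<otimes> inv (t (c \<otimes> (x \<otimes> y))) \<in> generate G V"
      using carr by (simp add: m_assoc)
  qed
  have R: "R x" if "x \<in> ?H" for x
    using that
  proof (induction x rule: generate.induct)
    case one
    show ?case unfolding R_def
    proof
      fix c assume "c \<in> t ` ?H"
      then have "t c = c" "c \<in> ?H" using tt t(1) by auto
      then show "c \<otimes> \<one> \<otimes> inv t (c \<otimes> \<one>) \<in> generate G V" by simp
    qed
  next
    case (incl h)
    then show ?case unfolding R_def V_def by (auto intro!: generate.incl)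
  next
    case (inv h)
    then show ?case unfolding R_def V_def by (auto intro!: generate.incl)
  next
    case (eng h1 h2)
    then show ?case using R_mult by blast
  qed
  let ?t1 = "t \<one>"
  have t1: "?t1 \<in> ?H" "?t1 \<in> K"
  proof -
    show "?t1 \<in> ?H" using t(1) by simp
    then have "inv ?t1 \<in> K" using t(2)[of \<one>] by simp
    then show "?t1 \<in> K" using K.m_inv_closed \<open>?t1 \<in> ?H\<close> by fastforce
  qed
  let ?U = "insert ?t1 V"
  have UK: "?U \<subseteq> K" using VK t1 by blast
  interpret U: subgroup "generate G ?U" G using UK K.subset by (intro generate_is_subgroup) auto
  have "K \<subseteq> generate G ?U"
  proof
    fix x assume x: "x \<in> K"
    then have xH: "x \<in> ?H" using K by blast
    have "t (?t1 \<otimes> x) = t \<one>"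
      by (rule t(3)) (use x t1 in \<open>simp add: r_coset_eq_iff[OF K(1)]\<close>)
    then have "?t1 \<otimes> x \<otimes> inv ?t1 \<in> generate G V" 
    proof -
      have "t \<one> \<in> t ` ?H" by simp
      then have "?t1 \<otimes> x \<otimes> inv (t (?t1 \<otimes> x)) \<in> generate G V" using R[OF xH] unfolding R_def by blast
      then show ?thesis by (simp add: \<open>t (?t1 \<otimes> x) = t \<one>\<close>)
    qed
    then have "?t1 \<otimes> x \<otimes> inv ?t1 \<in> generate G ?U" using mono_generate[of V ?U] by blast
    moreover have u: "?t1 \<in> generate G ?U" by (rule generate.incl) simp
    ultimately have "inv ?t1 \<otimes> (?t1 \<otimes> x \<otimes> inv ?t1) \<otimes> ?t1 \<in> generate G ?U"
      by simp
    moreover have "inv ?t1 \<otimes> (?t1 \<otimes> x \<otimes> inv ?t1) \<otimes> ?t1 = x"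
    proof -
      have c: "?t1 \<in> carrier G" "x \<in> carrier G" using x t1 by auto
      have "inv ?t1 \<otimes> (?t1 \<otimes> x \<otimes> inv ?t1) \<otimes> ?t1 = inv ?t1 \<otimes> (?t1 \<otimes> x)"
        using c by (simp add: m_assoc)
      also have "\<dots> = x" using c by (simp flip: m_assoc)
      finally show ?thesis .
    qed
    ultimately show "x \<in> generate G ?U" by simp
  qed
  moreover have "generate G ?U \<subseteq> K" by (rule generate_subgroup_incl[OF UK K(1)])
  moreover have "finite ?U" unfolding V_def using fin S by simp
  ultimately show ?thesis using that[of ?U] UK K.subset by blast
qed

end


section \<open>Virtually poly-\<open>\<int>\<close> groups\<close>

text \<open>Passing to a subgroup of finite index is allowed before each extension, so that the class is
  closed under subgroups and under finite extensions by construction. The least \<open>n\<close> is the Hirsch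
  length.\<close>

primrec virtually_poly_Z :: "('a, 'b) monoid_scheme \<Rightarrow> nat \<Rightarrow> 'a set \<Rightarrow> bool" where
  "virtually_poly_Z G 0 H \<longleftrightarrow> finite H"
| "virtually_poly_Z G (Suc n) H \<longleftrightarrow>
     (\<exists>K (\<phi> :: 'a \<Rightarrow> int). fi_subgroup G H K \<and> (\<forall>x\<in>K. \<forall>y\<in>K. \<phi> (x \<otimes>\<^bsub>G\<^esub> y) = \<phi> x + \<phi> y) \<and>
       virtually_poly_Z G n {x \<in> K. \<phi> x = 0})"

context group
begin

context
  fixes K :: "'a set" and \<phi> :: "'a \<Rightarrow> 'c :: comm_ring_1"
  assumes K: "subgroup K G" and \<phi>: "\<And>x y. x \<in> K \<Longrightarrow> y \<in> K \<Longrightarrow> \<phi> (x \<otimes> y) = \<phi> x + \<phi> y"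
begin

interpretation K: subgroup K G by (rule K)

lemma additive_one: "\<phi> \<one> = 0"
  using \<phi>[of \<one> \<one>] by simp

lemma additive_inv: "x \<in> K \<Longrightarrow> \<phi> (inv x) = - \<phi> x"
  using \<phi>[of "inv x" x] additive_one by (simp add: eq_neg_iff_add_eq_0)

lemma additive_pow: "x \<in> K \<Longrightarrow> \<phi> (x [^] (n::nat)) = of_nat n * \<phi> x"
proof (induction n)
  case (Suc n)
  have "x [^] n \<in> K" using Suc.prems by (induction n) auto
  with Suc show ?case by (simp add: \<phi> algebra_simps)
qed (simp add: additive_one)

lemma additive_int_pow:
  assumes "x \<in> K"
  shows "\<phi> (x [^] (k::int)) = of_int k * \<phi> x"
proof -
  have pow: "x [^] n \<in> K" for n :: nat using assms by (induction n) auto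
  show ?thesis
  proof (cases "k < 0")
    case True
    then have "x [^] k = inv (x [^] nat (- k))" by (subst int_pow_def2) simp
    then have "\<phi> (x [^] k) = - (of_nat (nat (- k)) * \<phi> x)"
      by (simp only: additive_inv[OF pow] additive_pow[OF assms])
    also have "of_nat (nat (- k)) = (of_int (- k) :: 'c)" using True by (intro of_nat_nat) simp
    finally show ?thesis by simp
  next
    case False
    then have "x [^] k = x [^] nat k" by (subst int_pow_def2) simp
    moreover have "of_nat (nat k) = (of_int k :: 'c)" using False by (intro of_nat_nat) simp
    ultimately show ?thesis by (simp only: additive_pow[OF assms])
  qed
qed

lemma additive_kernel: "subgroup {x \<in> K. \<phi> x = 0} G"
  by standard (auto simp: additive_one additive_inv \<phi>)

end

lemma virtually_poly_Z_SucE: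
  assumes "virtually_poly_Z G (Suc n) H"
  obtains K and \<phi> :: "'a \<Rightarrow> int" where "fi_subgroup G H K"
    "\<And>x y. x \<in> K \<Longrightarrow> y \<in> K \<Longrightarrow> \<phi> (x \<otimes> y) = \<phi> x + \<phi> y"
    "virtually_poly_Z G n {x \<in> K. \<phi> x = 0}"
  using assms unfolding virtually_poly_Z.simps by blast

lemma virtually_poly_Z_subgroup:
  "virtually_poly_Z G n H \<Longrightarrow> subgroup J G \<Longrightarrow> J \<subseteq> H \<Longrightarrow> virtually_poly_Z G n J"
proof (induction n arbitrary: H J)
  case 0
  then show ?case using finite_subset by auto
next
  case (Suc n)
  obtain K and \<phi> :: "'a \<Rightarrow> int" where K: "fi_subgroup G H K"
    and \<phi>: "\<And>x y. x \<in> K \<Longrightarrow> y \<in> K \<Longrightarrow> \<phi> (x \<otimes> y) = \<phi> x + \<phi> y"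
    and N: "virtually_poly_Z G n {x \<in> K. \<phi> x = 0}" using virtually_poly_Z_SucE[OF Suc.prems(1)] by blast
  have fi: "fi_subgroup G J (J \<inter> K)" using fi_subgroup_Int_subgroup[OF K] Suc.prems by blast
  have "subgroup {x \<in> J \<inter> K. \<phi> x = 0} G"
    by (rule additive_kernel[OF fi_subgroupD(1)[OF fi]]) (use \<phi> in auto)
  then have "virtually_poly_Z G n {x \<in> J \<inter> K. \<phi> x = 0}" by (rule Suc.IH[OF N]) auto
  with fi \<phi> show ?case by (auto intro!: exI[of _ "J \<inter> K"] exI[of _ \<phi>])
qed

lemma virtually_poly_Z_Suc:
  assumes "virtually_poly_Z G n H" "subgroup H G"
  shows "virtually_poly_Z G (Suc n) H"
  using assms by (auto intro!: exI[of _ H] exI[of _ "\<lambda>_. 0"] fi_subgroup_refl)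

lemma virtually_poly_Z_fi:
  assumes "virtually_poly_Z G n K" "fi_subgroup G H K" "subgroup H G"
  shows "virtually_poly_Z G n H"
proof (cases n)
  case 0
  then show ?thesis using assms fi_subgroup_finite by (simp add: subgroup.subset)
next
  case (Suc m)
  obtain J and \<phi> :: "'a \<Rightarrow> int" where J: "fi_subgroup G K J"
    and \<phi>: "\<And>x y. x \<in> J \<Longrightarrow> y \<in> J \<Longrightarrow> \<phi> (x \<otimes> y) = \<phi> x + \<phi> y"
    and N: "virtually_poly_Z G m {x \<in> J. \<phi> x = 0}"
    using assms(1) unfolding Suc by (rule virtually_poly_Z_SucE) blast
  have "fi_subgroup G H J" by (rule fi_subgroup_trans[OF assms(2) J subgroup.subset[OF assms(3)]])
  with \<phi> N show ?thesis unfolding Suc by (auto intro!: exI[of _ J] exI[of _ \<phi>])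
qed

lemma virtually_poly_Z_finitely_generated:
  assumes "virtually_poly_Z G n H" "subgroup H G"
  obtains S where "finite S" "S \<subseteq> carrier G" "generate G S = H"
proof -
  have "\<exists>S. finite S \<and> S \<subseteq> carrier G \<and> generate G S = H"
    using assms
  proof (induction n arbitrary: H)
    case 0
    then have "generate G H = H"
      using generate_subgroup_incl[of H H] by (auto intro: generate.incl)
    moreover have "finite H" "H \<subseteq> carrier G" using 0 subgroup.subset by auto
    ultimately show ?case by blast
  next
    case (Suc n)
    obtain K and \<phi> :: "'a \<Rightarrow> int" where K: "fi_subgroup G H K"
      and \<phi>: "\<And>x y. x \<in> K \<Longrightarrow> y \<in> K \<Longrightarrow> \<phi> (x \<otimes> y) = \<phi> x + \<phi> y"
      and N: "virtually_poly_Z G n {x \<in> K. \<phi> x = 0}" using virtually_poly_Z_SucE[OF Suc.prems(1)] by blast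
    note Ksub = fi_subgroupD[OF K]
    interpret K: subgroup K G by (rule Ksub)
    interpret H: subgroup H G by (rule Suc.prems)
    obtain S where S: "finite S" "S \<subseteq> carrier G" "generate G S = {x \<in> K. \<phi> x = 0}"
      using Suc.IH[OF N additive_kernel[of K \<phi>, OF Ksub(1) \<phi>]] by blast
    \<comment> \<open>An element with the least positive value of \<open>\<bar>\<phi>\<bar>\<close>, if there is one.\<close>
    have "\<exists>t\<in>K. \<forall>x\<in>K. \<phi> t dvd \<phi> x"
    proof (cases "\<exists>x\<in>K. \<phi> x \<noteq> 0")
      case True
      then obtain t0 where t0: "t0 \<in> K \<and> \<phi> t0 \<noteq> 0" by blast
      obtain t where t: "t \<in> K \<and> \<phi> t \<noteq> 0"
        and least: "\<forall>y. y \<in> K \<and> \<phi> y \<noteq> 0 \<longrightarrow> nat \<bar>\<phi> t\<bar> \<le> nat \<bar>\<phi> y\<bar>"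
        using ex_has_least_nat[of "\<lambda>x. x \<in> K \<and> \<phi> x \<noteq> 0" t0 "\<lambda>x. nat \<bar>\<phi> x\<bar>", OF t0] by blast
      have "\<phi> t dvd \<phi> x" if x: "x \<in> K" for x
      proof (rule ccontr)
        assume "\<not> \<phi> t dvd \<phi> x"
        then have ne: "\<phi> x mod \<phi> t \<noteq> 0" by (simp add: dvd_eq_mod_eq_0)
        let ?y = "x \<otimes> inv (t [^] (\<phi> x div \<phi> t))"
        have tp: "t [^] k \<in> K" for k :: int using t by (intro subgroup_int_pow_closed[OF Ksub(1)]) simp
        have "\<phi> ?y = \<phi> x mod \<phi> t"
          using x tp by (simp add: \<phi> additive_inv[OF Ksub(1) \<phi>] additive_int_pow[OF Ksub(1) \<phi> conjunct1[OF t]]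
              minus_div_mult_eq_mod)
        moreover have "?y \<in> K" using x tp by simp
        moreover have "\<bar>\<phi> x mod \<phi> t\<bar> < \<bar>\<phi> t\<bar>" using t by (intro abs_mod_less) simp
        ultimately show False using least[rule_format, of ?y] ne by simp
      qed
      with t show ?thesis by blast
    next
      case False
      then show ?thesis by (intro bexI[of _ \<one>]) auto
    qed
    then obtain t where t: "t \<in> K" and dvd: "\<And>x. x \<in> K \<Longrightarrow> \<phi> t dvd \<phi> x" by blast
    obtain c where c: "\<And>x. x \<in> H \<Longrightarrow> c x \<in> H" "\<And>x. x \<in> H \<Longrightarrow> x \<otimes> inv (c x) \<in> K" "finite (c ` H)"
      using fi_subgroup_transversal[OF K H.subset] by metis
    let ?S = "insert t S \<union> c ` H"
    have SK: "S \<subseteq> K" using S(3) generate.incl[of _ S G] by blast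
    have SH: "?S \<subseteq> H" using SK t Ksub(2) c(1) by auto
    interpret gS: subgroup "generate G ?S" G
      using SH H.subset by (intro generate_is_subgroup) auto
    have Kgen: "K \<subseteq> generate G ?S"
    proof
      fix x assume x: "x \<in> K"
      obtain k where k: "\<phi> x = \<phi> t * k" using dvd[OF x] by (auto simp: dvd_def)
      have tp: "t [^] k \<in> K" using t by (intro subgroup_int_pow_closed[OF Ksub(1)]) simp
      have "x \<otimes> inv (t [^] k) \<in> generate G S"
        unfolding S(3) using x tp k
        by (simp add: \<phi> additive_inv[OF Ksub(1) \<phi>] additive_int_pow[OF Ksub(1) \<phi> t])
      then have "x \<otimes> inv (t [^] k) \<in> generate G ?S" using mono_generate[of S ?S] by blast
      moreover have "t [^] k \<in> generate G ?S"
        by (rule subgroup_int_pow_closed[OF gS.subgroup_axioms]) (auto intro: generate.incl)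
      ultimately have "x \<otimes> inv (t [^] k) \<otimes> t [^] k \<in> generate G ?S" by (rule gS.m_closed)
      then show "x \<in> generate G ?S" using x tp by (simp add: m_assoc)
    qed
    have "H \<subseteq> generate G ?S"
    proof
      fix x assume x: "x \<in> H"
      have "x \<otimes> inv (c x) \<in> generate G ?S" using c(2)[OF x] Kgen by blast
      moreover have "c x \<in> generate G ?S" using x by (intro generate.incl) simp
      ultimately have "x \<otimes> inv (c x) \<otimes> c x \<in> generate G ?S" by (rule gS.m_closed)
      then show "x \<in> generate G ?S" using x c(1)[OF x] by (simp add: m_assoc)
    qed
    moreover have "generate G ?S \<subseteq> H" by (rule generate_subgroup_incl[OF SH H.subgroup_axioms])
    moreover have "finite ?S" using S c by simp
    moreover have "?S \<subseteq> carrier G" using SH H.subset by (rule subset_trans)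
    ultimately show ?case by (intro exI[of _ ?S] conjI equalityI)
  qed
  then show ?thesis by (elim exE conjE) (rule that)
qed

lemma virtually_poly_Z_torsion_finite:
  "virtually_poly_Z G n H \<Longrightarrow> subgroup H G \<Longrightarrow> (\<And>x. x \<in> H \<Longrightarrow> \<exists>r::nat>0. x [^] r = \<one>) \<Longrightarrow> finite H"
proof (induction n arbitrary: H)
  case (Suc n)
  obtain K and \<phi> :: "'a \<Rightarrow> int" where K: "fi_subgroup G H K"
    and \<phi>: "\<And>x y. x \<in> K \<Longrightarrow> y \<in> K \<Longrightarrow> \<phi> (x \<otimes> y) = \<phi> x + \<phi> y"
    and N: "virtually_poly_Z G n {x \<in> K. \<phi> x = 0}" using virtually_poly_Z_SucE[OF Suc.prems(1)] by blast
  note Ksub = fi_subgroupD[OF K]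
  have "\<phi> x = 0" if "x \<in> K" for x
  proof -
    have "x \<in> H" using that Ksub(2) by blast
    from Suc.prems(3)[OF this] obtain r :: nat where r: "r > 0" "x [^] r = \<one>"
      by (elim exE conjE)
    then have "of_nat r * \<phi> x = 0"
      using additive_pow[OF Ksub(1) \<phi> that, of r] additive_one[OF Ksub(1) \<phi>] by simp
    with r show ?thesis by simp
  qed
  then have "{x \<in> K. \<phi> x = 0} = K" by blast
  then have "virtually_poly_Z G n K" using N by simp
  then have "finite K"
    by (rule Suc.IH) (use Ksub Suc.prems(3) in blast)+
  then show ?case using fi_subgroup_finite[OF K] Suc.prems(2) by (simp add: subgroup.subset)
qed simp

text \<open>This bounds the dimension of the space of homomorphisms to \<open>\<real>\<close> uniformly over all subgroups
  of finite index. The elements of \<open>T\<close> come from the infinite cyclic factors: if \<open>t\<close> lifts a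
  non-zero element of such a factor, then every \<open>x\<close> has a power that differs from a power of \<open>t\<close> by
  an element of the kernel.\<close>

lemma virtually_poly_Z_detect:
  "virtually_poly_Z G n H \<Longrightarrow> subgroup H G \<Longrightarrow>
    \<exists>T. finite T \<and> T \<subseteq> H \<and> (\<forall>K (\<phi> :: 'a \<Rightarrow> real). fi_subgroup G H K \<longrightarrow>
      (\<forall>x\<in>K. \<forall>y\<in>K. \<phi> (x \<otimes> y) = \<phi> x + \<phi> y) \<longrightarrow>
      (\<forall>t\<in>T. \<forall>r::nat>0. t [^] r \<in> K \<longrightarrow> \<phi> (t [^] r) = 0) \<longrightarrow> (\<forall>x\<in>K. \<phi> x = 0))"
proof (induction n arbitrary: H)
  case 0
  show ?case
  proof (intro exI[of _ H] conjI allI impI ballI)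
    fix K and \<phi> :: "'a \<Rightarrow> real" and x
    assume K: "fi_subgroup G H K" and x: "x \<in> K"
      and 1: "\<forall>t\<in>H. \<forall>r::nat>0. t [^] r \<in> K \<longrightarrow> \<phi> (t [^] r) = 0"
    have "x \<in> H" "x \<in> carrier G" using x fi_subgroupD[OF K] subgroup.subset by blast+
    then show "\<phi> x = 0" using 1[rule_format, of x 1] x by simp
  qed (use 0 in auto)
next
  case (Suc n)
  obtain K0 and \<psi> :: "'a \<Rightarrow> int" where K0: "fi_subgroup G H K0"
    and \<psi>: "\<And>x y. x \<in> K0 \<Longrightarrow> y \<in> K0 \<Longrightarrow> \<psi> (x \<otimes> y) = \<psi> x + \<psi> y"
    and N: "virtually_poly_Z G n {x \<in> K0. \<psi> x = 0}" using virtually_poly_Z_SucE[OF Suc.prems(1)] by blast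
  let ?N = "{x \<in> K0. \<psi> x = 0}"
  note K0sub = fi_subgroupD[OF K0]
  interpret H: subgroup H G by (rule Suc.prems)
  have Nsub: "subgroup ?N G" by (rule additive_kernel[OF K0sub(1) \<psi>])
  obtain T where T: "finite T" "T \<subseteq> ?N"
    and det: "\<forall>K (\<phi> :: 'a \<Rightarrow> real). fi_subgroup G ?N K \<longrightarrow>
      (\<forall>x\<in>K. \<forall>y\<in>K. \<phi> (x \<otimes> y) = \<phi> x + \<phi> y) \<longrightarrow>
      (\<forall>t\<in>T. \<forall>r::nat>0. t [^] r \<in> K \<longrightarrow> \<phi> (t [^] r) = 0) \<longrightarrow> (\<forall>x\<in>K. \<phi> x = 0)"
    using Suc.IH[OF N Nsub] by (elim exE conjE)
  obtain t where t: "t \<in> K0" and t0: "\<And>x. \<psi> t = 0 \<Longrightarrow> x \<in> K0 \<Longrightarrow> \<psi> x = 0"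
    using subgroup.one_closed[OF K0sub(1)] by (cases "\<exists>t\<in>K0. \<psi> t \<noteq> 0") blast+
  show ?case
  proof (intro exI[of _ "insert t T"] conjI allI impI ballI)
    show "insert t T \<subseteq> H" using T t K0sub by auto
    fix K and \<phi> :: "'a \<Rightarrow> real" and x
    assume K: "fi_subgroup G H K" and "\<forall>x\<in>K. \<forall>y\<in>K. \<phi> (x \<otimes> y) = \<phi> x + \<phi> y" and x: "x \<in> K"
      and van: "\<forall>t\<in>insert t T. \<forall>r::nat>0. t [^] r \<in> K \<longrightarrow> \<phi> (t [^] r) = 0"
    then have \<phi>: "\<And>x y. x \<in> K \<Longrightarrow> y \<in> K \<Longrightarrow> \<phi> (x \<otimes> y) = \<phi> x + \<phi> y" by blast
    note Ksub = fi_subgroupD[OF K]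
    interpret K: subgroup K G by (rule Ksub)
    interpret K0: subgroup K0 G by (rule K0sub)
    have NK: "\<phi> y = 0" if "y \<in> ?N" "y \<in> K" for y
    proof -
      have "?N \<subseteq> H" using K0sub by auto
      then have "fi_subgroup G ?N (?N \<inter> K)" using fi_subgroup_Int_subgroup[OF K Nsub] by blast
      then have "\<forall>x\<in>?N \<inter> K. \<phi> x = 0"
      proof (rule det[THEN spec, THEN spec, THEN mp, THEN mp, THEN mp])
        show "\<forall>x\<in>?N \<inter> K. \<forall>y\<in>?N \<inter> K. \<phi> (x \<otimes> y) = \<phi> x + \<phi> y" using \<phi> by blast
        show "\<forall>t\<in>T. \<forall>r::nat>0. t [^] r \<in> ?N \<inter> K \<longrightarrow> \<phi> (t [^] r) = 0"
          using van by blast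
      qed
      with that show ?thesis by blast
    qed
    have xH: "x \<in> H" using x Ksub by blast
    obtain r :: nat where r: "r > 0" "x [^] r \<in> K0"
      using fi_subgroup_pow[OF K0 H.subgroup_axioms xH] by blast
    let ?y = "x [^] r"
    have yK: "?y \<in> K" using x by (induction r) auto
    have "\<phi> ?y = 0"
    proof (cases "\<psi> t = 0")
      case True
      then show ?thesis using t0 r(2) yK NK by simp
    next
      case False
      have "t \<in> H" using t K0sub by blast
      then obtain s :: nat where s: "s > 0" "t [^] s \<in> K"
        using fi_subgroup_pow[OF K H.subgroup_axioms] by blast
      let ?u = "t [^] s"
      have u0: "?u \<in> K0" using t by (induction s) auto
      have \<psi>u: "\<psi> ?u \<noteq> 0" using additive_pow[OF K0sub(1) \<psi> t, of s] s False by simp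
      let ?z = "?y [^] \<psi> ?u \<otimes> inv (?u [^] \<psi> ?y)"
      note pw = subgroup_int_pow_closed[OF K0sub(1)] subgroup_int_pow_closed[OF Ksub(1)]
      have "\<psi> ?z = 0"
        using r(2) u0 pw by (simp add: \<psi> additive_inv[OF K0sub(1) \<psi>] additive_int_pow[OF K0sub(1) \<psi>])
      then have "?z \<in> ?N" using r(2) u0 pw by simp
      moreover have "?z \<in> K" using s(2) yK pw by simp
      ultimately have "\<phi> ?z = 0" by (rule NK)
      moreover have "\<phi> ?u = 0" using van s by blast
      ultimately have "of_int (\<psi> ?u) * \<phi> ?y = 0"
        using s(2) yK pw by (simp add: \<phi> additive_inv[OF Ksub(1) \<phi>] additive_int_pow[OF Ksub(1) \<phi>])
      then show ?thesis using \<psi>u by simp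
    qed
    then show "\<phi> x = 0" using additive_pow[OF Ksub(1) \<phi> x, of r] r by simp
  qed (use T in simp)
qed

end


section \<open>Finitely generated nilpotent groups\<close>

lemma virtually_poly_Z_restrict_carrier:
  assumes "group G" "subgroup H G"
  shows "virtually_poly_Z (G\<lparr>carrier := H\<rparr>) n J \<Longrightarrow> virtually_poly_Z G n J"
proof (induction n arbitrary: J)
  case (Suc n)
  interpret group G by fact
  have fi: "fi_subgroup (G\<lparr>carrier := H\<rparr>) J K \<Longrightarrow> fi_subgroup G J K" for K
    using incl_subgroup[OF assms(2)] by (simp add: fi_subgroup_def finite_index_def)
  obtain K and \<phi> :: "'a \<Rightarrow> int" where "fi_subgroup (G\<lparr>carrier := H\<rparr>) J K"
    "\<forall>x\<in>K. \<forall>y\<in>K. \<phi> (x \<otimes>\<^bsub>G\<^esub> y) = \<phi> x + \<phi> y" "virtually_poly_Z (G\<lparr>carrier := H\<rparr>) n {x \<in> K. \<phi> x = 0}"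
    using Suc.prems by auto
  with fi Suc.IH show ?case unfolding virtually_poly_Z.simps by blast
qed simp

context group
begin

lemma generate_insert_normal:
  assumes N: "N \<lhd> G" and z: "z \<in> carrier G" and x: "x \<in> generate G (insert z N)"
  shows "\<exists>n\<in>N. \<exists>k::int. x = n \<otimes> z [^] k"
  using x
proof (induction rule: generate.induct)
  interpret N: normal N G by fact
  {
    case one
    show ?case by (intro bexI[of _ \<one>] exI[of _ "0::int"]) auto
  next
    case (incl h)
    then show ?case
    proof
      assume "h = z" then show ?thesis
        using z by (intro bexI[of _ \<one>] exI[of _ "1::int"]) auto
    next
      assume "h \<in> N" then show ?thesis by (intro bexI[of _ h] exI[of _ "0::int"]) auto
    qed
  next
    case (inv h)
    then show ?case
    proof
      assume "h = z" then show ?thesis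
        using z by (intro bexI[of _ \<one>] exI[of _ "-1::int"]) (auto simp: int_pow_neg)
    next
      assume "h \<in> N" then show ?thesis by (intro bexI[of _ "inv h"] exI[of _ "0::int"]) auto
    qed
  next
    case (eng h1 h2)
    then obtain n1 n2 and k1 k2 :: int
      where n: "n1 \<in> N" "n2 \<in> N" "h1 = n1 \<otimes> z [^] k1" "h2 = n2 \<otimes> z [^] k2" by blast
    have "z [^] k1 \<otimes> n2 \<otimes> inv (z [^] k1) \<in> N" using n z by (simp add: N.inv_op_closed2)
    then have "n1 \<otimes> (z [^] k1 \<otimes> n2 \<otimes> inv (z [^] k1)) \<in> N" using n by simp
    moreover have "h1 \<otimes> h2 = n1 \<otimes> (z [^] k1 \<otimes> n2 \<otimes> inv (z [^] k1)) \<otimes> z [^] (k1 + k2)"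
      using n z N.subset by (auto simp: m_assoc int_pow_mult cancel_left subset_iff)
    ultimately show ?case by blast
  }
qed

text \<open>If no power of \<open>z\<close> lies in \<open>N\<close>, the extension is \<open>N \<rtimes> \<int>\<close>; otherwise \<open>N\<close> has finite index.\<close>

lemma virtually_poly_Z_cyclic_extension:
  assumes v: "virtually_poly_Z G n N" and N: "N \<lhd> G" and z: "z \<in> carrier G"
  shows "virtually_poly_Z G (Suc n) (generate G (insert z N))"
proof -
  interpret N: normal N G by fact
  let ?H = "generate G (insert z N)"
  have Hc: "insert z N \<subseteq> carrier G" using z N.subset by auto
  interpret H: subgroup ?H G by (rule generate_is_subgroup[OF Hc])
  have NH: "N \<subseteq> ?H" by (auto intro: generate.incl)
  have zp: "z [^] k \<in> ?H" for k :: int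
    by (rule subgroup_int_pow_closed[OF H.subgroup_axioms]) (auto intro: generate.incl)
  have zc: "z [^] k \<in> carrier G" for k :: int using z by simp
  obtain e :: "'a \<Rightarrow> int" where e: "\<And>x. x \<in> ?H \<Longrightarrow> \<exists>n\<in>N. x = n \<otimes> z [^] e x"
    using generate_insert_normal[OF N z] by metis
  have quot: "x \<otimes> inv y \<in> N \<longleftrightarrow> z [^] (e x - e y) \<in> N" if xy: "x \<in> ?H" "y \<in> ?H" for x y
  proof -
    obtain a where a: "a \<in> N" "x = a \<otimes> z [^] e x" using e[OF xy(1)] by (elim bexE)
    obtain b where b: "b \<in> N" "y = b \<otimes> z [^] e y" using e[OF xy(2)] by (elim bexE)
    have c: "a \<in> carrier G" "b \<in> carrier G" using a(1) b(1) by auto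
    have "x \<otimes> inv y = (a \<otimes> z [^] e x) \<otimes> inv (b \<otimes> z [^] e y)"
      by (rule arg_cong2[OF a(2) arg_cong[OF b(2)]])
    also have "\<dots> = a \<otimes> z [^] (e x - e y) \<otimes> inv b"
      using c zc z by (simp add: inv_mult_group m_assoc int_pow_diff)
    finally have eq: "x \<otimes> inv y = a \<otimes> z [^] (e x - e y) \<otimes> inv b" .
    show ?thesis
    proof
      assume "z [^] (e x - e y) \<in> N"
      then show "x \<otimes> inv y \<in> N" unfolding eq using a(1) b(1) by simp
    next
      assume "x \<otimes> inv y \<in> N"
      then have "inv a \<otimes> (a \<otimes> z [^] (e x - e y) \<otimes> inv b) \<otimes> b \<in> N" unfolding eq using a(1) b(1) by simp
      then show "z [^] (e x - e y) \<in> N" using c zc by (simp add: m_assoc cancel_left)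
    qed
  qed
  show ?thesis
  proof (cases "\<exists>r::int. r \<noteq> 0 \<and> z [^] r \<in> N")
    case True
    then obtain r :: int where r: "r \<noteq> 0" "z [^] r \<in> N" by blast
    have "fi_subgroup G ?H N"
    proof (rule fi_subgroupI[where F = "\<lambda>x. e x mod r"])
      have "(\<lambda>x. e x mod r) ` ?H \<subseteq> {- \<bar>r\<bar>..\<bar>r\<bar>}"
        using abs_mod_less[OF r(1)] by (auto simp: abs_le_iff intro: less_imp_le) (smt (verit))+
      then show "finite ((\<lambda>x. e x mod r) ` ?H)" using finite_subset by blast
    next
      fix x y assume xy: "x \<in> ?H" "y \<in> ?H" "e x mod r = e y mod r"
      then obtain q where "e x - e y = r * q" by (metis mod_eq_dvd_iff dvd_def)
      then have "z [^] (e x - e y) = (z [^] r) [^] q" using z by (simp add: int_pow_pow)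
      also have "\<dots> \<in> N" by (rule subgroup_int_pow_closed[OF N.subgroup_axioms r(2)])
      finally show "x \<otimes> inv y \<in> N" using quot xy by blast
    qed (use NH N.subgroup_axioms H.subset in auto)
    then show ?thesis using virtually_poly_Z_fi[OF v] virtually_poly_Z_Suc H.subgroup_axioms by blast
  next
    case False
    then have inj: "k = 0" if "z [^] k \<in> N" for k :: int using that by blast
    have add: "e (x \<otimes> y) = e x + e y" if xy: "x \<in> ?H" "y \<in> ?H" for x y
    proof -
      obtain a where a: "a \<in> N" "x = a \<otimes> z [^] e x" using e[OF xy(1)] by (elim bexE)
      obtain b where b: "b \<in> N" "y = b \<otimes> z [^] e y" using e[OF xy(2)] by (elim bexE)
      obtain c where c: "c \<in> N" "x \<otimes> y = c \<otimes> z [^] e (x \<otimes> y)"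
        using e[OF H.m_closed[OF xy]] by (elim bexE)
      have carr: "a \<in> carrier G" "b \<in> carrier G" "c \<in> carrier G" using a(1) b(1) c(1) by auto
      let ?b = "z [^] e x \<otimes> b \<otimes> inv (z [^] e x)"
      have b': "?b \<in> N" using b(1) zc by (simp add: N.inv_op_closed2)
      have "c \<otimes> z [^] e (x \<otimes> y) = (a \<otimes> z [^] e x) \<otimes> (b \<otimes> z [^] e y)"
        by (metis a(2) b(2) c(2))
      also have "\<dots> = a \<otimes> ?b \<otimes> z [^] (e x + e y)"
        using carr zc z by (simp add: m_assoc int_pow_mult cancel_left)
      finally have "inv c \<otimes> (c \<otimes> z [^] e (x \<otimes> y)) \<otimes> inv (z [^] (e x + e y))
          = inv c \<otimes> (a \<otimes> ?b \<otimes> z [^] (e x + e y)) \<otimes> inv (z [^] (e x + e y))" by simp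
      then have "z [^] (e (x \<otimes> y) - (e x + e y)) = inv c \<otimes> (a \<otimes> ?b)"
        using carr zc z N.mem_carrier[OF b'] by (simp add: cancel_left m_assoc int_pow_diff)
      also have "\<dots> \<in> N" using a(1) b' c(1) by simp
      finally show ?thesis using inj by fastforce
    qed
    have "{x \<in> ?H. e x = 0} = N"
    proof (intro equalityI subsetI)
      fix x assume "x \<in> {x \<in> ?H. e x = 0}"
      then have x: "x \<in> ?H" "e x = 0" by auto
      from e[OF x(1)] obtain a where "a \<in> N" "x = a \<otimes> z [^] e x" by (elim bexE)
      then show "x \<in> N" using N.mem_carrier[of a] unfolding x(2) by simp
    next
      fix x assume x: "x \<in> N"
      then have "x \<in> ?H" using NH by blast
      from e[OF this] obtain a where a: "a \<in> N" "x = a \<otimes> z [^] e x" by (elim bexE)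
      have "inv a \<otimes> x = inv a \<otimes> (a \<otimes> z [^] e x)" by (rule arg_cong[OF a(2)])
      then have "z [^] e x = inv a \<otimes> x" using a(1) zc by (simp add: cancel_left)
      then have "z [^] e x \<in> N" using a(1) x by simp
      then show "x \<in> {x \<in> ?H. e x = 0}" using inj x NH by blast
    qed
    with add v show ?thesis
      by (auto intro!: exI[of _ ?H] exI[of _ e] fi_subgroup_refl H.subgroup_axioms)
  qed
qed

abbreviation comm_elt :: "'a \<Rightarrow> 'a \<Rightarrow> 'a" where
  "comm_elt x y \<equiv> x \<otimes> y \<otimes> inv x \<otimes> inv y"

declare lower_central.simps(2) [simp del]

lemma lower_central_normal: "lower_central G n \<lhd> G"
proof (induction n)
  case (Suc n)
  then interpret N: normal "lower_central G n" G .
  let ?C = "\<Union>x \<in> lower_central G n. \<Union>y \<in> carrier G. {comm_elt x y}"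
  have "generate G ?C \<lhd> G"
  proof (rule normal_generateI)
    show "?C \<subseteq> carrier G" by auto
    fix h g assume "h \<in> ?C" and g: "g \<in> carrier G"
    then obtain x y where xy: "x \<in> lower_central G n" "y \<in> carrier G" "h = comm_elt x y" by blast
    have "g \<otimes> h \<otimes> inv g = comm_elt (g \<otimes> x \<otimes> inv g) (g \<otimes> y \<otimes> inv g)"
    proof -
      have c: "x \<in> carrier G" using N.mem_carrier[OF xy(1)] .
      show ?thesis unfolding xy(3) using c xy(2) g by (simp add: m_assoc inv_mult_group cancel_left)
    qed
    moreover have "g \<otimes> x \<otimes> inv g \<in> lower_central G n" using xy g by (simp add: N.inv_op_closed2)
    moreover have "g \<otimes> y \<otimes> inv g \<in> carrier G" using xy g by simp
    moreover have "comm_elt a b \<in> ?C" if "a \<in> lower_central G n" "b \<in> carrier G" for a b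
      using that by blast
    ultimately show "g \<otimes> h \<otimes> inv g \<in> ?C" by simp
  qed
  then show ?case by (simp add: lower_central.simps(2))
qed (simp add: normal_self)

lemma lower_central_comm:
  assumes "x \<in> lower_central G n" "y \<in> carrier G"
  shows "comm_elt x y \<in> lower_central G (Suc n)"
  using assms unfolding lower_central.simps(2) by (intro generate.incl) blast

lemma lower_central_Suc_subset: "lower_central G (Suc n) \<subseteq> lower_central G n"
proof -
  interpret N: normal "lower_central G n" G by (rule lower_central_normal)
  have "comm_elt x y \<in> lower_central G n" if "x \<in> lower_central G n" "y \<in> carrier G" for x y
  proof -
    have "x \<otimes> (y \<otimes> inv x \<otimes> inv y) \<in> lower_central G n"
      using that by (intro N.m_closed N.inv_op_closed2) auto
    then show ?thesis using that by (simp add: m_assoc)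
  qed
  then show ?thesis
    unfolding lower_central.simps(2) by (intro generate_subgroup_incl N.subgroup_axioms) blast
qed

text \<open>If \<open>h\<close> lies in the \<open>n\<close>-th term, its conjugates differ from it by commutators, which lie in the
  next term.\<close>

lemma lower_central_between:
  assumes "subgroup J G" "lower_central G (Suc n) \<subseteq> J" "J \<subseteq> lower_central G n"
  shows "J \<lhd> G"
proof (rule normal_invI[OF assms(1)])
  interpret J: subgroup J G by fact
  fix g h assume gh: "g \<in> carrier G" "h \<in> J"
  have "inv (comm_elt h g) \<in> J"
    using lower_central_comm[of h n g] assms gh by (intro J.m_inv_closed) auto
  then have "inv (comm_elt h g) \<otimes> h \<in> J" using gh by simp
  moreover have "inv (comm_elt h g) \<otimes> h = g \<otimes> h \<otimes> inv g"
    using gh by (simp add: inv_mult_group m_assoc)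
  ultimately show "g \<otimes> h \<otimes> inv g \<in> J" by simp
qed

primrec lower_central_gens :: "'a set \<Rightarrow> nat \<Rightarrow> 'a set" where
  "lower_central_gens S 0 = S"
| "lower_central_gens S (Suc n) = (\<lambda>(x, s). comm_elt x s) ` (lower_central_gens S n \<times> S)"

declare lower_central_gens.simps(2) [simp del]

text \<open>Modulo the next term of the lower central series, \<open>comm_elt\<close> is multiplicative in both
  arguments, so iterated commutators of generators suffice.\<close>

lemma lower_central_generated:
  assumes S: "S \<subseteq> carrier G" "generate G S = carrier G"
  shows "lower_central_gens S n \<subseteq> lower_central G n \<and>
    generate G (lower_central_gens S n \<union> lower_central G (Suc n)) = lower_central G n"
proof (induction n)
  case 0
  have "carrier G \<subseteq> generate G (S \<union> lower_central G (Suc 0))"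
    using S mono_generate[of S "S \<union> lower_central G (Suc 0)"] by auto
  moreover have "lower_central G (Suc 0) \<subseteq> carrier G" using lower_central_Suc_subset[of 0] by simp
  then have "generate G (S \<union> lower_central G (Suc 0)) \<subseteq> carrier G"
    using S by (intro generate_incl) auto
  ultimately show ?case using S by simp
next
  case (Suc n)
  interpret N: normal "lower_central G n" G by (rule lower_central_normal)
  interpret N1: normal "lower_central G (Suc n)" G by (rule lower_central_normal)
  let ?X = "lower_central_gens S (Suc n)"
  let ?J = "generate G (?X \<union> lower_central G (Suc (Suc n)))"
  have X: "?X \<subseteq> lower_central G (Suc n)"
  proof
    fix h assume "h \<in> ?X"
    then obtain x s where "x \<in> lower_central_gens S n" "s \<in> S" "h = comm_elt x s"
      unfolding lower_central_gens.simps(2) by (elim imageE) auto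
    then show "h \<in> lower_central G (Suc n)"
      using Suc lower_central_comm[of x n s] S(1) by blast
  qed
  have U: "?X \<union> lower_central G (Suc (Suc n)) \<subseteq> lower_central G (Suc n)"
    using X lower_central_Suc_subset[of "Suc n"] by blast
  have J: "?J \<subseteq> lower_central G (Suc n)" by (rule generate_subgroup_incl[OF U N1.subgroup_axioms])
  have U': "?X \<union> lower_central G (Suc (Suc n)) \<subseteq> carrier G" using U N1.subset by blast
  have "?J \<lhd> G"
    by (rule lower_central_between[OF generate_is_subgroup[OF U'] _ J]) (auto intro: generate.incl)
  then interpret J: normal ?J G .
  have mem_gen: "comm_elt x s \<in> ?J" if "x \<in> lower_central_gens S n" "s \<in> S" for x s
    using that unfolding lower_central_gens.simps(2) by (intro generate.incl) force
  have mem_Suc: "comm_elt x s \<in> ?J" if "x \<in> lower_central G (Suc n)" "s \<in> carrier G" for x s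
    using that lower_central_comm[of x "Suc n" s] by (intro generate.incl) blast
  have left: "comm_elt x s \<in> ?J" if s: "s \<in> S" and x: "x \<in> lower_central G n" for x s
  proof -
    have sc: "s \<in> carrier G" using s S by blast
    let ?A = "{x \<in> lower_central G n. comm_elt x s \<in> ?J}"
    have "subgroup ?A G"
    proof
      fix a b assume ab: "a \<in> ?A" "b \<in> ?A"
      then have c: "a \<in> carrier G" "b \<in> carrier G" by auto
      have "comm_elt (a \<otimes> b) s = (a \<otimes> comm_elt b s \<otimes> inv a) \<otimes> comm_elt a s"
        using c sc by (simp add: m_assoc inv_mult_group cancel_left)
      moreover have "\<dots> \<in> ?J" using ab c by - (rule J.m_closed[OF J.inv_op_closed2]; simp)
      ultimately show "a \<otimes> b \<in> ?A" using ab by simp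
    next
      fix a assume a: "a \<in> ?A"
      then have c: "a \<in> carrier G" by auto
      have "comm_elt (inv a) s = inv a \<otimes> inv (comm_elt a s) \<otimes> a"
        using c sc by (simp add: m_assoc inv_mult_group cancel_left)
      moreover have "\<dots> \<in> ?J" using a c by - (rule J.inv_op_closed1; simp)
      ultimately show "inv a \<in> ?A" using a by simp
    next
      show "?A \<subseteq> carrier G" using N.subset by blast
      have "comm_elt \<one> s = \<one>" using sc by simp
      then show "\<one> \<in> ?A" using J.one_closed N.one_closed by simp
    qed
    moreover have "lower_central_gens S n \<union> lower_central G (Suc n) \<subseteq> ?A"
      using Suc mem_gen[OF _ s] mem_Suc[OF _ sc] lower_central_Suc_subset[of n] by blast
    ultimately have "generate G (lower_central_gens S n \<union> lower_central G (Suc n)) \<subseteq> ?A"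
      by - (rule generate_subgroup_incl)
    then have "lower_central G n \<subseteq> ?A" unfolding conjunct2[OF Suc] .
    with x show ?thesis by blast
  qed
  have "comm_elt x y \<in> ?J" if x: "x \<in> lower_central G n" and y: "y \<in> carrier G" for x y
  proof -
    have xc: "x \<in> carrier G" using x by auto
    let ?A = "{y \<in> carrier G. comm_elt x y \<in> ?J}"
    have "subgroup ?A G"
    proof
      fix a b assume ab: "a \<in> ?A" "b \<in> ?A"
      then have c: "a \<in> carrier G" "b \<in> carrier G" by auto
      have "comm_elt x (a \<otimes> b) = comm_elt x a \<otimes> (a \<otimes> comm_elt x b \<otimes> inv a)"
        using c xc by (simp add: m_assoc inv_mult_group cancel_left)
      moreover have "\<dots> \<in> ?J" using ab c by - (rule J.m_closed[OF _ J.inv_op_closed2]; simp)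
      ultimately show "a \<otimes> b \<in> ?A" using ab by simp
    next
      fix a assume a: "a \<in> ?A"
      then have c: "a \<in> carrier G" by auto
      have "comm_elt x (inv a) = inv a \<otimes> inv (comm_elt x a) \<otimes> a"
        using c xc by (simp add: m_assoc inv_mult_group cancel_left)
      moreover have "\<dots> \<in> ?J" using a c by - (rule J.inv_op_closed1; simp)
      ultimately show "inv a \<in> ?A" using a by simp
    next
      have "comm_elt x \<one> = \<one>" using xc by simp
      then show "\<one> \<in> ?A" using J.one_closed by simp
    qed blast
    moreover have "S \<subseteq> ?A" using left[OF _ x] S by blast
    ultimately have "generate G S \<subseteq> ?A" by - (rule generate_subgroup_incl)
    then have "carrier G \<subseteq> ?A" unfolding S(2) .
    with y show ?thesis by blast
  qed
  then have "lower_central G (Suc n) \<subseteq> ?J"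
    unfolding lower_central.simps(2)[of G n] by (intro generate_subgroup_incl[OF _ J.subgroup_axioms]) blast
  with J have "?J = lower_central G (Suc n)" by (intro equalityI)
  with X show ?case by (intro conjI)
qed

lemma virtually_poly_Z_nilpotent:
  assumes S: "finite S" "S \<subseteq> carrier G" "generate G S = carrier G" and nil: "nilpotent G"
  shows "\<exists>m. virtually_poly_Z G m (carrier G)"
proof -
  obtain c where c: "lower_central G c = {\<one>}" using nil by (auto simp: nilpotent_def)
  have fin: "finite (lower_central_gens S i)" for i using S(1) by (induction i) (auto simp: lower_central_gens.simps(2))
  have step: "\<exists>m. virtually_poly_Z G m (lower_central G i)"
    if v: "virtually_poly_Z G m (lower_central G (Suc i))" for i m
  proof -
    interpret N1: normal "lower_central G (Suc i)" G by (rule lower_central_normal)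
    interpret N: normal "lower_central G i" G by (rule lower_central_normal)
    have "\<exists>m. virtually_poly_Z G m (generate G (Z \<union> lower_central G (Suc i)))"
      if "finite Z" "Z \<subseteq> lower_central G i" for Z
      using that
    proof (induction Z)
      case empty
      have "generate G (lower_central G (Suc i)) = lower_central G (Suc i)"
        by (intro equalityI generate_subgroup_incl N1.subgroup_axioms subset_refl subsetI generate.incl)
      with v show ?case by auto
    next
      case (insert z Z)
      let ?U = "Z \<union> lower_central G (Suc i)"
      have U: "?U \<subseteq> lower_central G i" using insert.prems lower_central_Suc_subset[of i] by blast
      have Uc: "?U \<subseteq> carrier G" using U N.subset by blast
      have zc: "z \<in> carrier G" using insert.prems N.subset by blast
      obtain m where m: "virtually_poly_Z G m (generate G ?U)" using insert by auto
      have "generate G ?U \<lhd> G"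
        by (rule lower_central_between[OF generate_is_subgroup[OF Uc] _
              generate_subgroup_incl[OF U N.subgroup_axioms]]) (auto intro: generate.incl)
      then have "virtually_poly_Z G (Suc m) (generate G (insert z (generate G ?U)))"
        using virtually_poly_Z_cyclic_extension m zc by blast
      moreover have "generate G (insert z (generate G ?U)) = generate G (insert z Z \<union> lower_central G (Suc i))"
      proof (intro equalityI generate_subgroup_incl generate_is_subgroup)
        show "insert z (generate G ?U) \<subseteq> generate G (insert z Z \<union> lower_central G (Suc i))"
          using mono_generate[of ?U "insert z Z \<union> lower_central G (Suc i)"] by (auto intro: generate.incl)
        show "insert z Z \<union> lower_central G (Suc i) \<subseteq> generate G (insert z (generate G ?U))"
          by (auto intro!: generate.incl)
      qed (use Uc zc generate_incl[OF Uc] in auto)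
      ultimately show ?case by metis
    qed
    from this[of "lower_central_gens S i"] show ?thesis
      using fin lower_central_generated[OF S(2,3)] by metis
  qed
  have "\<exists>m. virtually_poly_Z G m (lower_central G (c - i))" for i
  proof (induction i)
    case 0
    show ?case using c by (intro exI[of _ 0]) simp
  next
    case (Suc i)
    show ?case
    proof (cases "i < c")
      case True
      then have "c - i = Suc (c - Suc i)" by simp
      with Suc step show ?thesis by metis
    next
      case False
      with Suc show ?thesis by simp
    qed
  qed
  from this[of c] show ?thesis by simp
qed

lemma virtually_poly_Z_virtually_nilpotent:
  assumes "finitely_generated G" "virtually_nilpotent G"
  obtains m where "virtually_poly_Z G m (carrier G)"
proof -
  obtain S where S: "finite S" "S \<subseteq> carrier G" "generate G S = carrier G"
    using assms(1) by (auto simp: finitely_generated_def finite_generating_set_def)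
  obtain H where H: "subgroup H G" "finite_index G (carrier G) H" "nilpotent (G\<lparr>carrier := H\<rparr>)"
    using assms(2) by (auto simp: virtually_nilpotent_def)
  interpret H: subgroup H G by (rule H)
  have fi: "fi_subgroup G (carrier G) H" using H by (simp add: fi_subgroup_def H.subset)
  obtain U where U: "finite U" "U \<subseteq> carrier G" "generate G U = H"
    using schreier[OF S(1,2)] fi S(3) by metis
  have UH: "U \<subseteq> H" using U(3) generate.incl[of _ U G] by blast
  interpret GH: group "G\<lparr>carrier := H\<rparr>" by (rule subgroup_imp_group[OF H(1)])
  obtain m where "virtually_poly_Z (G\<lparr>carrier := H\<rparr>) m H"
    using GH.virtually_poly_Z_nilpotent[of U] U UH H by (auto simp: generate_consistent)
  then have "virtually_poly_Z G m H" by (rule virtually_poly_Z_restrict_carrier[OF is_group H(1)])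
  then show ?thesis using that virtually_poly_Z_fi[OF _ fi subgroup_self] by blast
qed

end


section \<open>Linear algebra of real functions\<close>

text \<open>Orthogonal projection of \<open>F\<close> to the span of the \<open>d k\<close>, by Gram-Schmidt: \<open>e\<close> is the component of
  \<open>d i0\<close> that is orthogonal to the others. If \<open>e\<close> vanishes, then \<open>s = 0\<close> by the convention on
  division, which is the right coefficient.\<close>

lemma ex_orthogonal_coefficients:
  fixes d :: "'i \<Rightarrow> 'j \<Rightarrow> real"
  assumes "finite I" "finite J"
  shows "\<exists>c. \<forall>i\<in>I. (\<Sum>j\<in>J. (F j - (\<Sum>k\<in>I. c k * d k j)) * d i j) = 0"
  using assms(1)
proof (induction I arbitrary: F)
  case (insert i0 I)
  obtain b where b: "\<forall>i\<in>I. (\<Sum>j\<in>J. (d i0 j - (\<Sum>k\<in>I. b k * d k j)) * d i j) = 0"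
    using insert.IH[of "d i0"] by (elim exE)
  obtain c where c: "\<forall>i\<in>I. (\<Sum>j\<in>J. (F j - (\<Sum>k\<in>I. c k * d k j)) * d i j) = 0"
    using insert.IH[of F] by (elim exE)
  define e where "e j = d i0 j - (\<Sum>k\<in>I. b k * d k j)" for j
  define F' where "F' j = F j - (\<Sum>k\<in>I. c k * d k j)" for j
  define s where "s = (\<Sum>j\<in>J. F' j * e j) / (\<Sum>j\<in>J. e j * e j)"
  define c' where "c' k = (if k = i0 then s else c k - s * b k)" for k
  have res: "F j - (\<Sum>k\<in>insert i0 I. c' k * d k j) = F' j - s * e j" for j
  proof -
    have "(\<Sum>k\<in>I. c' k * d k j) = (\<Sum>k\<in>I. c k * d k j - s * (b k * d k j))"
      using insert.hyps by (intro sum.cong) (auto simp: c'_def algebra_simps)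
    also have "\<dots> = (\<Sum>k\<in>I. c k * d k j) - s * (\<Sum>k\<in>I. b k * d k j)"
      by (simp add: sum_subtractf sum_distrib_left)
    finally show ?thesis
      using insert.hyps by (simp add: F'_def e_def c'_def algebra_simps)
  qed
  have orth: "(\<Sum>j\<in>J. (F' j - s * e j) * d i j) = 0" if "i \<in> I" for i
  proof -
    have "(\<Sum>j\<in>J. (F' j - s * e j) * d i j) = (\<Sum>j\<in>J. F' j * d i j) - s * (\<Sum>j\<in>J. e j * d i j)"
      by (simp add: sum_subtractf sum_distrib_left algebra_simps)
    also have "\<dots> = 0" using b c that by (simp add: F'_def e_def)
    finally show ?thesis .
  qed
  have orth_e: "(\<Sum>j\<in>J. (F' j - s * e j) * e j) = 0"
  proof -
    have eq: "(\<Sum>j\<in>J. (F' j - s * e j) * e j) = (\<Sum>j\<in>J. F' j * e j) - s * (\<Sum>j\<in>J. e j * e j)"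
      by (simp add: sum_subtractf sum_distrib_left algebra_simps)
    show ?thesis
    proof (cases "(\<Sum>j\<in>J. e j * e j) = 0")
      case True
      then have "\<forall>j\<in>J. e j = 0" using assms(2) by (subst (asm) sum_nonneg_eq_0_iff) auto
      then show ?thesis by simp
    next
      case False
      then show ?thesis unfolding eq by (simp add: s_def)
    qed
  qed
  have "(\<Sum>j\<in>J. (F' j - s * e j) * d i0 j)
      = (\<Sum>j\<in>J. (F' j - s * e j) * e j + (\<Sum>k\<in>I. b k * ((F' j - s * e j) * d k j)))"
  proof (rule sum.cong[OF refl])
    fix j
    have "(\<Sum>k\<in>I. b k * ((F' j - s * e j) * d k j)) = (F' j - s * e j) * (\<Sum>k\<in>I. b k * d k j)"
      by (simp add: sum_distrib_left algebra_simps)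
    then show "(F' j - s * e j) * d i0 j
        = (F' j - s * e j) * e j + (\<Sum>k\<in>I. b k * ((F' j - s * e j) * d k j))"
      by (simp add: e_def algebra_simps)
  qed
  also have "\<dots> = (\<Sum>j\<in>J. (F' j - s * e j) * e j)
      + (\<Sum>k\<in>I. b k * (\<Sum>j\<in>J. (F' j - s * e j) * d k j))"
    by (simp add: sum.distrib sum_distrib_left sum.swap[of _ I J])
  also have "\<dots> = 0" using orth orth_e by simp
  finally have "\<forall>i\<in>insert i0 I. (\<Sum>j\<in>J. (F' j - s * e j) * d i j) = 0" using orth by simp
  then show ?case unfolding res[symmetric] by (rule exI[of _ c'])
qed simp

text \<open>The next two lemmas are about a space \<open>V\<close> of functions on \<open>P\<close> on which finitely many linear
  functionals are jointly injective. Both are proved by passing to the kernel of one of them.\<close>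

definition fun_subspace :: "('a \<Rightarrow> real) set \<Rightarrow> bool" where
  "fun_subspace V \<longleftrightarrow> (\<forall>f\<in>V. \<forall>g\<in>V. \<forall>c. (\<lambda>x. f x - c * g x) \<in> V)"

lemma fun_subspaceD: "fun_subspace V \<Longrightarrow> f \<in> V \<Longrightarrow> g \<in> V \<Longrightarrow> (\<lambda>x. f x - c * g x) \<in> V"
  by (simp add: fun_subspace_def)

lemma finite_separating_set:
  fixes V :: "('a \<Rightarrow> real) set" and \<Lambda> :: "(('a \<Rightarrow> real) \<Rightarrow> real) set"
  assumes "finite \<Lambda>" "fun_subspace V"
    and "\<And>l f g c. l \<in> \<Lambda> \<Longrightarrow> f \<in> V \<Longrightarrow> g \<in> V \<Longrightarrow> l (\<lambda>x. f x - c * g x) = l f - c * l g"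
    and "\<And>f. f \<in> V \<Longrightarrow> (\<And>l. l \<in> \<Lambda> \<Longrightarrow> l f = 0) \<Longrightarrow> \<forall>x\<in>P. f x = 0"
  shows "\<exists>B. finite B \<and> B \<subseteq> P \<and> (\<forall>f\<in>V. (\<forall>x\<in>B. f x = 0) \<longrightarrow> (\<forall>x\<in>P. f x = 0))"
  using assms
proof (induction \<Lambda> arbitrary: V)
  case empty
  then show ?case by (intro exI[of _ "{}"]) auto
next
  case (insert l \<Lambda>)
  note lin = insert.prems(2)[OF insertI1]
  let ?V = "{f \<in> V. l f = 0}"
  have "fun_subspace ?V"
    using fun_subspaceD[OF insert.prems(1)] lin by (auto simp: fun_subspace_def)
  then have "\<exists>B. finite B \<and> B \<subseteq> P \<and> (\<forall>f\<in>?V. (\<forall>x\<in>B. f x = 0) \<longrightarrow> (\<forall>x\<in>P. f x = 0))"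
  proof (rule insert.IH)
    fix k f g c assume "k \<in> \<Lambda>" "f \<in> ?V" "g \<in> ?V"
    then show "k (\<lambda>x. f x - c * g x) = k f - c * k g" using insert.prems(2)[of k f g c] by simp
  next
    fix f assume f: "f \<in> ?V" and zero: "\<And>k. k \<in> \<Lambda> \<Longrightarrow> k f = 0"
    show "\<forall>x\<in>P. f x = 0"
    proof (rule insert.prems(3))
      show "f \<in> V" using f by simp
      fix k assume "k \<in> insert l \<Lambda>"
      then show "k f = 0" using f zero[of k] by auto
    qed
  qed
  then obtain B where B: "finite B" "B \<subseteq> P"
    and sep: "\<And>f. f \<in> V \<Longrightarrow> l f = 0 \<Longrightarrow> \<forall>x\<in>B. f x = 0 \<Longrightarrow> \<forall>x\<in>P. f x = 0" by auto
  show ?case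
  proof (cases "\<forall>f\<in>V. (\<forall>x\<in>B. f x = 0) \<longrightarrow> (\<forall>x\<in>P. f x = 0)")
    case True
    with B show ?thesis by blast
  next
    case False
    then obtain f y where f: "f \<in> V" "\<forall>x\<in>B. f x = 0" and y: "y \<in> P" "f y \<noteq> 0" by blast
    have lf: "l f \<noteq> 0" using sep[OF f(1) _ f(2)] y by blast
    have z: "\<forall>x\<in>P. g x = 0" if g: "g \<in> V" "\<forall>x\<in>insert y B. g x = 0" for g
    proof -
      define c where "c = l g / l f"
      have "(\<lambda>x. g x - c * f x) \<in> V" by (rule fun_subspaceD[OF insert.prems(1) g(1) f(1)])
      moreover have "l (\<lambda>x. g x - c * f x) = l g - c * l f" by (rule lin[OF g(1) f(1)])
      then have "l (\<lambda>x. g x - c * f x) = 0" using lf by (simp only: c_def) simp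
      ultimately have eq: "\<forall>x\<in>P. g x - c * f x = 0" using g f by (intro sep) auto
      have "g y - c * f y = 0" using eq y(1) by (rule bspec)
      then have "c = 0" using g(2) y(2) by simp
      with eq show ?thesis by simp
    qed
    have "\<forall>g\<in>V. (\<forall>x\<in>insert y B. g x = 0) \<longrightarrow> (\<forall>x\<in>P. g x = 0)"
      by (intro ballI impI) (rule bspec[OF z])
    moreover have "finite (insert y B)" "insert y B \<subseteq> P" using B y(1) by auto
    ultimately show ?thesis by (intro exI[of _ "insert y B"] conjI)
  qed
qed

lemma finite_spanning_set:
  fixes V :: "('a \<Rightarrow> real) set" and \<Lambda> :: "(('a \<Rightarrow> real) \<Rightarrow> real) set"
  assumes "finite \<Lambda>" "fun_subspace V"
    and "\<And>l f g c. l \<in> \<Lambda> \<Longrightarrow> f \<in> V \<Longrightarrow> g \<in> V \<Longrightarrow> l (\<lambda>x. f x - c * g x) = l f - c * l g"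
    and "\<And>f. f \<in> V \<Longrightarrow> (\<And>l. l \<in> \<Lambda> \<Longrightarrow> l f = 0) \<Longrightarrow> \<forall>x\<in>P. f x = 0"
  shows "\<exists>F. finite F \<and> F \<subseteq> V \<and>
    (\<forall>W. fun_subspace W \<longrightarrow> {f. \<forall>x\<in>P. f x = 0} \<subseteq> W \<longrightarrow> F \<subseteq> W \<longrightarrow> V \<subseteq> W)"
  using assms
proof (induction \<Lambda> arbitrary: V)
  case empty
  then show ?case by (intro exI[of _ "{}"]) auto
next
  case (insert l \<Lambda>)
  note lin = insert.prems(2)[OF insertI1]
  let ?V = "{f \<in> V. l f = 0}"
  have "fun_subspace ?V"
    using fun_subspaceD[OF insert.prems(1)] lin by (auto simp: fun_subspace_def)
  then have "\<exists>F. finite F \<and> F \<subseteq> ?V \<and>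
    (\<forall>W. fun_subspace W \<longrightarrow> {f. \<forall>x\<in>P. f x = 0} \<subseteq> W \<longrightarrow> F \<subseteq> W \<longrightarrow> ?V \<subseteq> W)"
  proof (rule insert.IH)
    fix k f g c assume "k \<in> \<Lambda>" "f \<in> ?V" "g \<in> ?V"
    then show "k (\<lambda>x. f x - c * g x) = k f - c * k g" using insert.prems(2)[of k f g c] by simp
  next
    fix f assume f: "f \<in> ?V" and zero: "\<And>k. k \<in> \<Lambda> \<Longrightarrow> k f = 0"
    show "\<forall>x\<in>P. f x = 0"
    proof (rule insert.prems(3))
      show "f \<in> V" using f by simp
      fix k assume "k \<in> insert l \<Lambda>"
      then show "k f = 0" using f zero[of k] by auto
    qed
  qed
  then obtain F where F: "finite F" "F \<subseteq> V"
    and sp: "\<And>W. fun_subspace W \<Longrightarrow> {f. \<forall>x\<in>P. f x = 0} \<subseteq> W \<Longrightarrow> F \<subseteq> W \<Longrightarrow> ?V \<subseteq> W" by auto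
  show ?case
  proof (cases "\<forall>f\<in>V. l f = 0")
    case True
    then have "?V = V" by auto
    with F sp show ?thesis by auto
  next
    case False
    then obtain f where f: "f \<in> V" "l f \<noteq> 0" by blast
    have "V \<subseteq> W" if W: "fun_subspace W" "{f. \<forall>x\<in>P. f x = 0} \<subseteq> W" "insert f F \<subseteq> W" for W
    proof
      fix g assume g: "g \<in> V"
      define c where "c = l g / l f"
      let ?h = "\<lambda>x. g x - c * f x"
      have "?h \<in> V" by (rule fun_subspaceD[OF insert.prems(1) g f(1)])
      moreover have "l ?h = l g - c * l f" by (rule lin[OF g f(1)])
      then have "l ?h = 0" using f(2) by (simp only: c_def) simp
      ultimately have "?h \<in> W" using sp[OF W(1,2)] W(3) by auto
      moreover have "f \<in> W" using W(3) by simp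
      ultimately have "(\<lambda>x. ?h x - (- c) * f x) \<in> W" by (rule fun_subspaceD[OF W(1)])
      then show "g \<in> W" by simp
    qed
    with F f(1) show ?thesis by (intro exI[of _ "insert f F"]) auto
  qed
qed


section \<open>Harmonic functions of linear growth\<close>

locale harmonic_setting = group +
  fixes P A
  assumes P: "subgroup P G"
    and A: "finite A" "A \<subseteq> P" "generate G A = P"
    and A_inv: "\<And>a. a \<in> A \<Longrightarrow> inv a \<in> A"
begin

sublocale P: subgroup P G by (rule P)

definition laplacian :: "('a \<Rightarrow> real) \<Rightarrow> 'a \<Rightarrow> real" where
  "laplacian f x = (\<Sum>a\<in>A. f (x \<otimes> a) - f x)"

text \<open>Taking \<open>x\<close> in \<open>K\<close> shows that \<open>f\<close> is a homomorphism to \<open>\<real>\<close> plus a constant on \<open>K\<close>, and \<open>f\<close> is then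
  determined by this homomorphism and by its values on coset representatives.\<close>

definition equivariant :: "'a set \<Rightarrow> ('a \<Rightarrow> real) \<Rightarrow> bool" where
  "equivariant K f \<longleftrightarrow> (\<forall>k\<in>K. \<forall>x\<in>P. f (k \<otimes> x) - f x = f k - f \<one>)"

definition Harm :: "('a \<Rightarrow> real) set" where
  "Harm = {f. (\<exists>K. fi_subgroup G P K \<and> equivariant K f) \<and> (\<forall>x\<in>P. laplacian f x = 0)}"

lemma equivariantD: "equivariant K f \<Longrightarrow> k \<in> K \<Longrightarrow> x \<in> P \<Longrightarrow> f (k \<otimes> x) = f x + (f k - f \<one>)"
  unfolding equivariant_def by (drule bspec, assumption, drule bspec, assumption) linarith

lemma equivariant_additive:
  assumes "equivariant K f" "K \<subseteq> P" "k \<in> K" "l \<in> K"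
  shows "f (k \<otimes> l) - f \<one> = (f k - f \<one>) + (f l - f \<one>)"
  using equivariantD[OF assms(1,3), of l] assms by auto

lemma equivariant_mono: "equivariant K f \<Longrightarrow> J \<subseteq> K \<Longrightarrow> equivariant J f"
  by (auto simp: equivariant_def)

lemma equivariant_combination:
  assumes "equivariant K f" "equivariant K g"
  shows "equivariant K (\<lambda>x. f x - c * g x)"
  unfolding equivariant_def
proof (intro ballI)
  fix k x assume kx: "k \<in> K" "x \<in> P"
  show "f (k \<otimes> x) - c * g (k \<otimes> x) - (f x - c * g x) = f k - c * g k - (f \<one> - c * g \<one>)"
    unfolding equivariantD[OF assms(1) kx] equivariantD[OF assms(2) kx] by (simp add: algebra_simps)
qed

lemma HarmE:
  assumes "f \<in> Harm"
  obtains K where "fi_subgroup G P K" "equivariant K f"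
  using assms unfolding Harm_def by blast

lemma Harm_laplacian: "f \<in> Harm \<Longrightarrow> x \<in> P \<Longrightarrow> laplacian f x = 0"
  by (simp add: Harm_def)

lemma Harm_subspace: "fun_subspace Harm"
  unfolding fun_subspace_def
proof (intro ballI allI)
  fix f g and c :: real assume f: "f \<in> Harm" and g: "g \<in> Harm"
  obtain K where K: "fi_subgroup G P K" "equivariant K f" using f by (rule HarmE)
  obtain K' where K': "fi_subgroup G P K'" "equivariant K' g" using g by (rule HarmE)
  have "fi_subgroup G P (K \<inter> K')" using K(1) K'(1) P.subset by (rule fi_subgroup_Int)
  moreover have "equivariant (K \<inter> K') (\<lambda>x. f x - c * g x)"
    using K(2) K'(2) by (intro equivariant_combination) (auto elim: equivariant_mono)
  moreover have "laplacian (\<lambda>x. f x - c * g x) x = laplacian f x - c * laplacian g x" for x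
    unfolding laplacian_def sum_distrib_left sum_subtractf[symmetric]
    by (rule sum.cong) (simp_all add: algebra_simps)
  then have "\<forall>x\<in>P. laplacian (\<lambda>x. f x - c * g x) x = 0" using Harm_laplacian f g by simp
  ultimately show "(\<lambda>x. f x - c * g x) \<in> Harm" unfolding Harm_def by blast
qed

lemma Harm_translate:
  assumes f: "f \<in> Harm" and p: "p \<in> P"
  shows "(\<lambda>x. f (p \<otimes> x)) \<in> Harm"
proof -
  obtain K where K: "fi_subgroup G P K" "equivariant K f" using f by (rule HarmE)
  obtain N where N: "fi_subgroup G P N" "N \<subseteq> K" "\<And>x y. x \<in> P \<Longrightarrow> y \<in> N \<Longrightarrow> x \<otimes> y \<otimes> inv x \<in> N"
    using K(1) P by (rule fi_subgroup_core) blast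
  have "equivariant N (\<lambda>x. f (p \<otimes> x))"
    unfolding equivariant_def
  proof (intro ballI)
    fix k x assume k: "k \<in> N" and x: "x \<in> P"
    have kc: "k \<in> carrier G" using k fi_subgroupD(2)[OF N(1)] P.subset by blast
    have k': "p \<otimes> k \<otimes> inv p \<in> K" using N(2) N(3)[OF p k] by blast
    have "p \<otimes> (k \<otimes> x) = (p \<otimes> k \<otimes> inv p) \<otimes> (p \<otimes> x)"
      using kc x p by (simp add: m_assoc cancel_left)
    moreover have "p \<otimes> k = (p \<otimes> k \<otimes> inv p) \<otimes> p" using kc p by (simp add: m_assoc)
    ultimately show "f (p \<otimes> (k \<otimes> x)) - f (p \<otimes> x) = f (p \<otimes> k) - f (p \<otimes> \<one>)"
      using equivariantD[OF K(2) k', of "p \<otimes> x"] equivariantD[OF K(2) k', of p] x p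
      by (metis P.m_closed P.mem_carrier add_diff_cancel_left' r_one)
  qed
  moreover have "laplacian (\<lambda>x. f (p \<otimes> x)) x = laplacian f (p \<otimes> x)" if "x \<in> P" for x
    unfolding laplacian_def using that p A(2) by (intro sum.cong) (auto simp: m_assoc subset_iff)
  ultimately show ?thesis using N(1) Harm_laplacian[OF f] p unfolding Harm_def by auto
qed

text \<open>The maximum principle: a harmonic function invariant under a subgroup of finite index takes
  finitely many values, hence attains its maximum, and the set where it does so is closed under
  right multiplication by generators.\<close>

lemma invariant_harmonic_const:
  assumes K: "fi_subgroup G P K" and inv: "\<And>k x. k \<in> K \<Longrightarrow> x \<in> P \<Longrightarrow> f (k \<otimes> x) = f x"
    and harm: "\<And>x. x \<in> P \<Longrightarrow> laplacian f x = 0" and x: "x \<in> P"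
  shows "f x = f \<one>"
proof -
  obtain t where t: "\<And>x. x \<in> P \<Longrightarrow> t x \<in> P" "\<And>x. x \<in> P \<Longrightarrow> x \<otimes> inv (t x) \<in> K" "finite (t ` P)"
    using fi_subgroup_transversal[OF K P.subset] by metis
  have ft: "f x = f (t x)" if x: "x \<in> P" for x
  proof -
    have "x \<otimes> inv (t x) \<otimes> t x = x" using x t(1)[OF x] by (simp add: m_assoc)
    then show ?thesis using inv[OF t(2)[OF x] t(1)[OF x]] by simp
  qed
  have "f ` P \<subseteq> f ` (t ` P)" using ft by auto
  then have fin: "finite (f ` P)" using t(3) finite_subset by blast
  define m where "m = Max (f ` P)"
  have "f ` P \<noteq> {}" using P.one_closed by blast
  then have "m \<in> f ` P" unfolding m_def by (intro Max_in fin)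
  then obtain z where z: "z \<in> P" "f z = m" by auto
  have le: "f x \<le> m" if "x \<in> P" for x unfolding m_def using fin that by (intro Max_ge) auto
  have step: "f (y \<otimes> a) = m" if y: "y \<in> P" "f y = m" and a: "a \<in> A" for y a
  proof -
    have nonpos: "f (y \<otimes> b) - f y \<le> 0" if "b \<in> A" for b
      using le[of "y \<otimes> b"] y that A(2) by auto
    have "(\<Sum>b\<in>A. - (f (y \<otimes> b) - f y)) = 0"
      using harm[OF y(1)] by (simp add: laplacian_def sum_negf[symmetric] sum_subtractf)
    then have "\<forall>b\<in>A. - (f (y \<otimes> b) - f y) = 0"
      using nonpos A(1) by (subst (asm) sum_nonneg_eq_0_iff) auto
    then show ?thesis using a y(2) by simp
  qed
  have reach: "\<forall>y\<in>P. f y = m \<longrightarrow> f (y \<otimes> g) = m" if "g \<in> generate G A" for g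
    using that
  proof (induction g rule: generate.induct)
    case (eng g h)
    have gh: "g \<in> P" "h \<in> P" using eng A(3) by auto
    show ?case
    proof (intro ballI impI)
      fix y assume y: "y \<in> P" "f y = m"
      then have "f (y \<otimes> g \<otimes> h) = m" using eng gh by simp
      then show "f (y \<otimes> (g \<otimes> h)) = m" using y gh by (simp add: m_assoc)
    qed
  qed (use step A_inv in auto)
  have all: "f y = m" if y: "y \<in> P" for y
  proof -
    have "inv z \<otimes> y \<in> generate G A" using z y A(3) by simp
    then have "f (z \<otimes> (inv z \<otimes> y)) = m" using reach z by blast
    then show ?thesis using z y by (simp add: cancel_left)
  qed
  then show ?thesis using x by simp
qed

text \<open>Every homomorphism from a subgroup of finite index to \<open>\<real>\<close> is, up to a constant, the
  restriction of a harmonic function: among all functions with the prescribed equivariance the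
  harmonic one minimises the Dirichlet energy, a sum over the finitely many cosets of \<open>K\<close>. The
  minimum is found by orthogonal projection to the differentials \<open>d r\<close> of indicator functions of
  cosets; orthogonality to \<open>d r\<close> becomes harmonicity at \<open>r\<close> by summation by parts, where the
  symmetry of \<open>A\<close> enters.\<close>

lemma ex_harmonic:
  assumes K: "fi_subgroup G P K" and \<phi>: "\<And>x y. x \<in> K \<Longrightarrow> y \<in> K \<Longrightarrow> \<phi> (x \<otimes> y) = \<phi> x + (\<phi> y :: real)"
  obtains f where "f \<in> Harm" "\<And>k x. k \<in> K \<Longrightarrow> x \<in> P \<Longrightarrow> f (k \<otimes> x) = \<phi> k + f x"
proof -
  note Ksub = fi_subgroupD[OF K]
  interpret K: subgroup K G by (rule Ksub)
  obtain t where t: "\<And>x. x \<in> P \<Longrightarrow> t x \<in> P" "\<And>x. x \<in> P \<Longrightarrow> x \<otimes> inv (t x) \<in> K"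
    and tc: "\<And>x y. K #> x = K #> y \<Longrightarrow> t x = t y" and fin: "finite (t ` P)"
    using fi_subgroup_transversal[OF K P.subset] by metis
  have t_eq: "t x = t y \<longleftrightarrow> x \<otimes> inv y \<in> K" if xy: "x \<in> P" "y \<in> P" for x y
  proof
    assume eq: "t x = t y"
    have "x \<otimes> inv (t x) \<otimes> inv (y \<otimes> inv (t x)) \<in> K"
      using K.m_closed[OF t(2)[OF xy(1)] K.m_inv_closed[OF t(2)[OF xy(2)]]] eq by simp
    moreover have "x \<otimes> inv (t x) \<otimes> inv (y \<otimes> inv (t x)) = x \<otimes> inv y"
      using xy t(1)[OF xy(1)] by (simp add: inv_mult_group m_assoc cancel_left)
    ultimately show "x \<otimes> inv y \<in> K" by simp
  next
    assume "x \<otimes> inv y \<in> K"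
    then have "K #> x = K #> y" using xy by (subst r_coset_eq_iff[OF Ksub(1)]) auto
    then show "t x = t y" by (rule tc)
  qed
  have t_mult: "t (k \<otimes> x) = t x" if "k \<in> K" "x \<in> P" for k x
    using that Ksub(2) by (subst t_eq) (auto simp: m_assoc)
  have tt: "t (t x) = t x" if "x \<in> P" for x
  proof -
    have "t x = t (t x)" using t[OF that] that by (subst t_eq) auto
    then show ?thesis by simp
  qed
  let ?R = "t ` P"
  have R: "r \<in> P" "t r = r" if "r \<in> ?R" for r using that t(1) tt by auto
  define f0 where "f0 x = \<phi> (x \<otimes> inv (t x))" for x
  have f0: "f0 (k \<otimes> x) = \<phi> k + f0 x" if k: "k \<in> K" and x: "x \<in> P" for k x
  proof -
    have "k \<otimes> x \<otimes> inv (t x) = k \<otimes> (x \<otimes> inv (t x))"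
      using k x t(1)[OF x] by (simp add: m_assoc)
    then show ?thesis using \<phi>[OF k t(2)[OF x]] by (simp add: f0_def t_mult[OF k x])
  qed
  define d where "d r = (\<lambda>(s, a). of_bool (t (s \<otimes> a) = r) - (of_bool (s = r) :: real))" for r
  obtain c where c: "\<forall>r\<in>?R. (\<Sum>j\<in>?R \<times> A. ((\<lambda>(s, a). f0 (s \<otimes> a) - f0 s) j
      - (\<Sum>k\<in>?R. c k * d k j)) * d r j) = 0"
    using ex_orthogonal_coefficients[OF fin finite_cartesian_product[OF fin A(1)],
        of "\<lambda>(s, a). f0 (s \<otimes> a) - f0 s" d] by (elim exE)
  define f where "f x = f0 x - c (t x)" for x
  have f: "f (k \<otimes> x) = \<phi> k + f x" if "k \<in> K" "x \<in> P" for k x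
    using that by (simp add: f_def f0 t_mult)
  have f_t: "f (t x \<otimes> y) - f (t x) = f (x \<otimes> y) - f x" if x: "x \<in> P" and y: "y \<in> P" for x y
  proof -
    have "x \<otimes> inv (t x) \<otimes> (t x \<otimes> y) = x \<otimes> y" "x \<otimes> inv (t x) \<otimes> t x = x"
      using x y t(1)[OF x] by (simp_all add: m_assoc cancel_left)
    then show ?thesis
      using f[OF t(2)[OF x], of "t x \<otimes> y"] f[OF t(2)[OF x] t(1)[OF x]] x y t(1)[OF x] by simp
  qed
  have harm_R: "laplacian f r = 0" if r: "r \<in> ?R" for r
  proof -
    have Aa: "a \<in> P" "inv a \<in> P" "a \<in> carrier G" if "a \<in> A" for a using that A(2) by auto
    have D: "(\<Sum>k\<in>?R. c k * d k (s, a)) = c (t (s \<otimes> a)) - c s" if "s \<in> ?R" "a \<in> A" for s a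
    proof -
      have "t (s \<otimes> a) \<in> ?R" using R(1)[OF that(1)] Aa[OF that(2)] by simp
      have "(\<Sum>k\<in>?R. c k * d k (s, a))
          = (\<Sum>k\<in>?R. (if k = t (s \<otimes> a) then c k else 0) - (if k = s then c k else 0))"
        by (rule sum.cong) (auto simp: d_def)
      also have "\<dots> = c (t (s \<otimes> a)) - c s"
        using fin that(1) \<open>t (s \<otimes> a) \<in> ?R\<close> by (simp only: sum_subtractf sum.delta if_True)
      finally show ?thesis .
    qed
    have "(\<Sum>(s, a)\<in>?R \<times> A. (f (s \<otimes> a) - f s) * d r (s, a))
        = (\<Sum>j\<in>?R \<times> A. ((\<lambda>(s, a). f0 (s \<otimes> a) - f0 s) j - (\<Sum>k\<in>?R. c k * d k j)) * d r j)"
    proof (rule sum.cong[OF refl])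
      fix j assume "j \<in> ?R \<times> A"
      then obtain s a where j: "j = (s, a)" and s: "s \<in> ?R" and a: "a \<in> A" by (elim SigmaE)
      show "(case j of (s, a) \<Rightarrow> (f (s \<otimes> a) - f s) * d r (s, a))
          = ((\<lambda>(s, a). f0 (s \<otimes> a) - f0 s) j - (\<Sum>k\<in>?R. c k * d k j)) * d r j"
        unfolding j prod.case D[OF s a] f_def R(2)[OF s] by (simp add: algebra_simps)
    qed
    then have "0 = (\<Sum>(s, a)\<in>?R \<times> A. (f (s \<otimes> a) - f s) * d r (s, a))"
      using bspec[OF c r] by (simp only:)
    also have "\<dots> = (\<Sum>s\<in>?R. \<Sum>a\<in>A. (f (s \<otimes> a) - f s) * d r (s, a))"
      by (rule sum.cartesian_product[symmetric])
    also have "\<dots> = (\<Sum>a\<in>A. \<Sum>s\<in>?R. (f (s \<otimes> a) - f s) * d r (s, a))" by (rule sum.swap)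
    also have "\<dots> = (\<Sum>a\<in>A. (f r - f (r \<otimes> inv a)) - (f (r \<otimes> a) - f r))"
    proof (rule sum.cong[OF refl])
      fix a assume a: "a \<in> A"
      have rP: "r \<in> P" using R[OF r] by simp
      have iff: "t (s \<otimes> a) = r \<longleftrightarrow> s = t (r \<otimes> inv a)" if s: "s \<in> ?R" for s
      proof -
        have sP: "s \<in> P" "t s = s" using R[OF s] .
        have "t (s \<otimes> a) = t r \<longleftrightarrow> (s \<otimes> a) \<otimes> inv r \<in> K" using sP rP Aa[OF a] by (intro t_eq) auto
        also have "(s \<otimes> a) \<otimes> inv r = s \<otimes> inv (r \<otimes> inv a)"
          using sP rP Aa[OF a] by (simp add: inv_mult_group m_assoc)
        also have "s \<otimes> inv (r \<otimes> inv a) \<in> K \<longleftrightarrow> t s = t (r \<otimes> inv a)"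
          using sP rP Aa[OF a] by (intro t_eq[symmetric]) auto
        finally show ?thesis using R(2)[OF r] sP by simp
      qed
      have mem: "t (r \<otimes> inv a) \<in> ?R" using rP Aa[OF a] by simp
      have "(\<Sum>s\<in>?R. (f (s \<otimes> a) - f s) * d r (s, a))
          = (\<Sum>s\<in>?R. (if s = t (r \<otimes> inv a) then f (s \<otimes> a) - f s else 0))
            - (\<Sum>s\<in>?R. (if s = r then f (s \<otimes> a) - f s else 0))"
        unfolding sum_subtractf[symmetric]
        by (rule sum.cong[OF refl]) (simp add: d_def iff)
      also have "\<dots> = (f (t (r \<otimes> inv a) \<otimes> a) - f (t (r \<otimes> inv a))) - (f (r \<otimes> a) - f r)"
        using fin r mem by (simp add: sum.delta)
      also have "f (t (r \<otimes> inv a) \<otimes> a) - f (t (r \<otimes> inv a)) = f (r \<otimes> inv a \<otimes> a) - f (r \<otimes> inv a)"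
        using rP Aa[OF a] by (intro f_t) auto
      also have "r \<otimes> inv a \<otimes> a = r" using rP Aa[OF a] by (simp add: m_assoc)
      finally show "(\<Sum>s\<in>?R. (f (s \<otimes> a) - f s) * d r (s, a)) = (f r - f (r \<otimes> inv a)) - (f (r \<otimes> a) - f r)" .
    qed
    also have "\<dots> = - (\<Sum>a\<in>A. f (r \<otimes> inv a) - f r) - laplacian f r"
      unfolding laplacian_def sum_negf[symmetric] sum_subtractf[symmetric] by (rule sum.cong) simp_all
    also have "(\<Sum>a\<in>A. f (r \<otimes> inv a) - f r) = laplacian f r"
      unfolding laplacian_def
      by (rule sum.reindex_bij_witness[of _ "\<lambda>a. inv a" "\<lambda>a. inv a"])
        (use A_inv Aa in auto)
    finally show ?thesis by simp
  qed
  have harm: "laplacian f x = 0" if x: "x \<in> P" for x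
  proof -
    have "laplacian f x = laplacian f (t x)"
      unfolding laplacian_def by (rule sum.cong[OF refl]) (use f_t[OF x] A(2) in auto)
    then show ?thesis using harm_R x by simp
  qed
  have "equivariant K f"
    unfolding equivariant_def
  proof (intro ballI)
    fix k x assume k: "k \<in> K" and x: "x \<in> P"
    have "f (k \<otimes> \<one>) = \<phi> k + f \<one>" using f[OF k P.one_closed] .
    then show "f (k \<otimes> x) - f x = f k - f \<one>" using f[OF k x] k by simp
  qed
  with K harm have "f \<in> Harm" unfolding Harm_def by blast
  with f that show ?thesis by blast
qed

text \<open>Up to constants, the slopes are coordinates of \<open>f\<close>. They are read off from those powers of
  \<open>t\<close> that lie in a subgroup on which \<open>f\<close> is a homomorphism plus a constant, and do not depend
  on the subgroup; this makes them linear in \<open>f\<close> although the subgroup varies with \<open>f\<close>.\<close>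

definition slope :: "('a \<Rightarrow> real) \<Rightarrow> 'a \<Rightarrow> real" where
  "slope f t = (THE s. \<exists>r>0. \<forall>j::nat. f (t [^] (r * j)) = f \<one> + s * real (r * j))"

lemma slope_eqI:
  assumes "r > 0" and s: "\<And>j::nat. f (t [^] (r * j)) = f \<one> + s * real (r * j)"
  shows "slope f t = s"
  unfolding slope_def
proof (rule the_equality)
  show "\<exists>r>0. \<forall>j::nat. f (t [^] (r * j)) = f \<one> + s * real (r * j)" using assms by blast
  fix s' assume "\<exists>r>0. \<forall>j::nat. f (t [^] (r * j)) = f \<one> + s' * real (r * j)"
  then obtain r' where r': "r' > 0" "\<And>j::nat. f (t [^] (r' * j)) = f \<one> + s' * real (r' * j)" by blast
  have "f (t [^] (r * r')) = f \<one> + s * real (r * r')" by (rule s)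
  moreover have "f (t [^] (r * r')) = f \<one> + s' * real (r * r')"
    using r'(2)[of r] by (simp only: mult.commute[of r' r])
  ultimately have "s' * real (r * r') = s * real (r * r')" by linarith
  moreover have "real (r * r') \<noteq> 0" using assms(1) r'(1) by simp
  ultimately show "s' = s" by (metis mult_right_cancel)
qed

lemma equivariant_pow:
  assumes K: "fi_subgroup G P K" and f: "equivariant K f" and t: "t \<in> P" "t [^] (r::nat) \<in> K"
  shows "f (t [^] (r * j)) = f \<one> + (f (t [^] r) - f \<one>) * real j"
proof -
  note Ksub = fi_subgroupD[OF K]
  have "f ((t [^] r) [^] j) - f \<one> = real j * (f (t [^] r) - f \<one>)"
    using additive_pow[OF Ksub(1) equivariant_additive[OF f Ksub(2)] t(2), of j] by simp
  moreover have "(t [^] r) [^] j = t [^] (r * j)" using t(1) by (simp add: nat_pow_pow)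
  ultimately show ?thesis by (simp add: algebra_simps)
qed

lemma slope_eq:
  assumes "fi_subgroup G P K" "equivariant K f" "t \<in> P" "r > 0" "t [^] (r::nat) \<in> K"
  shows "slope f t = (f (t [^] r) - f \<one>) / real r"
  by (rule slope_eqI[OF assms(4)]) (use equivariant_pow[OF assms(1-3,5)] assms(4) in simp)

lemma slope_combination:
  assumes f: "f \<in> Harm" and g: "g \<in> Harm" and t: "t \<in> P"
  shows "slope (\<lambda>x. f x - c * g x) t = slope f t - c * slope g t"
proof -
  obtain K where K: "fi_subgroup G P K" "equivariant K f" using f by (rule HarmE)
  obtain K' where K': "fi_subgroup G P K'" "equivariant K' g" using g by (rule HarmE)
  have KK: "fi_subgroup G P (K \<inter> K')" using K(1) K'(1) P.subset by (rule fi_subgroup_Int)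
  obtain r :: nat where r: "r > 0" "t [^] r \<in> K \<inter> K'" using fi_subgroup_pow[OF KK P t] by blast
  have eq: "equivariant (K \<inter> K') f" "equivariant (K \<inter> K') g"
    using K(2) K'(2) by (auto elim: equivariant_mono)
  show ?thesis
    unfolding slope_eq[OF KK eq(1) t r] slope_eq[OF KK eq(2) t r]
      slope_eq[OF KK equivariant_combination[OF eq, of c] t r]
    using r by (simp add: field_simps)
qed

lemma Harm_functionals:
  assumes "virtually_poly_Z G n P"
  obtains \<Lambda> :: "(('a \<Rightarrow> real) \<Rightarrow> real) set" where "finite \<Lambda>"
    "\<forall>l\<in>\<Lambda>. \<forall>f\<in>Harm. \<forall>g\<in>Harm. \<forall>c. l (\<lambda>x. f x - c * g x) = l f - c * l g"
    "\<forall>f\<in>Harm. (\<forall>l\<in>\<Lambda>. l f = 0) \<longrightarrow> (\<forall>x\<in>P. f x = 0)"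
proof -
  obtain T where T: "finite T" "T \<subseteq> P"
    and det: "\<forall>K (\<phi> :: 'a \<Rightarrow> real). fi_subgroup G P K \<longrightarrow>
      (\<forall>x\<in>K. \<forall>y\<in>K. \<phi> (x \<otimes> y) = \<phi> x + \<phi> y) \<longrightarrow>
      (\<forall>t\<in>T. \<forall>r::nat>0. t [^] r \<in> K \<longrightarrow> \<phi> (t [^] r) = 0) \<longrightarrow> (\<forall>x\<in>K. \<phi> x = 0)"
    using virtually_poly_Z_detect[OF assms P] by (elim exE conjE)
  let ?\<Lambda> = "insert (\<lambda>f. f \<one>) ((\<lambda>t f. slope f t) ` T)"
  show ?thesis
  proof (rule that[of ?\<Lambda>])
    show "finite ?\<Lambda>" using T by simp
    show "\<forall>l\<in>?\<Lambda>. \<forall>f\<in>Harm. \<forall>g\<in>Harm. \<forall>c. l (\<lambda>x. f x - c * g x) = l f - c * l g"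
      using T slope_combination by auto
    show "\<forall>f\<in>Harm. (\<forall>l\<in>?\<Lambda>. l f = 0) \<longrightarrow> (\<forall>x\<in>P. f x = 0)"
    proof (intro ballI impI)
      fix f x assume f: "f \<in> Harm" and zero: "\<forall>l\<in>?\<Lambda>. l f = 0" and x: "x \<in> P"
      obtain K where K: "fi_subgroup G P K" "equivariant K f" using f by (rule HarmE)
      note Ksub = fi_subgroupD[OF K(1)]
      have one: "f \<one> = 0" using zero by simp
      have "\<forall>x\<in>K. f x - f \<one> = 0"
      proof (rule det[THEN spec, THEN spec, THEN mp, THEN mp, THEN mp, OF K(1)])
        show "\<forall>x\<in>K. \<forall>y\<in>K. f (x \<otimes> y) - f \<one> = f x - f \<one> + (f y - f \<one>)"
          using equivariant_additive[OF K(2) Ksub(2)] by blast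
        show "\<forall>t\<in>T. \<forall>r::nat>0. t [^] r \<in> K \<longrightarrow> f (t [^] r) - f \<one> = 0"
        proof (intro ballI allI impI)
          fix t and r :: nat assume tr: "t \<in> T" "0 < r" "t [^] r \<in> K"
          have "slope f t = 0" using zero tr(1) by simp
          then show "f (t [^] r) - f \<one> = 0"
            using slope_eq[OF K _ tr(2,3)] tr T by auto
        qed
      qed
      then have inv: "f (k \<otimes> x) = f x" if "k \<in> K" "x \<in> P" for k x
        using equivariantD[OF K(2) that] that by simp
      have "f x = f \<one>"
        by (rule invariant_harmonic_const[OF K(1)]) (simp_all add: inv Harm_laplacian[OF f] x)
      with one show "f x = 0" by simp
    qed
  qed
qed

lemma Harm_separating:
  assumes "virtually_poly_Z G n P"
  obtains B where "finite B" "B \<subseteq> P" "\<And>f. f \<in> Harm \<Longrightarrow> \<forall>x\<in>B. f x = 0 \<Longrightarrow> \<forall>x\<in>P. f x = 0"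
proof -
  obtain \<Lambda> :: "(('a \<Rightarrow> real) \<Rightarrow> real) set" where L: "finite \<Lambda>"
    "\<forall>l\<in>\<Lambda>. \<forall>f\<in>Harm. \<forall>g\<in>Harm. \<forall>c. l (\<lambda>x. f x - c * g x) = l f - c * l g"
    "\<forall>f\<in>Harm. (\<forall>l\<in>\<Lambda>. l f = 0) \<longrightarrow> (\<forall>x\<in>P. f x = 0)"
    by (rule Harm_functionals[OF assms]) (rule that)
  have "\<exists>B. finite B \<and> B \<subseteq> P \<and> (\<forall>f\<in>Harm. (\<forall>x\<in>B. f x = 0) \<longrightarrow> (\<forall>x\<in>P. f x = 0))"
    by (rule finite_separating_set[OF L(1) Harm_subspace]) (use L(2) in blast, use L(3) in blast)
  then obtain B where "finite B" "B \<subseteq> P" "\<forall>f\<in>Harm. (\<forall>x\<in>B. f x = 0) \<longrightarrow> (\<forall>x\<in>P. f x = 0)"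
    by (elim exE conjE)
  then show ?thesis by (intro that[of B]) blast+
qed

text \<open>\<open>Harm\<close> is spanned by finitely many functions, so the intersection of their subgroups serves for
  all of \<open>Harm\<close>.\<close>

lemma Harm_uniformly_equivariant:
  assumes "virtually_poly_Z G n P"
  obtains K where "fi_subgroup G P K" "\<And>f. f \<in> Harm \<Longrightarrow> equivariant K f"
proof -
  obtain \<Lambda> :: "(('a \<Rightarrow> real) \<Rightarrow> real) set" where L: "finite \<Lambda>"
    "\<forall>l\<in>\<Lambda>. \<forall>f\<in>Harm. \<forall>g\<in>Harm. \<forall>c. l (\<lambda>x. f x - c * g x) = l f - c * l g"
    "\<forall>f\<in>Harm. (\<forall>l\<in>\<Lambda>. l f = 0) \<longrightarrow> (\<forall>x\<in>P. f x = 0)"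
    by (rule Harm_functionals[OF assms]) (rule that)
  have "\<exists>F. finite F \<and> F \<subseteq> Harm \<and>
    (\<forall>W. fun_subspace W \<longrightarrow> {f. \<forall>x\<in>P. f x = 0} \<subseteq> W \<longrightarrow> F \<subseteq> W \<longrightarrow> Harm \<subseteq> W)"
    by (rule finite_spanning_set[OF L(1) Harm_subspace]) (use L(2) in blast, use L(3) in blast)
  then obtain F where F: "finite F" "F \<subseteq> Harm"
    and span: "\<forall>W. fun_subspace W \<longrightarrow> {f. \<forall>x\<in>P. f x = 0} \<subseteq> W \<longrightarrow> F \<subseteq> W \<longrightarrow> Harm \<subseteq> W"
    by (elim exE conjE)
  have "\<forall>f\<in>F. \<exists>K. fi_subgroup G P K \<and> equivariant K f"
    using F(2) by (auto elim: HarmE)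
  then obtain K where K: "\<forall>f\<in>F. fi_subgroup G P (K f) \<and> equivariant (K f) f"
    unfolding bchoice_iff by (elim exE)
  let ?K = "{x \<in> P. \<forall>f\<in>F. x \<in> K f}"
  have fi: "fi_subgroup G P ?K" using F(1) P K by (intro fi_subgroup_INT) auto
  have "Harm \<subseteq> {f. equivariant ?K f}"
  proof (rule span[THEN spec, THEN mp, THEN mp, THEN mp])
    show "fun_subspace {f. equivariant ?K f}"
      by (auto simp: fun_subspace_def intro: equivariant_combination)
    show "{f. \<forall>x\<in>P. f x = 0} \<subseteq> {f. equivariant ?K f}"
      by (auto simp: equivariant_def)
    show "F \<subseteq> {f. equivariant ?K f}"
    proof
      fix f assume "f \<in> F"
      then have "equivariant (K f) f" "?K \<subseteq> K f" using K by auto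
      then show "f \<in> {f. equivariant ?K f}" by (auto elim: equivariant_mono)
    qed
  qed
  with fi that show ?thesis by blast
qed

definition Level :: "'a set" where
  "Level = {p \<in> P. \<forall>f\<in>Harm. f p = f \<one>}"

lemma LevD: "p \<in> Level \<Longrightarrow> f \<in> Harm \<Longrightarrow> f p = f \<one>" "p \<in> Level \<Longrightarrow> p \<in> P"
  by (auto simp: Level_def)

lemma Level_subgroup: "subgroup Level G"
proof
  fix p q assume p: "p \<in> Level" and q: "q \<in> Level"
  have "f (p \<otimes> q) = f \<one>" if f: "f \<in> Harm" for f
    using LevD(1)[OF q Harm_translate[OF f LevD(2)[OF p]]] LevD(1)[OF p f] LevD(2)[OF p] by simp
  then show "p \<otimes> q \<in> Level" using LevD(2)[OF p] LevD(2)[OF q] by (simp add: Level_def)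
next
  fix p assume p: "p \<in> Level"
  have pP: "p \<in> P" "inv p \<in> P" using LevD(2)[OF p] by auto
  have "f (inv p) = f \<one>" if f: "f \<in> Harm" for f
    using LevD(1)[OF p Harm_translate[OF f pP(2)]] pP by simp
  then show "inv p \<in> Level" using pP by (simp add: Level_def)
qed (auto simp: Level_def)

text \<open>The first homomorphism to \<open>\<int>\<close> in the chain for \<open>P\<close> extends to a function in \<open>Harm\<close>, so \<open>Level\<close>
  lies in its kernel up to finite index.\<close>

lemma virtually_poly_Z_Level:
  assumes "virtually_poly_Z G (Suc n) P"
  shows "virtually_poly_Z G n Level"
proof -
  obtain K and \<phi> :: "'a \<Rightarrow> int" where K: "fi_subgroup G P K"
    and \<phi>: "\<And>x y. x \<in> K \<Longrightarrow> y \<in> K \<Longrightarrow> \<phi> (x \<otimes> y) = \<phi> x + \<phi> y"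
    and N: "virtually_poly_Z G n {x \<in> K. \<phi> x = 0}"
    using assms by (rule virtually_poly_Z_SucE) blast
  obtain f where f: "f \<in> Harm" "\<And>k x. k \<in> K \<Longrightarrow> x \<in> P \<Longrightarrow> f (k \<otimes> x) = real_of_int (\<phi> k) + f x"
    using ex_harmonic[OF K, of "\<lambda>k. real_of_int (\<phi> k)"] \<phi> by auto
  have LP: "Level \<subseteq> P" by (auto simp: Level_def)
  have fi: "fi_subgroup G Level (Level \<inter> K)" by (rule fi_subgroup_Int_subgroup[OF K Level_subgroup LP])
  have "Level \<inter> K \<subseteq> {x \<in> K. \<phi> x = 0}"
  proof
    fix k assume k: "k \<in> Level \<inter> K"
    then have "f (k \<otimes> \<one>) = f \<one>" using LevD(1)[of k f] f(1) LevD(2)[of k] by auto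
    then show "k \<in> {x \<in> K. \<phi> x = 0}" using f(2)[of k \<one>] k by simp
  qed
  then have "virtually_poly_Z G n (Level \<inter> K)"
    using virtually_poly_Z_subgroup[OF N fi_subgroupD(1)[OF fi]] by blast
  then show ?thesis using virtually_poly_Z_fi[OF _ fi Level_subgroup] by blast
qed

end


section \<open>Permutation groups twisted by a group\<close>

text \<open>Permutations of the whole type, so that composition and inverses need no relativisation to a
  carrier, and so that the same functions can act on subgroups of \<open>P\<close>.\<close>

definition perms :: "('x \<Rightarrow> 'x) monoid" where
  "perms = \<lparr>carrier = {f. bij f}, monoid.mult = (\<circ>), one = id\<rparr>"

lemma perms_simps [simp]:
  "carrier perms = {f. bij f}" "f \<otimes>\<^bsub>perms\<^esub> g = f \<circ> g" "\<one>\<^bsub>perms\<^esub> = id"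
  by (simp_all add: perms_def)

lemma group_perms: "group perms"
proof (rule groupI)
  fix f :: "'a \<Rightarrow> 'a" assume "f \<in> carrier perms"
  then show "\<exists>g\<in>carrier perms. g \<otimes>\<^bsub>perms\<^esub> f = \<one>\<^bsub>perms\<^esub>"
    by (intro bexI[of _ "inv_into UNIV f"]) (auto simp: bij_imp_bij_inv bij_is_inj)
qed (auto simp: bij_comp comp_assoc)

lemma inv_perms: "bij f \<Longrightarrow> inv\<^bsub>perms\<^esub> f = inv_into UNIV f"
  by (rule group.inv_equality[OF group_perms]) (auto simp: bij_imp_bij_inv bij_is_inj)

context
  fixes L :: "('x \<Rightarrow> 'x) set"
  assumes L: "subgroup L perms"
begin

lemma perm_bij: "h \<in> L \<Longrightarrow> bij h"
  using subgroup.subset[OF L] by auto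

lemma perm_id: "id \<in> L"
  using subgroup.one_closed[OF L] by simp

lemma perm_comp: "h \<in> L \<Longrightarrow> k \<in> L \<Longrightarrow> h \<circ> k \<in> L"
  using subgroup.m_closed[OF L, of h k] by simp

lemma perm_inv: "h \<in> L \<Longrightarrow> inv_into UNIV h \<in> L"
  using subgroup.m_inv_closed[OF L, of h] perm_bij[of h] by (simp add: inv_perms)

lemma perm_inv_cancel: "h \<in> L \<Longrightarrow> h (inv_into UNIV h x) = x" "h \<in> L \<Longrightarrow> inv_into UNIV h (h x) = x"
  using perm_bij[of h] by (simp_all add: bij_is_surj surj_f_inv_f bij_is_inj)

lemma perm_funpow: "h \<in> L \<Longrightarrow> h ^^ n \<in> L"
  by (induction n) (auto simp: perm_id perm_comp)

end

lemma subgroup_permsI: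
  assumes "id \<in> L" "\<And>h. h \<in> L \<Longrightarrow> bij h" "\<And>h k. h \<in> L \<Longrightarrow> k \<in> L \<Longrightarrow> h \<circ> k \<in> L"
    "\<And>h. h \<in> L \<Longrightarrow> inv_into UNIV h \<in> L"
  shows "subgroup L perms"
  by standard (use assms in \<open>auto simp: inv_perms\<close>)

lemma finite_action_of_finite_index:
  assumes L: "subgroup L perms" and P: "\<And>h x. h \<in> L \<Longrightarrow> x \<in> P \<Longrightarrow> h x \<in> P"
    and fi: "fi_subgroup perms L M" and fin: "finite ((\<lambda>h. restrict h P) ` M)"
  shows "finite ((\<lambda>h. restrict h P) ` L)"
proof -
  interpret perms: group perms by (rule group_perms)
  obtain c where c: "\<And>h. h \<in> L \<Longrightarrow> c h \<in> L" "\<And>h. h \<in> L \<Longrightarrow> h \<otimes>\<^bsub>perms\<^esub> inv\<^bsub>perms\<^esub> (c h) \<in> M"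
    and cf: "finite (c ` L)"
    using perms.fi_subgroup_transversal[OF fi subgroup.subset[OF L]] by metis
  let ?f = "\<lambda>(a, b). compose P a (restrict b P)"
  have "(\<lambda>h. restrict h P) ` L \<subseteq> ?f ` ((\<lambda>h. restrict h P) ` M \<times> c ` L)"
  proof
    fix r assume "r \<in> (\<lambda>h. restrict h P) ` L"
    then obtain h where h: "h \<in> L" "r = restrict h P" by (elim imageE)
    let ?m = "h \<circ> inv_into UNIV (c h)"
    have m: "?m \<in> M" using c(2)[OF h(1)] perm_bij[OF L c(1)[OF h(1)]] by (simp add: inv_perms)
    have "r = ?f (restrict ?m P, c h)"
      unfolding h(2) using P[OF c(1)[OF h(1)]] perm_inv_cancel(2)[OF L c(1)[OF h(1)]]
      by (auto simp: compose_def restrict_def fun_eq_iff)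
    then show "r \<in> ?f ` ((\<lambda>h. restrict h P) ` M \<times> c ` L)" using m h(1) by blast
  qed
  then show ?thesis using fin cf finite_subset by blast
qed

text \<open>The model is a group \<open>L\<close> of automorphisms of a Cayley graph of \<open>P\<close> that fix \<open>\<one>\<close> and commensurate
  \<open>P\<close>. The graph is replaced by its two consequences: finite orbits, and closure under restriction.
  In this form the hypotheses pass to subgroups of \<open>P\<close> that \<open>L\<close> preserves and to quotients.\<close>

locale self_similar_action = group +
  fixes P L
  assumes P: "subgroup P G" and L: "subgroup L perms"
    and act_closed: "h \<in> L \<Longrightarrow> x \<in> P \<Longrightarrow> h x \<in> P"
    and act_one: "h \<in> L \<Longrightarrow> h \<one> = \<one>"
    and act_restriction: "h \<in> L \<Longrightarrow> x \<in> P \<Longrightarrow> \<exists>h'\<in>L. \<forall>y\<in>P. h (x \<otimes> y) = h x \<otimes> h' y"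
    and act_orbit: "x \<in> P \<Longrightarrow> finite ((\<lambda>h. h x) ` L)"
    and act_restrictions: "h \<in> L \<Longrightarrow> finite ((\<lambda>x. \<lambda>y\<in>P. inv (h x) \<otimes> h (x \<otimes> y)) ` P)"
begin

sublocale P: subgroup P G by (rule P)

text \<open>The stabiliser of \<open>h\<close> under the action of \<open>P\<close> by restriction.\<close>

definition St :: "('a \<Rightarrow> 'a) \<Rightarrow> 'a set" where
  "St h = {x \<in> P. \<forall>y\<in>P. h (x \<otimes> y) = h x \<otimes> h y}"

lemma St_mult: "x \<in> St h \<Longrightarrow> y \<in> P \<Longrightarrow> h (x \<otimes> y) = h x \<otimes> h y"
  by (simp add: St_def)

lemma St_P: "x \<in> St h \<Longrightarrow> x \<in> P"
  by (simp add: St_def)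

lemma St_inv:
  assumes h: "h \<in> L" and x: "x \<in> St h"
  shows "inv x \<in> St h" "h (inv x) = inv (h x)"
proof -
  have xP: "x \<in> P" using x by (rule St_P)
  have eq: "h (inv x \<otimes> y) = inv (h x) \<otimes> h y" if y: "y \<in> P" for y
  proof -
    have "h (x \<otimes> (inv x \<otimes> y)) = h x \<otimes> h (inv x \<otimes> y)" using x xP y by (intro St_mult) auto
    moreover have "x \<otimes> (inv x \<otimes> y) = y" using xP y by (simp add: cancel_left)
    ultimately have "inv (h x) \<otimes> h y = inv (h x) \<otimes> (h x \<otimes> h (inv x \<otimes> y))" by simp
    then show ?thesis using act_closed[OF h] xP y by (simp add: cancel_left)
  qed
  show 1: "h (inv x) = inv (h x)" using eq[OF P.one_closed] act_closed[OF h] xP act_one[OF h] by simp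
  show "inv x \<in> St h" unfolding St_def using eq 1 xP by simp
qed

lemma St_subgroup:
  assumes h: "h \<in> L"
  shows "subgroup (St h) G"
proof
  fix x y assume xy: "x \<in> St h" "y \<in> St h"
  note P = St_P[OF xy(1)] St_P[OF xy(2)]
  have "h (x \<otimes> y \<otimes> z) = h (x \<otimes> y) \<otimes> h z" if z: "z \<in> P" for z
  proof -
    have "h (x \<otimes> y \<otimes> z) = h (x \<otimes> (y \<otimes> z))" using P z by (simp add: m_assoc)
    also have "\<dots> = h x \<otimes> (h y \<otimes> h z)" using St_mult[OF xy(1)] St_mult[OF xy(2)] P z by simp
    also have "\<dots> = h (x \<otimes> y) \<otimes> h z"
      using St_mult[OF xy(1) P(2)] act_closed[OF h] P z by (simp add: m_assoc)
    finally show ?thesis .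
  qed
  then show "x \<otimes> y \<in> St h" using P by (simp add: St_def)
next
  show "\<one> \<in> St h" using act_one[OF h] act_closed[OF h] by (simp add: St_def)
  show "St h \<subseteq> carrier G" using St_P by auto
qed (rule St_inv[OF h])

text \<open>The index is the number of restrictions of \<open>h\<close>.\<close>

lemma St_fi:
  assumes h: "h \<in> L"
  shows "fi_subgroup G P (St h)"
proof (rule fi_subgroupI[where F = "\<lambda>x. \<lambda>y\<in>P. inv (h x) \<otimes> h (x \<otimes> y)", OF St_subgroup[OF h] _ P.subset act_restrictions[OF h]])
  show "St h \<subseteq> P" using St_P by blast
next
  fix x x' assume x: "x \<in> P" "x' \<in> P"
    and eq: "(\<lambda>y\<in>P. inv (h x) \<otimes> h (x \<otimes> y)) = (\<lambda>y\<in>P. inv (h x') \<otimes> h (x' \<otimes> y))"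
  have hx: "h x \<in> P" "h x' \<in> P" using act_closed[OF h] x by auto
  have key: "h (x \<otimes> inv x' \<otimes> y) = h x \<otimes> inv (h x') \<otimes> h y" if y: "y \<in> P" for y
  proof -
    let ?z = "inv x' \<otimes> y"
    have z: "?z \<in> P" using x y by simp
    have "inv (h x) \<otimes> h (x \<otimes> ?z) = inv (h x') \<otimes> h (x' \<otimes> ?z)"
      using fun_cong[OF eq, of ?z] z by simp
    moreover have "x' \<otimes> ?z = y" using x y by (simp add: cancel_left)
    ultimately have "h x \<otimes> (inv (h x) \<otimes> h (x \<otimes> ?z)) = h x \<otimes> (inv (h x') \<otimes> h y)" by simp
    moreover have "h (x \<otimes> ?z) \<in> P" using act_closed[OF h] x z by simp
    ultimately have "h (x \<otimes> ?z) = h x \<otimes> (inv (h x') \<otimes> h y)" using hx by (simp add: cancel_left)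
    then show ?thesis using x y hx act_closed[OF h y] by (simp add: m_assoc)
  qed
  have "h (x \<otimes> inv x') = h x \<otimes> inv (h x')"
    using key[OF P.one_closed] x hx act_one[OF h] by simp
  then show "x \<otimes> inv x' \<in> St h" using key x by (simp add: St_def)
qed

lemma fi_preimage:
  assumes h: "h \<in> L" and K: "fi_subgroup G P K"
  shows "fi_subgroup G P {x \<in> St h. h x \<in> K}"
proof -
  note Ksub = fi_subgroupD[OF K] and St = fi_subgroupD[OF St_fi[OF h]]
  interpret K: subgroup K G by (rule Ksub)
  interpret St: subgroup "St h" G by (rule St)
  have "fi_subgroup G (St h) {x \<in> St h. h x \<in> K}"
  proof (rule fi_subgroupI[where F = "\<lambda>x. K #> h x"])
    show "subgroup {x \<in> St h. h x \<in> K} G"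
    proof
      fix x y assume xy: "x \<in> {x \<in> St h. h x \<in> K}" "y \<in> {x \<in> St h. h x \<in> K}"
      then have "h (x \<otimes> y) = h x \<otimes> h y" using St_P by (intro St_mult) auto
      then show "x \<otimes> y \<in> {x \<in> St h. h x \<in> K}" using xy by simp
    qed (use St_P St_inv[OF h] act_one[OF h] in auto)
    have "(\<lambda>x. K #> h x) ` St h \<subseteq> (\<lambda>x. K #> x) ` P" using act_closed[OF h] St_P by blast
    then show "finite ((\<lambda>x. K #> h x) ` St h)" using Ksub(3) finite_subset by blast
  next
    fix x y assume xy: "x \<in> St h" "y \<in> St h" "K #> h x = K #> h y"
    have "h x \<in> carrier G" "h y \<in> carrier G" using act_closed[OF h] St_P xy by auto
    then have "h x \<otimes> inv (h y) \<in> K" using r_coset_eq_iff[OF Ksub(1)] xy(3) by blast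
    moreover have "h (x \<otimes> inv y) = h x \<otimes> inv (h y)"
      using St_mult[OF xy(1)] St_inv[OF h xy(2)] St_P[OF xy(2)] by simp
    ultimately show "x \<otimes> inv y \<in> {x \<in> St h. h x \<in> K}" using xy by simp
  qed (use St in auto)
  then show ?thesis by (rule fi_subgroup_trans[OF St_fi[OF h] _ P.subset])
qed

text \<open>Such an \<open>m\<close> is determined by its values on representatives of the cosets of \<open>K\<close>, each of which
  has a finite orbit.\<close>

lemma finite_action_of_centralised:
  assumes M: "M \<subseteq> L" and K: "fi_subgroup G P K"
    and cent: "\<And>m x y. m \<in> M \<Longrightarrow> x \<in> K \<Longrightarrow> y \<in> P \<Longrightarrow> m (x \<otimes> y) = x \<otimes> m y"
  shows "finite ((\<lambda>h. restrict h P) ` M)"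
proof -
  obtain t where t: "\<And>x. x \<in> P \<Longrightarrow> t x \<in> P" "\<And>x. x \<in> P \<Longrightarrow> x \<otimes> inv (t x) \<in> K"
    and tf: "finite (t ` P)"
    using fi_subgroup_transversal[OF K P.subset] by metis
  let ?R = "t ` P"
  let ?f = "\<lambda>g. \<lambda>y\<in>P. y \<otimes> inv (t y) \<otimes> g (t y)"
  have "(\<lambda>h. restrict h P) ` M \<subseteq> ?f ` (\<Pi>\<^sub>E r\<in>?R. (\<lambda>h. h r) ` L)"
  proof
    fix g assume "g \<in> (\<lambda>h. restrict h P) ` M"
    then obtain m where m: "m \<in> M" "g = restrict m P" by (elim imageE)
    have "g = ?f (restrict m ?R)"
    proof
      fix y
      show "g y = ?f (restrict m ?R) y"
      proof (cases "y \<in> P")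
        case True
        have "m (y \<otimes> inv (t y) \<otimes> t y) = y \<otimes> inv (t y) \<otimes> m (t y)"
          by (rule cent[OF m(1) t(2)[OF True] t(1)[OF True]])
        moreover have "y \<otimes> inv (t y) \<otimes> t y = y" using True t(1)[OF True] by (simp add: m_assoc)
        ultimately show ?thesis using True by (simp add: m(2))
      qed (simp add: m(2))
    qed
    moreover have "restrict m ?R \<in> (\<Pi>\<^sub>E r\<in>?R. (\<lambda>h. h r) ` L)" using m M by auto
    ultimately show "g \<in> ?f ` (\<Pi>\<^sub>E r\<in>?R. (\<lambda>h. h r) ` L)" by (rule image_eqI)
  qed
  moreover have "finite (\<Pi>\<^sub>E r\<in>?R. (\<lambda>h. h r) ` L)"
    using tf act_orbit t(1) by (intro finite_PiE) auto
  ultimately show ?thesis using finite_subset by blast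
qed

text \<open>The union of the orbits of \<open>S\<close> and its inverses. It is symmetric because the inverse of \<open>h s\<close> is
  the image of \<open>inv s\<close> under the restriction of \<open>h\<close> at \<open>s\<close>.\<close>

lemma invariant_generators:
  assumes S: "finite S" "S \<subseteq> carrier G" "generate G S = P"
  obtains A where "finite A" "A \<subseteq> P" "generate G A = P" "\<And>a. a \<in> A \<Longrightarrow> inv a \<in> A"
    "\<And>h. h \<in> L \<Longrightarrow> bij_betw h A A"
proof -
  have SP: "S \<subseteq> P" using S(3) generate.incl[of _ S G] by blast
  let ?S = "S \<union> (\<lambda>s. inv s) ` S"
  define A where "A = (\<Union>s\<in>?S. (\<lambda>h. h s) ` L)"
  have SP': "?S \<subseteq> P" using SP by auto
  have fin: "finite A" unfolding A_def using S(1) SP' act_orbit by blast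
  have AP: "A \<subseteq> P" unfolding A_def using SP' act_closed by blast
  have "S \<subseteq> A"
  proof
    fix s assume "s \<in> S"
    then have "id s \<in> A" unfolding A_def using perm_id[OF L] by blast
    then show "s \<in> A" by simp
  qed
  then have "P \<subseteq> generate G A" using mono_generate[of S A] S(3) by simp
  moreover have "generate G A \<subseteq> P" by (rule generate_subgroup_incl[OF AP P])
  ultimately have gen: "generate G A = P" by (rule equalityI[rotated])
  have inv: "inv a \<in> A" if aA: "a \<in> A" for a
  proof -
    obtain h s where h: "h \<in> L" and s: "s \<in> ?S" and a: "a = h s"
      using aA unfolding A_def by blast
    have sP: "s \<in> P" using s SP' by blast
    obtain h' where h': "h' \<in> L" "\<forall>y\<in>P. h (s \<otimes> y) = h s \<otimes> h' y"
      using act_restriction[OF h sP] by (elim bexE)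
    have "h (s \<otimes> inv s) = h s \<otimes> h' (inv s)"
      using sP by (intro h'(2)[THEN bspec]) simp
    then have "h s \<otimes> h' (inv s) = \<one>" using sP act_one[OF h] by simp
    then have "inv (h s) = h' (inv s)"
      using act_closed[OF h sP] act_closed[OF h'(1), of "inv s"] sP
      by (metis P.m_inv_closed P.mem_carrier inv_comm inv_equality)
    moreover have "inv s \<in> ?S" using s SP sP by auto
    ultimately show ?thesis unfolding a A_def using h'(1) by blast
  qed
  have bij: "bij_betw h A A" if h: "h \<in> L" for h
  proof -
    have sub: "k ` A \<subseteq> A" if k: "k \<in> L" for k
    proof
      fix b assume "b \<in> k ` A"
      then obtain h s where "h \<in> L" "s \<in> ?S" "b = (k \<circ> h) s" unfolding A_def by auto
      then show "b \<in> A" unfolding A_def using perm_comp[OF L k] by blast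
    qed
    have "inj_on h A" using perm_bij[OF L h] by (meson bij_is_inj inj_on_subset subset_UNIV)
    moreover have "h ` A = A"
      using sub[OF h] fin \<open>inj_on h A\<close> by (simp add: endo_inj_surj)
    ultimately show ?thesis by (rule bij_betw_imageI)
  qed
  show ?thesis using that[OF fin AP gen inv bij] by blast
qed

text \<open>The induction step. By the induction hypothesis and finite-dimensionality of \<open>Harm\<close>, the group
  \<open>M\<close> of all elements of \<open>L\<close> that act trivially on \<open>Level\<close> and on \<open>Harm\<close> has finite index, so it is
  generated by a finite set \<open>U\<close>. For \<open>m\<close> in \<open>M\<close> the displacement \<open>d m x = inv x \<otimes> m x\<close> lies in
  \<open>Level\<close>, where \<open>m\<close> is the identity. For \<open>x\<close> in a suitable subgroup \<open>K4\<close> of finite index, the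
  displacements of the elements of \<open>U\<close> lie in a subgroup \<open>E\<close> of \<open>Level\<close> and are central in it, and
  they have finite order because the orbits are finite. The torsion elements of the centre of \<open>E\<close>
  form a group that is torsion and virtually poly-\<open>\<int>\<close>, hence finite. So there are finitely many
  displacements, and on a subgroup of finite index they all vanish.\<close>

lemma finite_action_step:
  assumes v: "virtually_poly_Z G (Suc n) P" and gen: "finite S" "S \<subseteq> carrier perms" "generate perms S = L"
    and IH: "\<And>Y. self_similar_action G Y L \<Longrightarrow> virtually_poly_Z G n Y \<Longrightarrow> finite ((\<lambda>h. restrict h Y) ` L)"
  shows "finite ((\<lambda>h. restrict h P) ` L)"
proof -
  obtain S0 where "finite S0" "S0 \<subseteq> carrier G" "generate G S0 = P"
    by (rule virtually_poly_Z_finitely_generated[OF v P]) (rule that)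
  then obtain A where A: "finite A" "A \<subseteq> P" "generate G A = P" "\<And>a. a \<in> A \<Longrightarrow> inv a \<in> A"
    and A_bij: "\<And>h. h \<in> L \<Longrightarrow> bij_betw h A A"
    by (rule invariant_generators) (rule that)
  interpret harmonic_setting G P A
    by (unfold_locales) (use P A in auto)
  \<comment> \<open>\<open>L\<close> acts by graph automorphisms, so it preserves harmonicity, and elements of \<open>L\<close> are
    homomorphisms on subgroups of finite index, so it preserves equivariance.\<close>
  have Harm_act: "(\<lambda>x. f (h x)) \<in> Harm" if f: "f \<in> Harm" and h: "h \<in> L" for f h
  proof -
    obtain K where K: "fi_subgroup G P K" "equivariant K f" using f by (rule HarmE)
    have "equivariant {x \<in> St h. h x \<in> K} (\<lambda>x. f (h x))"
      unfolding equivariant_def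
    proof (intro ballI)
      fix k x assume k: "k \<in> {x \<in> St h. h x \<in> K}" and x: "x \<in> P"
      then have "f (h (k \<otimes> x)) = f (h k \<otimes> h x)" by (simp add: St_mult)
      also have "\<dots> = f (h x) + (f (h k) - f \<one>)"
        using k act_closed[OF h x] by (intro equivariantD[OF K(2)]) auto
      finally show "f (h (k \<otimes> x)) - f (h x) = f (h k) - f (h \<one>)" using act_one[OF h] by simp
    qed
    moreover have "laplacian (\<lambda>x. f (h x)) x = 0" if x: "x \<in> P" for x
    proof -
      obtain h' where h': "h' \<in> L" "\<forall>y\<in>P. h (x \<otimes> y) = h x \<otimes> h' y"
        using act_restriction[OF h x] by (elim bexE)
      have "laplacian (\<lambda>x. f (h x)) x = (\<Sum>a\<in>A. f (h x \<otimes> h' a) - f (h x))"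
        unfolding laplacian_def by (rule sum.cong[OF refl]) (use h'(2) A(2) in auto)
      also have "\<dots> = laplacian f (h x)"
        unfolding laplacian_def by (rule sum.reindex_bij_betw[OF A_bij[OF h'(1)]])
      finally show ?thesis using Harm_laplacian[OF f act_closed[OF h x]] by simp
    qed
    ultimately show ?thesis using fi_preimage[OF h K(1)] unfolding Harm_def by blast
  qed
  have LevP: "Level \<subseteq> P" using LevD(2) by blast
  have Level_act: "h p \<in> Level" if h: "h \<in> L" and p: "p \<in> Level" for h p
  proof -
    have "f (h p) = f \<one>" if f: "f \<in> Harm" for f
      using LevD(1)[OF p Harm_act[OF f h]] act_one[OF h] by simp
    then show ?thesis using act_closed[OF h LevD(2)[OF p]] by (simp add: Level_def)
  qed
  have ssa: "self_similar_action G Level L"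
  proof (intro self_similar_action.intro self_similar_action_axioms.intro)
    fix h x assume h: "h \<in> L" and x: "x \<in> Level"
    show "\<exists>h'\<in>L. \<forall>y\<in>Level. h (x \<otimes> y) = h x \<otimes> h' y"
      using act_restriction[OF h LevD(2)[OF x]] LevD(2) by blast
  next
    fix h assume h: "h \<in> L"
    have "(\<lambda>x. \<lambda>y\<in>Level. inv (h x) \<otimes> h (x \<otimes> y)) ` Level
      \<subseteq> (\<lambda>g. restrict g Level) ` ((\<lambda>x. \<lambda>y\<in>P. inv (h x) \<otimes> h (x \<otimes> y)) ` P)"
    proof
      fix g assume "g \<in> (\<lambda>x. \<lambda>y\<in>Level. inv (h x) \<otimes> h (x \<otimes> y)) ` Level"
      then obtain x where x: "x \<in> Level" "g = (\<lambda>y\<in>Level. inv (h x) \<otimes> h (x \<otimes> y))" by (elim imageE)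
      have "g = restrict (\<lambda>y\<in>P. inv (h x) \<otimes> h (x \<otimes> y)) Level"
        unfolding x(2) using LevP by (auto simp: restrict_def fun_eq_iff)
      then show "g \<in> (\<lambda>g. restrict g Level) ` ((\<lambda>x. \<lambda>y\<in>P. inv (h x) \<otimes> h (x \<otimes> y)) ` P)"
        using x(1) LevP by blast
    qed
    then show "finite ((\<lambda>x. \<lambda>y\<in>Level. inv (h x) \<otimes> h (x \<otimes> y)) ` Level)"
      using act_restrictions[OF h] by (meson finite_imageI finite_subset)
  next
    show "finite ((\<lambda>h. h x) ` L)" if "x \<in> Level" for x using act_orbit[OF LevD(2)[OF that]] .
  qed (use is_group Level_subgroup L Level_act act_one in simp_all)
  have finLev: "finite ((\<lambda>h. restrict h Level) ` L)" by (rule IH[OF ssa virtually_poly_Z_Level[OF v]])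
  obtain B where B: "finite B" "B \<subseteq> P" and sep: "\<And>f. f \<in> Harm \<Longrightarrow> \<forall>x\<in>B. f x = 0 \<Longrightarrow> \<forall>x\<in>P. f x = 0"
    by (rule Harm_separating[OF v]) (rule that)
  interpret perms: group perms by (rule group_perms)
  define M where "M = {h \<in> L. (\<forall>y\<in>Level. h y = y) \<and> (\<forall>f\<in>Harm. \<forall>x\<in>P. f (h x) = f x)}"
  have M_sub_L: "M \<subseteq> L" by (auto simp: M_def)
  have M_Level: "m y = y" if "m \<in> M" "y \<in> Level" for m y using that by (simp add: M_def)
  have M_Harm: "f (m x) = f x" if "m \<in> M" "f \<in> Harm" "x \<in> P" for m f x using that by (simp add: M_def)
  have Msub: "subgroup M perms"
  proof (rule subgroup_permsI)
    show "id \<in> M" using perm_id[OF L] by (simp add: M_def)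
    show "bij h" if "h \<in> M" for h using perm_bij[OF L] M_sub_L that by blast
    show "h \<circ> k \<in> M" if h: "h \<in> M" and k: "k \<in> M" for h k
    proof -
      have kL: "k \<in> L" and hk: "h \<circ> k \<in> L" using h k M_sub_L perm_comp[OF L] by blast+
      have "f (h (k x)) = f x" if "f \<in> Harm" "x \<in> P" for f x
        using M_Harm[OF h that(1) act_closed[OF kL that(2)]] M_Harm[OF k that] by simp
      moreover have "h (k y) = y" if "y \<in> Level" for y using M_Level[OF h that] M_Level[OF k that] by simp
      ultimately show ?thesis using hk by (simp add: M_def)
    qed
    show "inv_into UNIV h \<in> M" if h: "h \<in> M" for h
    proof -
      have hL: "h \<in> L" using h M_sub_L by blast
      note inv = perm_inv[OF L hL] and canc = perm_inv_cancel[OF L hL]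
      have "inv_into UNIV h y = y" if "y \<in> Level" for y
        using canc(2)[of y] M_Level[OF h that] by simp
      moreover have "f (inv_into UNIV h x) = f x" if "f \<in> Harm" "x \<in> P" for f x
        using M_Harm[OF h that(1) act_closed[OF inv that(2)]] canc(1)[of x] by simp
      ultimately show ?thesis using inv by (simp add: M_def)
    qed
  qed
  have fiM: "fi_subgroup perms L M"
  proof (rule perms.fi_subgroupI[where F = "\<lambda>h. (restrict h Level, restrict h B)", OF Msub M_sub_L subgroup.subset[OF L]])
    have "(\<lambda>h. (restrict h Level, restrict h B)) ` L
        \<subseteq> (\<lambda>h. restrict h Level) ` L \<times> (\<Pi>\<^sub>E b\<in>B. (\<lambda>h. h b) ` L)" by auto
    moreover have "finite (\<Pi>\<^sub>E b\<in>B. (\<lambda>h. h b) ` L)"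
      using B act_orbit by (intro finite_PiE) auto
    ultimately show "finite ((\<lambda>h. (restrict h Level, restrict h B)) ` L)"
      using finLev by (meson finite_SigmaI finite_subset)
  next
    fix h k assume hk: "h \<in> L" "k \<in> L" and "(restrict h Level, restrict h B) = (restrict k Level, restrict k B)"
    then have eq: "restrict h Level = restrict k Level" "restrict h B = restrict k B" by auto
    have eqLev: "h y = k y" if "y \<in> Level" for y using fun_cong[OF eq(1), of y] that by simp
    have eqB: "h y = k y" if "y \<in> B" for y using fun_cong[OF eq(2), of y] that by simp
    note inv = perm_inv[OF L hk(2)] and canc = perm_inv_cancel[OF L hk(2)]
    have eqHF: "f (h x) = f (k x)" if f: "f \<in> Harm" and x: "x \<in> P" for f x
    proof -
      have "(\<lambda>x. f (h x) - 1 * f (k x)) \<in> Harm"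
        by (rule fun_subspaceD[OF Harm_subspace Harm_act[OF f hk(1)] Harm_act[OF f hk(2)]])
      then have "\<forall>x\<in>P. f (h x) - 1 * f (k x) = 0" by (rule sep) (simp add: eqB)
      with x show ?thesis by simp
    qed
    have "h \<circ> inv_into UNIV k \<in> M"
      unfolding M_def
    proof (intro CollectI conjI ballI)
      show "h \<circ> inv_into UNIV k \<in> L" using perm_comp[OF L hk(1) inv] .
      show "(h \<circ> inv_into UNIV k) y = y" if "y \<in> Level" for y
        using eqLev[OF Level_act[OF inv that]] canc(1)[of y] by simp
      show "f ((h \<circ> inv_into UNIV k) x) = f x" if "f \<in> Harm" "x \<in> P" for f x
        using eqHF[OF that(1) act_closed[OF inv that(2)]] canc(1)[of x] by simp
    qed
    then show "h \<otimes>\<^bsub>perms\<^esub> inv\<^bsub>perms\<^esub> k \<in> M" using perm_bij[OF L hk(2)] by (simp add: inv_perms)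
  qed
  have "fi_subgroup perms (generate perms S) M" using fiM gen(3) by simp
  then obtain U where U: "finite U" "U \<subseteq> carrier perms" "generate perms U = M"
    by (rule perms.schreier[OF gen(1,2)]) (rule that)
  have UM: "U \<subseteq> M" using U(3) generate.incl[of _ U perms] by blast
  have UL: "m \<in> L" if "m \<in> U" for m using that UM M_sub_L by blast
  obtain K0 where K0: "fi_subgroup G P K0" and eqv: "\<And>f. f \<in> Harm \<Longrightarrow> equivariant K0 f"
    by (rule Harm_uniformly_equivariant[OF v]) (rule that)
  define K1 where "K1 = {x \<in> P. \<forall>m\<in>U. x \<in> St m} \<inter> K0"
  have K1: "fi_subgroup G P K1"
    unfolding K1_def
    by (intro fi_subgroup_Int fi_subgroup_INT U(1) P K0 P.subset St_fi UL)
  define K2 where "K2 = {x \<in> P. \<forall>m\<in>U. x \<in> {x \<in> St m. m x \<in> K1}} \<inter> K1"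
  have K2: "fi_subgroup G P K2"
    unfolding K2_def
    by (intro fi_subgroup_Int fi_subgroup_INT U(1) P K1 P.subset fi_preimage UL)
  obtain K3 where K3: "fi_subgroup G P K3" "K3 \<subseteq> K2"
    and norm: "\<And>x y. x \<in> P \<Longrightarrow> y \<in> K3 \<Longrightarrow> x \<otimes> y \<otimes> inv x \<in> K3"
    by (rule fi_subgroup_core[OF K2 P]) (rule that)
  define K4 where "K4 = {x \<in> P. \<forall>m\<in>U. x \<in> {x \<in> St m. m x \<in> K3}} \<inter> K3"
  have K4: "fi_subgroup G P K4"
    unfolding K4_def
    by (intro fi_subgroup_Int fi_subgroup_INT U(1) P K3 P.subset fi_preimage UL)
  note K3sub = fi_subgroupD[OF K3(1)] and K4sub = fi_subgroupD[OF K4]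
  interpret K3: subgroup K3 G by (rule K3sub)
  interpret K4: subgroup K4 G by (rule K4sub)
  interpret Level: subgroup Level G by (rule Level_subgroup)
  have K3P: "x \<in> P" if "x \<in> K3" for x using that K3sub(2) by blast
  have K3K0: "x \<in> K0" if "x \<in> K3" for x using that K3(2) by (auto simp: K2_def K1_def)
  have K3St: "x \<in> St m" if "x \<in> K3" "m \<in> U" for x m using that K3(2) by (auto simp: K2_def K1_def)
  have K4K3: "x \<in> K3" if "x \<in> K4" for x using that by (simp add: K4_def)
  have K4m: "m x \<in> K3" if "x \<in> K4" "m \<in> U" for x m using that by (simp add: K4_def)
  define d where "d m x = inv x \<otimes> m x" for m x
  have md: "m x = x \<otimes> d m x" if "x \<in> P" "m \<in> U" for m x
    using that act_closed[OF UL[OF that(2)]] by (simp add: d_def cancel_left)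
  have d_Level: "d m x \<in> Level" if x: "x \<in> P" and m: "m \<in> U" for m x
  proof -
    have mx: "m x \<in> P" using act_closed[OF UL[OF m] x] .
    have mM: "m \<in> M" using m UM by blast
    have "f (inv x \<otimes> m x) = f \<one>" if f: "f \<in> Harm" for f
      using M_Harm[OF mM Harm_translate[OF f] x, of "inv x"] x by simp
    then show ?thesis using x mx by (simp add: Level_def d_def)
  qed
  let ?E = "Level \<inter> K3"
  have Esub: "subgroup ?E G" by (rule subgroups_Inter_pair[OF Level_subgroup K3sub(1)])
  interpret E: subgroup ?E G by (rule Esub)
  have d_E: "d m x \<in> ?E" if x: "x \<in> K4" and m: "m \<in> U" for m x
    using d_Level[OF K3P[OF K4K3[OF x]] m] K4m[OF x m] K4K3[OF x] by (simp add: d_def)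
  have conj_Level: "x \<otimes> y \<otimes> inv x \<in> Level" if x: "x \<in> K3" and y: "y \<in> ?E" for x y
  proof -
    have xP: "x \<in> P" "inv x \<in> P" and yP: "y \<in> P" using x y K3P by auto
    have "f (x \<otimes> y \<otimes> inv x) = f \<one>" if f: "f \<in> Harm" for f
    proof -
      have "f (x \<otimes> y \<otimes> inv x) = f (x \<otimes> (y \<otimes> inv x))" using xP yP by (simp add: m_assoc)
      also have "\<dots> = f (y \<otimes> inv x) + (f x - f \<one>)"
        using xP yP by (intro equivariantD[OF eqv[OF f] K3K0[OF x]]) simp
      also have "f (y \<otimes> inv x) = f (inv x) + (f y - f \<one>)"
        using xP y by (intro equivariantD[OF eqv[OF f] K3K0]) auto
      also have "f y = f \<one>" using y f LevD(1) by blast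
      finally have "f (x \<otimes> y \<otimes> inv x) = f (inv x) + (f x - f \<one>)" by simp
      also have "\<dots> = f (x \<otimes> inv x)"
        by (rule equivariantD[OF eqv[OF f] K3K0[OF x] xP(2), symmetric])
      also have "x \<otimes> inv x = \<one>" using xP by simp
      finally show ?thesis .
    qed
    then show ?thesis using xP yP by (simp add: Level_def)
  qed
  \<comment> \<open>Compare \<open>m (x \<otimes> y) = m x \<otimes> y\<close> with \<open>m ((x \<otimes> y \<otimes> inv x) \<otimes> x) = x \<otimes> y \<otimes> inv x \<otimes> m x\<close>.\<close>
  have d_comm: "d m x \<otimes> y = y \<otimes> d m x" if x: "x \<in> K3" and y: "y \<in> ?E" and m: "m \<in> U" for m x y
  proof -
    have xP: "x \<in> P" and yP: "y \<in> P" using x y K3P by auto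
    have mM: "m \<in> M" using m UM by blast
    let ?z = "x \<otimes> y \<otimes> inv x"
    have z: "?z \<in> Level" "?z \<in> K3" using conj_Level[OF x y] norm[OF xP] y by auto
    have mx: "m x \<in> P" using act_closed[OF UL[OF m] xP] .
    have "m x \<otimes> y = m x \<otimes> m y" using M_Level[OF mM] y by simp
    also have "\<dots> = m (x \<otimes> y)" by (rule St_mult[OF K3St[OF x m] yP, symmetric])
    also have "x \<otimes> y = ?z \<otimes> x" using xP yP by (simp add: m_assoc)
    also have "m (?z \<otimes> x) = m ?z \<otimes> m x" by (rule St_mult[OF K3St[OF z(2) m] xP])
    also have "m ?z = ?z" by (rule M_Level[OF mM z(1)])
    finally have "inv x \<otimes> (m x \<otimes> y) = inv x \<otimes> (?z \<otimes> m x)" by simp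
    then show ?thesis using xP yP mx by (simp add: d_def m_assoc cancel_left)
  qed
  \<comment> \<open>The orbit of \<open>x\<close> under \<open>m\<close> consists of the \<open>x \<otimes> d m x [^] j\<close>.\<close>
  have d_torsion: "\<exists>r::nat>0. d m x [^] r = \<one>" if x: "x \<in> K3" and m: "m \<in> U" for m x
  proof -
    have xP: "x \<in> P" and dL: "d m x \<in> Level" using K3P[OF x] d_Level[OF K3P[OF x] m] .
    have mM: "m \<in> M" using m UM by blast
    have dc: "d m x \<in> carrier G" using dL by simp
    have pw: "d m x [^] j \<in> Level" for j :: nat using dL by (induction j) auto
    have orb: "(m ^^ j) x = x \<otimes> d m x [^] j" for j
    proof (induction j)
      case (Suc j)
      have "(m ^^ Suc j) x = m (x \<otimes> d m x [^] j)" using Suc by simp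
      also have "\<dots> = m x \<otimes> m (d m x [^] j)" by (rule St_mult[OF K3St[OF x m] LevD(2)[OF pw]])
      also have "m (d m x [^] j) = d m x [^] j" by (rule M_Level[OF mM pw])
      also have "m x = x \<otimes> d m x" by (rule md[OF xP m])
      also have "x \<otimes> d m x \<otimes> d m x [^] j = x \<otimes> d m x [^] Suc j"
        using xP dc nat_pow_Suc2[OF dc, of j] by (simp only: m_assoc P.mem_carrier nat_pow_closed)
      finally show ?case by simp
    qed (use xP in simp)
    have "range (\<lambda>j. (m ^^ j) x) \<subseteq> (\<lambda>h. h x) ` L" using perm_funpow[OF L UL[OF m]] by blast
    then have "finite (range (\<lambda>j. (m ^^ j) x))" using act_orbit[OF xP] finite_subset by blast
    then have "\<not> inj (\<lambda>j. (m ^^ j) x)" using finite_imageD infinite_UNIV_nat by blast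
    then obtain i j where ij: "i < j" "(m ^^ i) x = (m ^^ j) x"
      unfolding inj_def by (metis linorder_neqE_nat)
    have "x \<otimes> d m x [^] i = x \<otimes> d m x [^] j" using ij(2) unfolding orb .
    then have "d m x [^] i = d m x [^] j" using xP dc by simp
    also have "\<dots> = d m x [^] i \<otimes> d m x [^] (j - i)" using ij(1) dc by (simp add: nat_pow_mult)
    finally have "d m x [^] (j - i) = \<one>" using dc by simp
    with ij(1) show ?thesis by (intro exI[of _ "j - i"]) simp
  qed
  define T where "T = {e \<in> ?E. (\<forall>y\<in>?E. e \<otimes> y = y \<otimes> e) \<and> (\<exists>r::nat>0. e [^] r = \<one>)}"
  have Tsub: "subgroup T G"
  proof
    fix a b assume a: "a \<in> T" and b: "b \<in> T"
    then have E: "a \<in> ?E" "b \<in> ?E" and com: "\<And>y. y \<in> ?E \<Longrightarrow> a \<otimes> y = y \<otimes> a" "\<And>y. y \<in> ?E \<Longrightarrow> b \<otimes> y = y \<otimes> b"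
      unfolding T_def by blast+
    have c: "a \<in> carrier G" "b \<in> carrier G" using E by auto
    obtain r s :: nat where rs: "r > 0" "a [^] r = \<one>" "s > 0" "b [^] s = \<one>"
      using a b unfolding T_def by blast
    have "(a \<otimes> b) [^] (r * s) = a [^] (r * s) \<otimes> b [^] (r * s)"
      by (rule pow_mult_distrib[OF com(1)[OF E(2)] c])
    also have "\<dots> = (a [^] r) [^] s \<otimes> (b [^] s) [^] r" using c by (simp add: nat_pow_pow mult.commute)
    also have "\<dots> = \<one>" using rs by simp
    finally have tors: "\<exists>r::nat>0. (a \<otimes> b) [^] r = \<one>" using rs by (intro exI[of _ "r * s"]) simp
    have "a \<otimes> b \<otimes> y = y \<otimes> (a \<otimes> b)" if y: "y \<in> ?E" for y
    proof -
      have yc: "y \<in> carrier G" using y by auto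
      have "a \<otimes> b \<otimes> y = a \<otimes> (y \<otimes> b)" using c yc com(2)[OF y] by (simp add: m_assoc)
      also have "\<dots> = (a \<otimes> y) \<otimes> b" using c yc by (simp add: m_assoc)
      also have "\<dots> = y \<otimes> (a \<otimes> b)" using c yc com(1)[OF y] by (simp add: m_assoc)
      finally show ?thesis .
    qed
    with tors E show "a \<otimes> b \<in> T" unfolding T_def by (intro CollectI conjI ballI E.m_closed)
  next
    fix a assume a: "a \<in> T"
    then have E: "a \<in> ?E" and com: "\<And>y. y \<in> ?E \<Longrightarrow> a \<otimes> y = y \<otimes> a" unfolding T_def by blast+
    have c: "a \<in> carrier G" using E by auto
    obtain r :: nat where r: "r > 0" "a [^] r = \<one>" using a unfolding T_def by blast
    have "inv a [^] r = \<one>" using c r(2) by (simp add: nat_pow_inv)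
    then have tors: "\<exists>r::nat>0. inv a [^] r = \<one>" using r(1) by blast
    have "inv a \<otimes> y = y \<otimes> inv a" if y: "y \<in> ?E" for y
    proof -
      have yc: "y \<in> carrier G" using y by auto
      have "inv a \<otimes> (a \<otimes> y) \<otimes> inv a = inv a \<otimes> (y \<otimes> a) \<otimes> inv a" using com[OF y] by simp
      then show ?thesis using c yc by (simp add: m_assoc cancel_left)
    qed
    with tors E show "inv a \<in> T" unfolding T_def by (intro CollectI conjI ballI E.m_inv_closed)
  next
    have "\<one> [^] (1::nat) = \<one>" by simp
    then have "\<exists>r::nat>0. \<one> [^] r = \<one>" by (intro exI[of _ 1]) simp
    moreover have "\<one> \<otimes> y = y \<otimes> \<one>" if "y \<in> ?E" for y using that by auto
    ultimately show "\<one> \<in> T" unfolding T_def by (intro CollectI conjI ballI E.one_closed)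
  next
    show "T \<subseteq> carrier G" using E.subset by (auto simp: T_def)
  qed
  have "T \<subseteq> P" using LevP by (auto simp: T_def)
  then have "virtually_poly_Z G (Suc n) T" by (rule virtually_poly_Z_subgroup[OF v Tsub])
  then have finT: "finite T"
    by (rule virtually_poly_Z_torsion_finite[OF _ Tsub]) (unfold T_def, blast)
  have d_T: "d m x \<in> T" if x: "x \<in> K4" and m: "m \<in> U" for m x
    unfolding T_def using d_E[OF x m] d_comm[OF K4K3[OF x] _ m] d_torsion[OF K4K3[OF x] m] by blast
  define K5 where "K5 = {x \<in> K4. \<forall>m\<in>U. m x = x}"
  have K5_fix: "m x = x" if "x \<in> K5" "m \<in> U" for m x using that unfolding K5_def by blast
  have K5K4: "x \<in> K4" if "x \<in> K5" for x using that by (simp add: K5_def)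
  have m_inv: "m (x \<otimes> inv y) = m x \<otimes> inv (m y)" if "x \<in> K4" "y \<in> K4" "m \<in> U" for m x y
  proof -
    have St: "x \<in> St m" "y \<in> St m" using that K4K3 K3St by auto
    have "inv y \<in> P" using that K4K3 K3P by simp
    then show ?thesis using St_mult[OF St(1)] St_inv(2)[OF UL[OF that(3)] St(2)] by simp
  qed
  have "fi_subgroup G K4 K5"
  proof (rule fi_subgroupI[where F = "\<lambda>x. \<lambda>m\<in>U. d m x"])
    show "subgroup K5 G"
    proof
      fix x y assume xy: "x \<in> K5" "y \<in> K5"
      have "m (x \<otimes> y) = x \<otimes> y" if m: "m \<in> U" for m
      proof -
        have "x \<in> K3" "y \<in> P" using xy K4K3 K3P by (auto simp: K5_def)
        then have "m (x \<otimes> y) = m x \<otimes> m y" using K3St[OF _ m] by (intro St_mult) auto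
        then show ?thesis using K5_fix[OF xy(1) m] K5_fix[OF xy(2) m] by simp
      qed
      then show "x \<otimes> y \<in> K5" using xy by (simp add: K5_def)
    next
      fix x assume x: "x \<in> K5"
      then have xK: "x \<in> K4" by (simp add: K5_def)
      have "m (inv x) = inv x" if m: "m \<in> U" for m
        using St_inv(2)[OF UL[OF m] K3St[OF K4K3[OF xK] m]] K5_fix[OF x m] by simp
      then show "inv x \<in> K5" using xK by (simp add: K5_def)
    qed (use act_one UL in \<open>auto simp: K5_def\<close>)
    have "(\<lambda>x. \<lambda>m\<in>U. d m x) ` K4 \<subseteq> (\<Pi>\<^sub>E m\<in>U. T)" using d_T by auto
    moreover have "finite (\<Pi>\<^sub>E m\<in>U. T)" using U(1) finT by (intro finite_PiE) auto
    ultimately show "finite ((\<lambda>x. \<lambda>m\<in>U. d m x) ` K4)" by (rule finite_subset)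
  next
    fix x y assume x: "x \<in> K4" and y: "y \<in> K4" and eq: "(\<lambda>m\<in>U. d m x) = (\<lambda>m\<in>U. d m y)"
    have P': "x \<in> P" "y \<in> P" using x y K4K3 K3P by auto
    have "m (x \<otimes> inv y) = x \<otimes> inv y" if m: "m \<in> U" for m
    proof -
      have dd: "d m x = d m y" using fun_cong[OF eq, of m] m by simp
      have dc: "d m y \<in> carrier G" using d_Level[OF P'(2) m] by simp
      have "m (x \<otimes> inv y) = (x \<otimes> d m x) \<otimes> inv (y \<otimes> d m y)"
        using m_inv[OF x y m] md[OF P'(1) m] md[OF P'(2) m] by simp
      also have "\<dots> = x \<otimes> inv y"
        using P' dc unfolding dd by (simp add: inv_mult_group m_assoc cancel_left)
      finally show ?thesis .
    qed
    then show "x \<otimes> inv y \<in> K5" using x y by (simp add: K5_def)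
  qed (auto simp: K5_def)
  then have K5: "fi_subgroup G P K5" by (rule fi_subgroup_trans[OF K4 _ P.subset])
  have K5P: "x \<in> P" if "x \<in> K5" for x using that K4K3 K3P by (simp add: K5_def)
  have "m (x \<otimes> y) = x \<otimes> m y" if "m \<in> generate perms U" "x \<in> K5" "y \<in> P" for m x y
    using that
  proof (induction m arbitrary: x y rule: generate.induct)
    case (incl m)
    have "x \<in> St m" using K3St[OF K4K3[OF K5K4]] incl by blast
    from St_mult[OF this incl.prems(2)] show ?case using K5_fix[OF incl.prems(1) incl.hyps] by simp
  next
    case (inv m)
    have St: "x \<in> St m" "m x = x"
      using K3St[OF K4K3[OF K5K4]] K5_fix inv by blast+
    let ?k = "inv_into UNIV m"
    have kL: "?k \<in> L" using perm_inv[OF L UL[OF inv.hyps]] .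
    have "m (x \<otimes> ?k y) = x \<otimes> y"
      using St_mult[OF St(1) act_closed[OF kL inv.prems(2)]] St(2)
        perm_inv_cancel(1)[OF L UL[OF inv.hyps]] by simp
    then have "?k (x \<otimes> y) = x \<otimes> ?k y"
      using perm_inv_cancel(2)[OF L UL[OF inv.hyps], of "x \<otimes> ?k y"] by simp
    then show ?case using perm_bij[OF L UL[OF inv.hyps]] by (simp add: inv_perms)
  next
    case (eng h k)
    have "k \<in> L" using eng.hyps(2) U(3) M_sub_L by blast
    then have "k y \<in> P" using act_closed eng.prems by blast
    then show ?case using eng by simp
  qed simp
  then have "finite ((\<lambda>h. restrict h P) ` M)"
    by (intro finite_action_of_centralised[OF M_sub_L K5]) (simp add: U(3))
  then show ?thesis by - (rule finite_action_of_finite_index[OF L _ fiM], rule act_closed)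
qed

end

theorem finite_self_similar_action:
  assumes "self_similar_action G P L" "virtually_poly_Z G n P"
    and S: "finite S" "S \<subseteq> carrier perms" "generate perms S = L"
  shows "finite ((\<lambda>h. restrict h P) ` L)"
  using assms(1,2)
proof (induction n arbitrary: P)
  case 0
  interpret self_similar_action G P L by (rule 0)
  have "(\<lambda>h. restrict h P) ` L \<subseteq> (P \<rightarrow>\<^sub>E P)" using act_closed by auto
  moreover have "finite (P \<rightarrow>\<^sub>E P)" using 0 by (intro finite_PiE) auto
  ultimately show ?case by (rule finite_subset)
next
  case (Suc n)
  interpret self_similar_action G P L by (rule Suc)
  show ?case by (rule finite_action_step[OF Suc.prems(2) S Suc.IH])
qed


section \<open>Passing from a quotient back to the group\<close>

lemma finite_image_factor:
  assumes "finite (F ` A)" "\<And>x y. x \<in> A \<Longrightarrow> y \<in> A \<Longrightarrow> F x = F y \<Longrightarrow> g x = g y"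
  shows "finite (g ` A)"
proof -
  have "g ` A \<subseteq> (\<lambda>v. g (SOME x. x \<in> A \<and> F x = v)) ` (F ` A)"
  proof
    fix w assume "w \<in> g ` A"
    then obtain x where x: "x \<in> A" "w = g x" by (elim imageE)
    let ?y = "SOME y. y \<in> A \<and> F y = F x"
    have "?y \<in> A \<and> F ?y = F x" by (rule someI[of _ x]) (use x in simp)
    then have "w = g ?y" unfolding x(2) by (intro assms(2)) (use x(1) in simp_all)
    then show "w \<in> (\<lambda>v. g (SOME x. x \<in> A \<and> F x = v)) ` (F ` A)" using x(1) by blast
  qed
  then show ?thesis using assms(1) finite_subset by blast
qed

lemma bij_image: "bij h \<Longrightarrow> bij (image h)"
  by (rule o_bij[of "image (inv_into UNIV h)"])
    (auto simp: fun_eq_iff image_image bij_is_inj bij_is_surj surj_f_inv_f)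

lemma group_hom_image: "group_hom perms perms image"
  by (intro group_hom.intro group_perms group_hom_axioms.intro homI)
    (auto simp: bij_image fun_eq_iff image_comp)

context self_similar_action
begin

text \<open>The elements of \<open>P\<close> at which every element of \<open>L\<close> restricts to itself: the kernel of the action
  of \<open>P\<close> on \<open>L\<close> by restriction.\<close>

definition inert :: "'a set" where
  "inert = {x \<in> P. \<forall>h\<in>L. x \<in> St h}"

lemma inert_St: "x \<in> inert \<Longrightarrow> h \<in> L \<Longrightarrow> x \<in> St h" "x \<in> inert \<Longrightarrow> x \<in> P"
  by (auto simp: inert_def)

lemma inert_mult: "n \<in> inert \<Longrightarrow> h \<in> L \<Longrightarrow> y \<in> P \<Longrightarrow> h (n \<otimes> y) = h n \<otimes> h y"
  by (rule St_mult[OF inert_St(1)])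

lemma inert_subgroup: "subgroup inert G"
proof
  fix x y assume xy: "x \<in> inert" "y \<in> inert"
  show "x \<otimes> y \<in> inert"
    unfolding inert_def
    using subgroup.m_closed[OF St_subgroup] inert_St[OF xy(1)] inert_St[OF xy(2)] by simp
next
  fix x assume x: "x \<in> inert"
  show "inv x \<in> inert"
    unfolding inert_def
    using subgroup.m_inv_closed[OF St_subgroup] inert_St[OF x] by simp
next
  show "\<one> \<in> inert" unfolding inert_def using subgroup.one_closed[OF St_subgroup] by simp
  show "inert \<subseteq> carrier G" by (auto simp: inert_def)
qed

text \<open>If \<open>h'\<close> is the restriction of \<open>h\<close> at \<open>g\<close>, then \<open>x\<close> restricts \<open>h'\<close> to itself and \<open>inv g\<close> takes \<open>h'\<close>
  back to \<open>h\<close>.\<close>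

lemma inert_conj:
  assumes x: "x \<in> inert" and g: "g \<in> P"
  shows "g \<otimes> x \<otimes> inv g \<in> inert"
proof -
  have xP: "x \<in> P" using inert_St(2)[OF x] .
  have "g \<otimes> x \<otimes> inv g \<in> St h" if h: "h \<in> L" for h
  proof -
    obtain h' where h': "h' \<in> L" "\<forall>y\<in>P. h (g \<otimes> y) = h g \<otimes> h' y"
      using act_restriction[OF h g] by (elim bexE)
    have hP: "h g \<in> P" "h' x \<in> P" using act_closed h h' g xP by auto
    have key: "h (g \<otimes> x \<otimes> inv g \<otimes> y) = h g \<otimes> h' x \<otimes> inv (h g) \<otimes> h y" if y: "y \<in> P" for y
    proof -
      have z: "inv g \<otimes> y \<in> P" and hz: "h' (inv g \<otimes> y) \<in> P" using g y act_closed h' by auto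
      have "h (g \<otimes> (inv g \<otimes> y)) = h g \<otimes> h' (inv g \<otimes> y)" using h'(2) z by (rule bspec)
      moreover have "g \<otimes> (inv g \<otimes> y) = y" using g y by (simp add: cancel_left)
      ultimately have hy: "h y = h g \<otimes> h' (inv g \<otimes> y)" by simp
      have "h (g \<otimes> x \<otimes> inv g \<otimes> y) = h (g \<otimes> (x \<otimes> (inv g \<otimes> y)))" using g xP y by (simp add: m_assoc)
      also have "\<dots> = h g \<otimes> h' (x \<otimes> (inv g \<otimes> y))"
        by (rule bspec[OF h'(2)]) (use xP z in simp)
      also have "h' (x \<otimes> (inv g \<otimes> y)) = h' x \<otimes> h' (inv g \<otimes> y)" by (rule inert_mult[OF x h'(1) z])
      finally show ?thesis unfolding hy using hP hz by (simp add: m_assoc cancel_left)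
    qed
    have "h (g \<otimes> x \<otimes> inv g) = h g \<otimes> h' x \<otimes> inv (h g)"
      using key[OF P.one_closed] g xP hP act_one[OF h] by simp
    then show ?thesis using key g xP by (simp add: St_def)
  qed
  then show ?thesis using xP g by (simp add: inert_def)
qed

lemma inert_act:
  assumes h: "h \<in> L" and n: "n \<in> inert"
  shows "h n \<in> inert"
proof -
  have nP: "n \<in> P" using inert_St(2)[OF n] .
  have "k (h n \<otimes> y) = k (h n) \<otimes> k y" if k: "k \<in> L" and y: "y \<in> P" for k y
  proof -
    let ?z = "inv_into UNIV h y"
    have z: "?z \<in> P" "h ?z = y" using act_closed[OF perm_inv[OF L h] y] perm_inv_cancel(1)[OF L h] .
    have "h n \<otimes> y = h (n \<otimes> ?z)" using inert_mult[OF n h z(1)] z(2) by simp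
    then have "k (h n \<otimes> y) = (k \<circ> h) (n \<otimes> ?z)" by simp
    also have "\<dots> = (k \<circ> h) n \<otimes> (k \<circ> h) ?z" by (rule inert_mult[OF n perm_comp[OF L k h] z(1)])
    finally show ?thesis using z(2) by simp
  qed
  then show ?thesis using act_closed[OF h nP] by (simp add: inert_def St_def)
qed

end

locale full_self_similar_action = self_similar_action +
  assumes P_carrier: "P = carrier G"
begin

lemma inert_normal: "inert \<lhd> G"
proof (rule normal_invI[OF inert_subgroup])
  fix g x assume "g \<in> carrier G" "x \<in> inert"
  then show "g \<otimes> x \<otimes> inv g \<in> inert" using inert_conj[of x g] unfolding P_carrier by blast
qed

sublocale N: normal inert G by (rule inert_normal)

lemma image_coset:
  assumes h: "h \<in> L" and x: "x \<in> carrier G"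
  shows "h ` (inert #> x) = inert #> h x"
proof -
  have sub: "k ` (inert #> y) \<subseteq> inert #> k y" if k: "k \<in> L" and y: "y \<in> carrier G" for k y
  proof
    fix b assume "b \<in> k ` (inert #> y)"
    then obtain n where n: "n \<in> inert" "b = k (n \<otimes> y)" unfolding r_coset_def by blast
    then have "b = k n \<otimes> k y" using inert_mult[OF n(1) k] y P_carrier by simp
    then show "b \<in> inert #> k y" using inert_act[OF k n(1)] unfolding r_coset_def by blast
  qed
  let ?k = "inv_into UNIV h"
  have "h x \<in> carrier G" using act_closed[OF h] x P_carrier by simp
  then have "?k ` (inert #> h x) \<subseteq> inert #> ?k (h x)" by (rule sub[OF perm_inv[OF L h]])
  then have "h ` (?k ` (inert #> h x)) \<subseteq> h ` (inert #> x)"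
    using perm_inv_cancel(2)[OF L h] by (intro image_mono) simp
  moreover have "h ` (?k ` B) = B" for B
    using perm_inv_cancel(1)[OF L h] by (simp add: image_image)
  ultimately have "inert #> h x \<subseteq> h ` (inert #> x)" by simp
  then show ?thesis using sub[OF h x] by (intro equalityI)
qed

lemma carrier_Mod: "carrier (G Mod inert) = (\<lambda>x. inert #> x) ` carrier G"
  by (rule carrier_FactGroup)

lemma group_hom_Mod: "group_hom G (G Mod inert) (\<lambda>x. inert #> x)"
  by (intro group_hom.intro is_group N.factorgroup_is_group group_hom_axioms.intro N.r_coset_hom_Mod)

lemma quotient_action:
  shows "self_similar_action (G Mod inert) (carrier (G Mod inert)) (image ` L)"
proof -
  interpret Q: group_hom G "G Mod inert" "\<lambda>x. inert #> x" by (rule group_hom_Mod)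
  interpret I: group_hom perms perms "image :: ('a \<Rightarrow> 'a) \<Rightarrow> 'a set \<Rightarrow> 'a set" by (rule group_hom_image)
  have act: "h x \<in> carrier G" if "h \<in> L" "x \<in> carrier G" for h x
    using act_closed that P_carrier by simp
  show ?thesis
  proof (intro self_similar_action.intro self_similar_action_axioms.intro)
    show "group (G Mod inert)" by (rule N.factorgroup_is_group)
    show "subgroup (carrier (G Mod inert)) (G Mod inert)" by (rule Q.H.subgroup_self)
    show "subgroup (image ` L) perms" by (rule I.subgroup_img_is_subgroup[OF L])
  next
    fix H C assume "H \<in> image ` L" "C \<in> carrier (G Mod inert)"
    then show "H C \<in> carrier (G Mod inert)"
      unfolding carrier_Mod using image_coset act by auto
  next
    fix H assume "H \<in> image ` L"
    then obtain h where h: "h \<in> L" "H = image h" by (elim imageE)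
    have "inert #> \<one> = inert" using N.subset by simp
    then show "H \<one>\<^bsub>G Mod inert\<^esub> = \<one>\<^bsub>G Mod inert\<^esub>"
      using image_coset[OF h(1) one_closed] act_one[OF h(1)] h(2) by simp
  next
    fix H C assume "H \<in> image ` L" "C \<in> carrier (G Mod inert)"
    then obtain h x where h: "h \<in> L" "H = image h" and x: "x \<in> carrier G" "C = inert #> x"
      unfolding carrier_Mod by (elim imageE)
    obtain h' where h': "h' \<in> L" "\<forall>y\<in>P. h (x \<otimes> y) = h x \<otimes> h' y"
      using act_restriction[OF h(1)] x(1) P_carrier by blast
    show "\<exists>H'\<in>image ` L. \<forall>D\<in>carrier (G Mod inert).
        H (C \<otimes>\<^bsub>G Mod inert\<^esub> D) = H C \<otimes>\<^bsub>G Mod inert\<^esub> H' D"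
    proof (intro bexI ballI)
      fix D assume "D \<in> carrier (G Mod inert)"
      then obtain y where y: "y \<in> carrier G" "D = inert #> y" unfolding carrier_Mod by (elim imageE)
      have "H (C \<otimes>\<^bsub>G Mod inert\<^esub> D) = inert #> h (x \<otimes> y)"
        using x y h Q.hom_mult[OF x(1) y(1), symmetric] image_coset[OF h(1), of "x \<otimes> y"] by simp
      also have "h (x \<otimes> y) = h x \<otimes> h' y" using h'(2) y(1) P_carrier by simp
      also have "inert #> (h x \<otimes> h' y) = (inert #> h x) \<otimes>\<^bsub>G Mod inert\<^esub> (inert #> h' y)"
        by (rule Q.hom_mult[OF act[OF h(1) x(1)] act[OF h'(1) y(1)]])
      finally show "H (C \<otimes>\<^bsub>G Mod inert\<^esub> D) = H C \<otimes>\<^bsub>G Mod inert\<^esub> (image h') D"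
        using image_coset h x y h'(1) by simp
    qed (use h'(1) in blast)
  next
    fix C assume "C \<in> carrier (G Mod inert)"
    then obtain x where x: "x \<in> carrier G" "C = inert #> x" unfolding carrier_Mod by (elim imageE)
    have "(\<lambda>H. H C) ` image ` L = (\<lambda>y. inert #> y) ` ((\<lambda>h. h x) ` L)"
      unfolding image_image x(2) by (rule image_cong[OF refl]) (rule image_coset[OF _ x(1)])
    then show "finite ((\<lambda>H. H C) ` image ` L)" using act_orbit x(1) P_carrier by simp
  next
    fix H assume "H \<in> image ` L"
    then obtain h where h: "h \<in> L" "H = image h" by (elim imageE)
    let ?G = "\<lambda>C. \<lambda>D\<in>carrier (G Mod inert). inv\<^bsub>G Mod inert\<^esub> (H C) \<otimes>\<^bsub>G Mod inert\<^esub> H (C \<otimes>\<^bsub>G Mod inert\<^esub> D)"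
    let ?F = "\<lambda>x. \<lambda>y\<in>P. inv (h x) \<otimes> h (x \<otimes> y)"
    have val: "?G (inert #> x) (inert #> y) = inert #> ?F x y"
      if x: "x \<in> carrier G" and y: "y \<in> carrier G" for x y
    proof -
      have D: "inert #> y \<in> carrier (G Mod inert)" unfolding carrier_Mod using y by blast
      have xy: "(inert #> x) \<otimes>\<^bsub>G Mod inert\<^esub> (inert #> y) = inert #> (x \<otimes> y)"
        by (rule Q.hom_mult[OF x y, symmetric])
      have "?G (inert #> x) (inert #> y)
          = inv\<^bsub>G Mod inert\<^esub> (inert #> h x) \<otimes>\<^bsub>G Mod inert\<^esub> (inert #> h (x \<otimes> y))"
        using D by (simp only: restrict_apply if_True xy h(2) image_coset[OF h(1) x]
            image_coset[OF h(1) m_closed[OF x y]])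
      also have "\<dots> = inert #> (inv (h x) \<otimes> h (x \<otimes> y))"
        using act[OF h(1)] x y by (simp only: Q.hom_inv[symmetric] Q.hom_mult[symmetric] inv_closed m_closed)
      finally show ?thesis using y P_carrier by simp
    qed
    have "finite ((\<lambda>x. ?G (inert #> x)) ` carrier G)"
    proof (rule finite_image_factor)
      show "finite (?F ` carrier G)" using act_restrictions[OF h(1)] P_carrier by simp
      fix x x' assume x: "x \<in> carrier G" "x' \<in> carrier G" "?F x = ?F x'"
      show "?G (inert #> x) = ?G (inert #> x')"
      proof
        fix D
        show "?G (inert #> x) D = ?G (inert #> x') D"
        proof (cases "D \<in> carrier (G Mod inert)")
          case True
          then obtain y where y: "y \<in> carrier G" "D = inert #> y" unfolding carrier_Mod by (elim imageE)
          show ?thesis unfolding y(2) val[OF x(1) y(1)] val[OF x(2) y(1)] x(3) ..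
        next
          case False
          then show ?thesis by (simp only: restrict_apply if_False)
        qed
      qed
    qed
    then show "finite (?G ` carrier (G Mod inert))" unfolding carrier_Mod image_image .
  qed
qed

text \<open>Let \<open>M\<close> be the kernel of the action on the quotient. The restriction of \<open>h\<close> at \<open>x\<close> depends only on
  the coset of \<open>x\<close> modulo \<open>inert\<close>, and the elements of \<open>M\<close> preserve these cosets. Hence restriction
  at \<open>x\<close> is multiplicative on \<open>M\<close>, and it is multiplicative on products of a coset representative
  with an element of \<open>M\<close>. So \<open>x\<close> is inert as soon as it restricts to themselves the generators
  \<open>U\<close> of \<open>M\<close> and the representatives \<open>R\<close> of the left cosets of \<open>M\<close>.\<close>

lemma inert_finite_index:
  assumes gen: "finite S" "S \<subseteq> carrier perms" "generate perms S = L"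
    and fin: "finite ((\<lambda>H. restrict H (carrier (G Mod inert))) ` image ` L)"
  shows "fi_subgroup G (carrier G) inert"
proof -
  interpret perms: group perms by (rule group_perms)
  have act: "h x \<in> carrier G" if "h \<in> L" "x \<in> carrier G" for h x
    using act_closed that P_carrier by simp
  have Lc: "L \<subseteq> carrier perms" by (rule subgroup.subset[OF L])
  define M where "M = {h \<in> L. \<forall>x\<in>carrier G. inert #> h x = inert #> x}"
  have M_sub_L: "M \<subseteq> L" by (auto simp: M_def)
  have M_coset: "inert #> m x = inert #> x" if "m \<in> M" "x \<in> carrier G" for m x
    using that by (simp add: M_def)
  have Msub: "subgroup M perms"
  proof (rule subgroup_permsI)
    show "id \<in> M" using perm_id[OF L] by (simp add: M_def)
    show "bij h" if "h \<in> M" for h using perm_bij[OF L] M_sub_L that by blast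
    show "h \<circ> k \<in> M" if h: "h \<in> M" and k: "k \<in> M" for h k
    proof -
      have kL: "k \<in> L" and hk: "h \<circ> k \<in> L" using h k M_sub_L perm_comp[OF L] by blast+
      have "inert #> (h \<circ> k) x = inert #> x" if "x \<in> carrier G" for x
        using M_coset[OF h act[OF kL that]] M_coset[OF k that] by simp
      then show ?thesis using hk by (simp add: M_def)
    qed
    show "inv_into UNIV h \<in> M" if h: "h \<in> M" for h
    proof -
      have hL: "h \<in> L" using h M_sub_L by blast
      note inv = perm_inv[OF L hL] and canc = perm_inv_cancel[OF L hL]
      have "inert #> inv_into UNIV h x = inert #> x" if "x \<in> carrier G" for x
        using M_coset[OF h act[OF inv that]] canc(1)[of x] by simp
      then show ?thesis using inv by (simp add: M_def)
    qed
  qed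
  have fiM: "fi_subgroup perms L M"
  proof (rule perms.fi_subgroupI[where F = "\<lambda>h. restrict (image h) (carrier (G Mod inert))", OF Msub M_sub_L Lc])
    show "finite ((\<lambda>h. restrict (image h) (carrier (G Mod inert))) ` L)"
      using fin unfolding image_image .
    fix h k assume hk: "h \<in> L" "k \<in> L"
      and eq: "restrict (image h) (carrier (G Mod inert)) = restrict (image k) (carrier (G Mod inert))"
    note inv = perm_inv[OF L hk(2)] and canc = perm_inv_cancel[OF L hk(2)]
    have eq': "inert #> h x = inert #> k x" if x: "x \<in> carrier G" for x
    proof -
      have "inert #> x \<in> carrier (G Mod inert)" unfolding carrier_Mod using x by blast
      then have "h ` (inert #> x) = k ` (inert #> x)"
        using fun_cong[OF eq, of "inert #> x"] by simp
      then show ?thesis using image_coset hk x by simp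
    qed
    have "inert #> (h \<circ> inv_into UNIV k) x = inert #> x" if x: "x \<in> carrier G" for x
      using eq'[OF act[OF inv x]] canc(1)[of x] by simp
    then have "h \<circ> inv_into UNIV k \<in> M"
      using perm_comp[OF L hk(1) inv] unfolding M_def by blast
    then show "h \<otimes>\<^bsub>perms\<^esub> inv\<^bsub>perms\<^esub> k \<in> M" using perm_bij[OF L hk(2)] by (simp add: inv_perms)
  qed
  have "fi_subgroup perms (generate perms S) M" using fiM gen(3) by simp
  then obtain U where U: "finite U" "U \<subseteq> carrier perms" "generate perms U = M"
    by (rule perms.schreier[OF gen(1,2)]) (rule that)
  have UM: "U \<subseteq> M" using U(3) generate.incl[of _ U perms] by blast
  have UL: "m \<in> L" if "m \<in> U" for m using that UM M_sub_L by blast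
  obtain c where c: "\<And>h. h \<in> L \<Longrightarrow> c h \<in> L" "\<And>h. h \<in> L \<Longrightarrow> h \<otimes>\<^bsub>perms\<^esub> inv\<^bsub>perms\<^esub> (c h) \<in> M"
    and cf: "finite (c ` L)"
    using perms.fi_subgroup_transversal[OF fiM Lc] by metis
  define R where "R = (\<lambda>h. inv_into UNIV h) ` c ` L"
  have R: "finite R" "R \<subseteq> L" unfolding R_def using cf c(1) perm_inv[OF L] by auto
  define K where "K = {x \<in> P. \<forall>m\<in>U \<union> R. x \<in> St m}"
  have K: "fi_subgroup G P K"
    unfolding K_def using U(1) R UL by (intro fi_subgroup_INT P St_fi) auto
  have KSt: "x \<in> St m" if "x \<in> K" "m \<in> U \<union> R" for x m using that unfolding K_def by blast
  have KP: "x \<in> P" if "x \<in> K" for x using that by (simp add: K_def)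
  have St_coset: "m x \<in> St h" if m: "m \<in> M" and h: "h \<in> L" and x: "x \<in> St h" for m h x
  proof -
    have xc: "x \<in> carrier G" using St_P[OF x] by simp
    have "m x \<in> inert #> x"
      using M_coset[OF m xc] rcos_self[OF act[OF _ xc] inert_subgroup] m M_sub_L by blast
    then obtain n where n: "n \<in> inert" "m x = n \<otimes> x" unfolding r_coset_def by blast
    show ?thesis unfolding n(2)
      by (rule subgroup.m_closed[OF St_subgroup[OF h] inert_St(1)[OF n(1) h] x])
  qed
  have M_St: "x \<in> St m" if "m \<in> generate perms U" "x \<in> K" for m x
    using that
  proof (induction m arbitrary: x rule: generate.induct)
    case one
    then show ?case using KP by (simp add: St_def)
  next
    case (incl m)
    then show ?case using KSt by blast
  next
    case (inv m)
    have mL: "m \<in> L" and mM: "m \<in> M" using inv UL UM by auto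
    let ?k = "inv_into UNIV m"
    have kM: "?k \<in> M" by (rule perm_inv[OF Msub mM])
    have kL: "?k \<in> L" using kM M_sub_L by blast
    have w: "?k x \<in> St m" by (rule St_coset[OF kM mL]) (use KSt inv in blast)
    have "?k (x \<otimes> y) = ?k x \<otimes> ?k y" if y: "y \<in> P" for y
    proof -
      have "m (?k x \<otimes> ?k y) = x \<otimes> y"
        using St_mult[OF w act_closed[OF kL y]] perm_inv_cancel(1)[OF L mL] by simp
      then show ?thesis using perm_inv_cancel(2)[OF L mL, of "?k x \<otimes> ?k y"] by simp
    qed
    then show ?case using KP[OF inv.prems] perm_bij[OF L mL] by (simp add: St_def inv_perms)
  next
    case (eng h k)
    have M: "h \<in> M" "k \<in> M" using eng.hyps U(3) by auto
    then have hL: "h \<in> L" and kL: "k \<in> L" using M_sub_L by auto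
    have kx: "k x \<in> St h" by (rule St_coset[OF M(2) hL eng.IH(1)[OF eng.prems]])
    have "h (k (x \<otimes> y)) = h (k x) \<otimes> h (k y)" if y: "y \<in> P" for y
      using St_mult[OF eng.IH(2)[OF eng.prems] y] St_mult[OF kx act_closed[OF kL y]] by simp
    then show ?case using KP[OF eng.prems] by (simp add: St_def)
  qed
  have "x \<in> St h" if x: "x \<in> K" and h: "h \<in> L" for x h
  proof -
    let ?g = "inv_into UNIV h"
    have g: "?g \<in> L" by (rule perm_inv[OF L h])
    note cL = c(1)[OF g]
    let ?r = "inv_into UNIV (c ?g)" and ?m = "c ?g \<circ> h"
    have "?g \<circ> ?r \<in> M" using c(2)[OF g] perm_bij[OF L cL] by (simp add: inv_perms)
    then have "inv_into UNIV (?g \<circ> ?r) \<in> M" by (rule perm_inv[OF Msub])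
    moreover have "inv_into UNIV (?g \<circ> ?r) = ?m"
    proof (rule inv_unique_comp)
      show "(?g \<circ> ?r) \<circ> ?m = id" "?m \<circ> (?g \<circ> ?r) = id"
        using perm_inv_cancel[OF L h] perm_inv_cancel[OF L cL] by (auto simp: fun_eq_iff)
    qed
    ultimately have mM: "?m \<in> M" by simp
    have r: "?r \<in> R" "?r \<in> L" using R(2) g unfolding R_def by blast+
    have h_eq: "h z = ?r (?m z)" for z using perm_inv_cancel(2)[OF L cL] by simp
    have mL: "?m \<in> L" using mM M_sub_L by blast
    have mx: "?m x \<in> St ?r" by (rule St_coset[OF mM r(2)]) (use KSt[OF x] r(1) in blast)
    have mgen: "?m \<in> generate perms U" using mM U(3) by simp
    have "h (x \<otimes> y) = h x \<otimes> h y" if y: "y \<in> P" for y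
    proof -
      have "h (x \<otimes> y) = ?r (?m (x \<otimes> y))" by (rule h_eq)
      also have "?m (x \<otimes> y) = ?m x \<otimes> ?m y" by (rule St_mult[OF M_St[OF mgen x] y])
      also have "?r (?m x \<otimes> ?m y) = ?r (?m x) \<otimes> ?r (?m y)" by (rule St_mult[OF mx act_closed[OF mL y]])
      also have "\<dots> = h x \<otimes> h y" by (simp only: h_eq[symmetric])
      finally show ?thesis .
    qed
    then show ?thesis using KP[OF x] by (simp add: St_def)
  qed
  then have "K \<subseteq> inert" using KP unfolding inert_def by blast
  then have "fi_subgroup G P inert"
    using fi_subgroup_mono[OF K inert_subgroup] inert_St(2) P.subset by blast
  then show ?thesis by (simp add: P_carrier)
qed

text \<open>An element of \<open>L\<close> is determined by its values on generators of \<open>inert\<close> and on coset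
  representatives.\<close>

lemma finite_action_of_inert:
  assumes S: "finite S" "S \<subseteq> carrier G" "generate G S = carrier G"
    and fi: "fi_subgroup G (carrier G) inert"
  shows "finite ((\<lambda>h. restrict h (carrier G)) ` L)"
proof -
  have "fi_subgroup G (generate G S) inert" using fi S(3) by simp
  then obtain V where V: "finite V" "V \<subseteq> carrier G" "generate G V = inert"
    by (rule schreier[OF S(1,2)]) (rule that)
  obtain t where t: "\<And>x. x \<in> carrier G \<Longrightarrow> t x \<in> carrier G"
      "\<And>x. x \<in> carrier G \<Longrightarrow> x \<otimes> inv (t x) \<in> inert" and tf: "finite (t ` carrier G)"
    using fi_subgroup_transversal[OF fi subset_refl] by metis
  let ?B = "V \<union> t ` carrier G"
  have BP: "?B \<subseteq> P" using V(2) t(1) P_carrier by auto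
  show ?thesis
  proof (rule finite_image_factor[where F = "\<lambda>h. restrict h ?B"])
    have "(\<lambda>h. restrict h ?B) ` L \<subseteq> (\<Pi>\<^sub>E b\<in>?B. (\<lambda>h. h b) ` L)"
      by (rule image_subsetI) (simp only: restrict_PiE_iff, blast)
    moreover have "finite (\<Pi>\<^sub>E b\<in>?B. (\<lambda>h. h b) ` L)"
      using V(1) tf BP act_orbit by (intro finite_PiE) auto
    ultimately show "finite ((\<lambda>h. restrict h ?B) ` L)" by (rule finite_subset)
  next
    fix h k assume hk: "h \<in> L" "k \<in> L" and eq: "restrict h ?B = restrict k ?B"
    have eqB: "h b = k b" if "b \<in> ?B" for b using fun_cong[OF eq, of b] that by simp
    have eqN: "h n = k n" if "n \<in> generate G V" for n
      using that
    proof (induction n rule: generate.induct)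
      case one
      then show ?case using act_one[OF hk(1)] act_one[OF hk(2)] by simp
    next
      case (incl v)
      then show ?case using eqB by simp
    next
      case (inv v)
      have "v \<in> inert" using inv V(3) generate.incl[of v V G] by blast
      then show ?case
        using St_inv(2)[OF hk(1) inert_St(1)[OF _ hk(1)]] St_inv(2)[OF hk(2) inert_St(1)[OF _ hk(2)]]
          eqB[of v] inv by simp
    next
      case (eng a b)
      then have ab: "a \<in> inert" "b \<in> P" using V(3) inert_St(2) by auto
      show ?case
        using inert_mult[OF ab(1) hk(1) ab(2)] inert_mult[OF ab(1) hk(2) ab(2)] eng.IH by simp
    qed
    show "restrict h (carrier G) = restrict k (carrier G)"
    proof (rule restrict_ext)
      fix y assume y: "y \<in> carrier G"
      have n: "y \<otimes> inv (t y) \<in> inert" and tP: "t y \<in> P" using t[OF y] P_carrier by simp_all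
      have "h (y \<otimes> inv (t y) \<otimes> t y) = h (y \<otimes> inv (t y)) \<otimes> h (t y)"
        by (rule inert_mult[OF n hk(1) tP])
      also have "\<dots> = k (y \<otimes> inv (t y)) \<otimes> k (t y)" using eqN n V(3) eqB y by simp
      also have "\<dots> = k (y \<otimes> inv (t y) \<otimes> t y)" by (rule inert_mult[OF n hk(2) tP, symmetric])
      finally show "h y = k y" using y t(1)[OF y] by (simp add: m_assoc)
    qed
  qed
qed

theorem finite_action_of_virtually_nilpotent_quotient:
  assumes G: "finitely_generated G" and gen: "finite S" "S \<subseteq> carrier perms" "generate perms S = L"
    and nil: "virtually_nilpotent (G Mod inert)"
  shows "finite ((\<lambda>h. restrict h (carrier G)) ` L)"
proof -
  interpret Q: group_hom G "G Mod inert" "\<lambda>x. inert #> x" by (rule group_hom_Mod)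
  interpret I: group_hom perms perms "image :: ('a \<Rightarrow> 'a) \<Rightarrow> 'a set \<Rightarrow> 'a set" by (rule group_hom_image)
  obtain T where T: "finite T" "T \<subseteq> carrier G" "generate G T = carrier G"
    using G by (auto simp: finitely_generated_def finite_generating_set_def)
  have "generate (G Mod inert) ((\<lambda>x. inert #> x) ` T) = carrier (G Mod inert)"
    unfolding carrier_Mod using Q.generate_img[OF T(2)] T(3) by simp
  then have "finitely_generated (G Mod inert)"
    unfolding finitely_generated_def finite_generating_set_def
    using T unfolding carrier_Mod by (intro exI[of _ "(\<lambda>x. inert #> x) ` T"]) auto
  then obtain n where n: "virtually_poly_Z (G Mod inert) n (carrier (G Mod inert))"
    using nil by (rule Q.H.virtually_poly_Z_virtually_nilpotent) (rule that)
  have "finite ((\<lambda>H. restrict H (carrier (G Mod inert))) ` image ` L)"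
  proof (rule finite_self_similar_action[OF quotient_action n])
    show "finite (image ` S)" "image ` S \<subseteq> carrier perms" using gen(1,2) bij_image by auto
    show "generate perms (image ` S) = image ` L" using I.generate_img[OF gen(2)] gen(3) by simp
  qed
  then have "fi_subgroup G (carrier G) inert" by (rule inert_finite_index[OF gen])
  then show ?thesis by (rule finite_action_of_inert[OF T])
qed

end


section \<open>Automorphisms of Cayley graphs and their restrictions\<close>

locale cayley = group +
  fixes A
  assumes A: "finite A" "A \<subseteq> carrier G" "generate G A = carrier G"
    and A_inv: "\<And>a. a \<in> A \<Longrightarrow> inv a \<in> A"
begin

text \<open>The automorphisms of the Cayley graph with fixed point \<open>\<one>\<close>, extended by the identity to the
  type; the last condition says that arcs are preserved.\<close>

definition cayley_auts :: "('a \<Rightarrow> 'a) set" where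
  "cayley_auts = {h. bij h \<and> (\<forall>x. x \<notin> carrier G \<longrightarrow> h x = x) \<and> (\<forall>x\<in>carrier G. h x \<in> carrier G) \<and>
     h \<one> = \<one> \<and> (\<forall>x\<in>carrier G. \<forall>y\<in>carrier G. inv (h x) \<otimes> h y \<in> A \<longleftrightarrow> inv x \<otimes> y \<in> A)}"

definition restriction :: "('a \<Rightarrow> 'a) \<Rightarrow> 'a \<Rightarrow> 'a \<Rightarrow> 'a" where
  "restriction h x = (\<lambda>y. if y \<in> carrier G then inv (h x) \<otimes> h (x \<otimes> y) else y)"

lemma cayley_autsD:
  assumes "h \<in> cayley_auts"
  shows "bij h" "x \<notin> carrier G \<Longrightarrow> h x = x" "x \<in> carrier G \<Longrightarrow> h x \<in> carrier G" "h \<one> = \<one>"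
    "x \<in> carrier G \<Longrightarrow> y \<in> carrier G \<Longrightarrow> inv (h x) \<otimes> h y \<in> A \<longleftrightarrow> inv x \<otimes> y \<in> A"
  using assms unfolding cayley_auts_def by blast+

lemma cayley_auts_inv_closed:
  assumes h: "h \<in> cayley_auts" and x: "x \<in> carrier G"
  shows "inv_into UNIV h x \<in> carrier G"
proof (rule ccontr)
  assume *: "inv_into UNIV h x \<notin> carrier G"
  have "h (inv_into UNIV h x) = x" using cayley_autsD(1)[OF h] by (simp add: bij_is_surj surj_f_inv_f)
  then have "inv_into UNIV h x = x" using cayley_autsD(2)[OF h *] by simp
  with * x show False by simp
qed

lemma subgroup_cayley_auts: "subgroup cayley_auts perms"
proof (rule subgroup_permsI)
  show "id \<in> cayley_auts" by (simp add: cayley_auts_def)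
  show "bij h" if "h \<in> cayley_auts" for h using cayley_autsD(1)[OF that] .
  show "h \<circ> k \<in> cayley_auts" if h: "h \<in> cayley_auts" and k: "k \<in> cayley_auts" for h k
    unfolding cayley_auts_def
    using bij_comp[OF cayley_autsD(1)[OF k] cayley_autsD(1)[OF h]] cayley_autsD(2-)[OF h] cayley_autsD(2-)[OF k]
    by simp
  show "inv_into UNIV h \<in> cayley_auts" if h: "h \<in> cayley_auts" for h
  proof -
    let ?k = "inv_into UNIV h"
    have hk: "h (?k x) = x" and kh: "?k (h x) = x" for x
      using cayley_autsD(1)[OF h] by (simp_all add: bij_is_surj surj_f_inv_f bij_is_inj)
    have "?k x = x" if "x \<notin> carrier G" for x using kh[of x] cayley_autsD(2)[OF h that] by simp
    moreover have "?k \<one> = \<one>" using kh[of \<one>] cayley_autsD(4)[OF h] by simp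
    moreover have "inv (?k x) \<otimes> ?k y \<in> A \<longleftrightarrow> inv x \<otimes> y \<in> A" if "x \<in> carrier G" "y \<in> carrier G" for x y
      using cayley_autsD(5)[OF h cayley_auts_inv_closed[OF h that(1)] cayley_auts_inv_closed[OF h that(2)]]
      by (simp add: hk)
    ultimately show ?thesis
      using cayley_auts_inv_closed[OF h] bij_imp_bij_inv[OF cayley_autsD(1)[OF h]]
      unfolding cayley_auts_def by blast
  qed
qed

lemma restriction_apply: "h \<in> cayley_auts \<Longrightarrow> x \<in> carrier G \<Longrightarrow> y \<in> carrier G \<Longrightarrow> h (x \<otimes> y) = h x \<otimes> restriction h x y"
  by (simp add: restriction_def cancel_left cayley_autsD(3))

lemma restriction_restriction:
  assumes h: "h \<in> cayley_auts" and x: "x \<in> carrier G" and y: "y \<in> carrier G"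
  shows "restriction (restriction h x) y = restriction h (x \<otimes> y)"
proof
  fix z
  show "restriction (restriction h x) y z = restriction h (x \<otimes> y) z"
  proof (cases "z \<in> carrier G")
    case True
    have c: "h x \<in> carrier G" "h (x \<otimes> y) \<in> carrier G" "h (x \<otimes> (y \<otimes> z)) \<in> carrier G"
      using x y True cayley_autsD(3)[OF h] by simp_all
    have "inv (inv (h x) \<otimes> h (x \<otimes> y)) \<otimes> (inv (h x) \<otimes> h (x \<otimes> (y \<otimes> z)))
        = inv (h (x \<otimes> y)) \<otimes> h (x \<otimes> (y \<otimes> z))"
      using c by (simp add: inv_mult_group m_assoc cancel_left)
    then show ?thesis using True x y by (simp add: restriction_def m_assoc)
  qed (simp add: restriction_def)
qed

lemma restriction_one: "h \<in> cayley_auts \<Longrightarrow> restriction h \<one> = h"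
  by (auto simp: restriction_def fun_eq_iff cayley_autsD(2-4))

lemma restriction_comp:
  assumes h: "h \<in> cayley_auts" and k: "k \<in> cayley_auts" and x: "x \<in> carrier G"
  shows "restriction (h \<circ> k) x = restriction h (k x) \<circ> restriction k x"
proof
  fix y
  show "restriction (h \<circ> k) x y = (restriction h (k x) \<circ> restriction k x) y"
  proof (cases "y \<in> carrier G")
    case True
    have c: "k x \<in> carrier G" "k (x \<otimes> y) \<in> carrier G"
      using x True cayley_autsD(3)[OF k] by simp_all
    then show ?thesis using True by (simp add: restriction_def cancel_left)
  qed (simp add: restriction_def)
qed

lemma restriction_inv:
  assumes h: "h \<in> cayley_auts" and x: "x \<in> carrier G"
  shows "restriction (inv_into UNIV h) (h x) \<circ> restriction h x = id" "restriction h x \<circ> restriction (inv_into UNIV h) (h x) = id"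
proof -
  let ?k = "inv_into UNIV h"
  have k: "?k \<in> cayley_auts" by (rule perm_inv[OF subgroup_cayley_auts h])
  have hk: "h \<circ> ?k = id" "?k \<circ> h = id" and kh: "?k (h x) = x"
    using cayley_autsD(1)[OF h] by (simp_all add: bij_is_surj surj_f_inv_f bij_is_inj fun_eq_iff)
  have id: "restriction id y = id" if "y \<in> carrier G" for y
    using that by (auto simp: restriction_def fun_eq_iff cancel_left)
  show "restriction ?k (h x) \<circ> restriction h x = id"
    using restriction_comp[OF k h x] id[OF x] by (simp add: hk)
  show "restriction h x \<circ> restriction ?k (h x) = id"
    using restriction_comp[OF h k cayley_autsD(3)[OF h x]] id[OF cayley_autsD(3)[OF h x]] by (simp add: hk kh)
qed

lemma restriction_closed:
  assumes h: "h \<in> cayley_auts" and x: "x \<in> carrier G"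
  shows "restriction h x \<in> cayley_auts"
proof -
  have "bij (restriction h x)" by (rule o_bij[OF restriction_inv[OF h x]])
  moreover have "inv (restriction h x y) \<otimes> restriction h x z \<in> A \<longleftrightarrow> inv y \<otimes> z \<in> A"
    if y: "y \<in> carrier G" and z: "z \<in> carrier G" for y z
  proof -
    have c: "h x \<in> carrier G" "h (x \<otimes> y) \<in> carrier G" "h (x \<otimes> z) \<in> carrier G"
      using x y z cayley_autsD(3)[OF h] by simp_all
    have "inv (restriction h x y) \<otimes> restriction h x z = inv (h (x \<otimes> y)) \<otimes> h (x \<otimes> z)"
      using c y z by (simp add: restriction_def inv_mult_group m_assoc cancel_left)
    also have "\<dots> \<in> A \<longleftrightarrow> inv (x \<otimes> y) \<otimes> (x \<otimes> z) \<in> A"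
      using x y z by (intro cayley_autsD(5)[OF h]) auto
    also have "inv (x \<otimes> y) \<otimes> (x \<otimes> z) = inv y \<otimes> z"
      using x y z by (simp add: inv_mult_group m_assoc cancel_left)
    finally show ?thesis .
  qed
  ultimately show ?thesis
    using x cayley_autsD(3)[OF h] unfolding cayley_auts_def by (simp add: restriction_def)
qed

lemma cayley_auts_A: "h \<in> cayley_auts \<Longrightarrow> a \<in> A \<Longrightarrow> h a \<in> A"
  using cayley_autsD(5)[of h \<one> a] cayley_autsD(3)[of h a] cayley_autsD(4)[of h] A(2) by auto

text \<open>Automorphisms with fixed point \<open>\<one>\<close> preserve the length of \<open>x\<close> as a word in \<open>A\<close>; the induction
  avoids lengths by means of restrictions.\<close>

lemma cayley_auts_orbit:
  assumes "x \<in> carrier G"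
  shows "finite ((\<lambda>h. h x) ` cayley_auts)"
proof -
  have "x \<in> generate G A" using assms A(3) by simp
  then show ?thesis
  proof (induction x rule: generate.induct)
    case one
    have "(\<lambda>h. h \<one>) ` cayley_auts \<subseteq> {\<one>}" using cayley_autsD(4) by auto
    then show ?case by (rule finite_subset) simp
  next
    case (incl a)
    have "(\<lambda>h. h a) ` cayley_auts \<subseteq> A" using cayley_auts_A incl by auto
    then show ?case using A(1) by (rule finite_subset)
  next
    case (inv a)
    have "(\<lambda>h. h (inv a)) ` cayley_auts \<subseteq> A" using cayley_auts_A A_inv[OF inv] by auto
    then show ?case using A(1) by (rule finite_subset)
  next
    case (eng x y)
    have xy: "x \<in> carrier G" "y \<in> carrier G" using eng A(3) by auto
    have "(\<lambda>h. h (x \<otimes> y)) ` cayley_auts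
        \<subseteq> (\<lambda>(u, v). u \<otimes> v) ` ((\<lambda>h. h x) ` cayley_auts \<times> (\<lambda>h. h y) ` cayley_auts)"
    proof
      fix z assume "z \<in> (\<lambda>h. h (x \<otimes> y)) ` cayley_auts"
      then obtain h where h: "h \<in> cayley_auts" "z = h (x \<otimes> y)" by (elim imageE)
      then have "z = (\<lambda>(u, v). u \<otimes> v) (h x, restriction h x y)" using restriction_apply xy by simp
      then show "z \<in> (\<lambda>(u, v). u \<otimes> v) ` ((\<lambda>h. h x) ` cayley_auts \<times> (\<lambda>h. h y) ` cayley_auts)"
        using h(1) restriction_closed[OF h(1) xy(1)] by blast
    qed
    then show ?case
      by (rule finite_subset) (intro finite_imageI finite_cartesian_product eng.IH)
  qed
qed

end

locale cayley_states = cayley +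
  fixes Q
  assumes Q: "finite Q" "Q \<subseteq> cayley_auts"
    and Q_restriction: "\<And>q x. q \<in> Q \<Longrightarrow> x \<in> carrier G \<Longrightarrow> restriction q x \<in> Q"
    and Q_inv: "\<And>q. q \<in> Q \<Longrightarrow> inv_into UNIV q \<in> Q"
begin

abbreviation L where "L \<equiv> generate perms Q"

lemma Q_perms: "Q \<subseteq> carrier perms"
  using Q(2) cayley_autsD(1) by auto

lemma L_auts: "L \<subseteq> cayley_auts"
  by (rule group.generate_subgroup_incl[OF group_perms Q(2) subgroup_cayley_auts])

lemma Q_auts: "q \<in> Q \<Longrightarrow> q \<in> cayley_auts"
  using Q(2) by blast

lemma L_subgroup: "subgroup L perms"
  by (rule group.generate_is_subgroup[OF group_perms Q_perms])

lemma L_restriction: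
  assumes "h \<in> L"
  shows "(\<forall>x\<in>carrier G. restriction h x \<in> L) \<and> finite (restriction h ` carrier G)"
  using assms
proof (induction h rule: generate.induct)
  case one
  have "restriction id x = id" if "x \<in> carrier G" for x
    using that by (auto simp: restriction_def fun_eq_iff cancel_left)
  moreover have "restriction id ` carrier G \<subseteq> {id}" using calculation by blast
  then have "finite (restriction id ` carrier G)" by (rule finite_subset) simp
  moreover have "id \<in> L" using generate.one[of perms Q] by simp
  ultimately show ?case unfolding perms_simps by metis
next
  case (incl q)
  have "restriction q ` carrier G \<subseteq> Q" using Q_restriction[OF incl] by auto
  then show ?case using Q(1) finite_subset generate.incl[of _ Q perms] by blast
next
  case (inv q)
  have eq: "inv\<^bsub>perms\<^esub> q = inv_into UNIV q" using inv_perms cayley_autsD(1)[OF Q_auts[OF inv]] .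
  have "restriction (inv_into UNIV q) ` carrier G \<subseteq> Q" using Q_restriction[OF Q_inv[OF inv]] by auto
  then show ?case unfolding eq using Q(1) finite_subset generate.incl[of _ Q perms] by blast
next
  case (eng h k)
  have hk: "h \<in> cayley_auts" "k \<in> cayley_auts" using eng.hyps L_auts by auto
  have c: "restriction (h \<circ> k) x = restriction h (k x) \<circ> restriction k x" if "x \<in> carrier G" for x by (rule restriction_comp[OF hk that])
  have kx: "k x \<in> carrier G" if "x \<in> carrier G" for x using cayley_autsD(3)[OF hk(2) that] .
  have "restriction (h \<circ> k) x \<in> L" if "x \<in> carrier G" for x
    unfolding c[OF that] using eng.IH kx that by (intro perm_comp[OF L_subgroup]) auto
  moreover have "restriction (h \<circ> k) ` carrier G \<subseteq> (\<lambda>(a, b). a \<circ> b) ` (restriction h ` carrier G \<times> restriction k ` carrier G)"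
    using c kx by force
  then have "finite (restriction (h \<circ> k) ` carrier G)"
    by (rule finite_subset) (intro finite_imageI finite_cartesian_product conjunct2[OF eng.IH(1)] conjunct2[OF eng.IH(2)])
  ultimately show ?case unfolding perms_simps by blast
qed

lemma L_action: "full_self_similar_action G (carrier G) L"
proof (intro full_self_similar_action.intro self_similar_action.intro self_similar_action_axioms.intro
    full_self_similar_action_axioms.intro)
  fix h x assume h: "h \<in> L" and x: "x \<in> carrier G"
  have hA: "h \<in> cayley_auts" using h L_auts by blast
  show "h x \<in> carrier G" by (rule cayley_autsD(3)[OF hA x])
  show "\<exists>h'\<in>L. \<forall>y\<in>carrier G. h (x \<otimes> y) = h x \<otimes> h' y"
    using L_restriction[OF h] restriction_apply[OF hA x] x by blast
next
  fix h assume h: "h \<in> L"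
  then show "h \<one> = \<one>" using cayley_autsD(4) L_auts by blast
  have "(\<lambda>x. \<lambda>y\<in>carrier G. inv (h x) \<otimes> h (x \<otimes> y)) ` carrier G
      = (\<lambda>g. restrict g (carrier G)) ` restriction h ` carrier G"
    unfolding image_image by (rule image_cong) (auto simp: restriction_def restrict_def)
  then show "finite ((\<lambda>x. \<lambda>y\<in>carrier G. inv (h x) \<otimes> h (x \<otimes> y)) ` carrier G)" using L_restriction[OF h] by simp
next
  fix x assume x: "x \<in> carrier G"
  show "finite ((\<lambda>h. h x) ` L)"
    using cayley_auts_orbit[OF x] L_auts by (meson finite_subset image_mono)
qed (simp_all add: subgroup_self L_subgroup)

sublocale act: full_self_similar_action G "carrier G" L
  by (rule L_action)

end


section \<open>The dual automaton\<close>

locale dual_automaton = cayley_states +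
  fixes n m :: nat and eQ :: "nat \<Rightarrow> 'a \<Rightarrow> 'a" and eA :: "nat \<Rightarrow> 'a"
  assumes eQ: "bij_betw eQ {..<n} Q" and eA: "bij_betw eA {..<m} A"
begin

definition iQ :: "('a \<Rightarrow> 'a) \<Rightarrow> nat" where "iQ = inv_into {..<n} eQ"
definition iA :: "'a \<Rightarrow> nat" where "iA = inv_into {..<m} eA"

lemma eQ_mem: "j < n \<Longrightarrow> eQ j \<in> Q" and eA_mem: "i < m \<Longrightarrow> eA i \<in> A"
  using eQ eA by (auto simp: bij_betw_def)

lemma eQ_auts: "j < n \<Longrightarrow> eQ j \<in> cayley_auts"
  using eQ_mem Q_auts by blast

lemma eA_carrier: "i < m \<Longrightarrow> eA i \<in> carrier G"
  using eA_mem A(2) by blast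

lemma iQ: "q \<in> Q \<Longrightarrow> eQ (iQ q) = q" "q \<in> Q \<Longrightarrow> iQ q < n" "j < n \<Longrightarrow> iQ (eQ j) = j"
  unfolding iQ_def using bij_betw_inv_into_right[OF eQ] bij_betw_inv_into_left[OF eQ]
    bij_betwE[OF bij_betw_inv_into[OF eQ]] by auto

lemma iA: "a \<in> A \<Longrightarrow> eA (iA a) = a" "a \<in> A \<Longrightarrow> iA a < m" "i < m \<Longrightarrow> iA (eA i) = i"
  unfolding iA_def using bij_betw_inv_into_right[OF eA] bij_betw_inv_into_left[OF eA]
    bij_betwE[OF bij_betw_inv_into[OF eA]] by auto

text \<open>Letters and states are numbered by \<open>eQ\<close> and \<open>eA\<close>. The roles are exchanged compared with the
  action of \<open>L\<close> on \<open>G\<close>: the elements of \<open>Q\<close> are the letters.\<close>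

definition dual :: "(nat, nat) mealy" where
  "dual = \<lparr>alphabet = {..<n}, states = {..<m},
     out_letter = (\<lambda>i j. iQ (restriction (eQ j) (eA i))), next_state = (\<lambda>i j. iA (eQ j (eA i)))\<rparr>"

lemma dual_sel [simp]:
  "alphabet dual = {..<n}" "states dual = {..<m}"
  "out_letter dual i j = iQ (restriction (eQ j) (eA i))" "next_state dual i j = iA (eQ j (eA i))"
  by (simp_all add: dual_def)

lemma out_less: "i < m \<Longrightarrow> j < n \<Longrightarrow> iQ (restriction (eQ j) (eA i)) < n"
  by (intro iQ(2) Q_restriction eQ_mem eA_carrier)

lemma next_less: "i < m \<Longrightarrow> j < n \<Longrightarrow> iA (eQ j (eA i)) < m"
  by (rule iA(2)[OF cayley_auts_A[OF eQ_auts eA_mem]])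

lemma dual_mealy: "mealy_automaton dual"
  by (auto simp: mealy_automaton_def out_less next_less)

lemma bij_betw_self_finite: "finite B \<Longrightarrow> f ` B \<subseteq> B \<Longrightarrow> inj_on f B \<Longrightarrow> bij_betw f B B"
  by (simp add: bij_betw_def endo_inj_surj)

lemma dual_invertible: "invertible dual"
  unfolding invertible_def
proof
  fix i assume "i \<in> states dual"
  then have i: "i < m" by simp
  show "bij_betw (out_letter dual i) (alphabet dual) (alphabet dual)"
  proof (rule bij_betw_self_finite)
    show "inj_on (out_letter dual i) (alphabet dual)"
    proof (rule inj_onI)
      fix j k assume "j \<in> alphabet dual" "k \<in> alphabet dual" and eq: "out_letter dual i j = out_letter dual i k"
      then have jk: "j < n" "k < n" by simp_all
      have "eQ (out_letter dual i j) = eQ (out_letter dual i k)" using eq by simp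
      then have eq': "restriction (eQ j) (eA i) = restriction (eQ k) (eA i)"
        using iQ(1) Q_restriction eQ_mem eA_carrier i jk by simp
      have undo: "restriction (restriction (eQ l) (eA i)) (inv (eA i)) = eQ l" if "l < n" for l
        using restriction_restriction[OF eQ_auts[OF that] eA_carrier[OF i], of "inv (eA i)"] eA_carrier[OF i]
          restriction_one[OF eQ_auts[OF that]] by simp
      have "eQ j = eQ k" by (rule trans[OF undo[OF jk(1), unfolded eq', symmetric] undo[OF jk(2)]])
      then show "j = k" using iQ(3) jk by metis
    qed
  qed (use out_less i in auto)
qed

lemma dual_bireversible: "bireversible dual"
proof -
  have "reversible dual"
    unfolding reversible_def
  proof
    fix j assume "j \<in> alphabet dual"
    then have j: "j < n" by simp
    show "bij_betw (\<lambda>i. next_state dual i j) (states dual) (states dual)"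
    proof (rule bij_betw_self_finite)
      show "inj_on (\<lambda>i. next_state dual i j) (states dual)"
      proof (rule inj_onI)
        fix i k assume "i \<in> states dual" "k \<in> states dual" and eq: "next_state dual i j = next_state dual k j"
        then have ik: "i < m" "k < m" by simp_all
        have "eA (next_state dual i j) = eA (next_state dual k j)" using eq by simp
        then have "eQ j (eA i) = eQ j (eA k)"
          using iA(1) cayley_auts_A[OF eQ_auts[OF j]] eA_mem ik by simp
        then have "eA i = eA k" using cayley_autsD(1)[OF eQ_auts[OF j]] by (simp add: bij_def inj_eq)
        then show "i = k" using iA(3) ik by metis
      qed
    qed (use next_less j in auto)
  qed
  moreover have "bij_betw (\<lambda>(i, j). (out_letter dual i j, next_state dual i j))
      (states dual \<times> alphabet dual) (alphabet dual \<times> states dual)" (is "bij_betw ?f ?X ?Y")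
  proof -
    have "inj_on ?f ?X"
    proof (rule inj_onI)
      fix u v assume "u \<in> ?X" "v \<in> ?X" and eq: "?f u = ?f v"
      then obtain i j k l where u: "u = (i, j)" "i < m" "j < n" and v: "v = (k, l)" "k < m" "l < n"
        by auto
      have "eQ (out_letter dual i j) = eQ (out_letter dual k l)" using eq u v by simp
      then have r: "restriction (eQ j) (eA i) = restriction (eQ l) (eA k)"
        using iQ(1) Q_restriction eQ_mem eA_carrier u v by simp
      have "eA (next_state dual i j) = eA (next_state dual k l)" using eq u v by simp
      then have b: "eQ j (eA i) = eQ l (eA k)"
        using iA(1) cayley_auts_A eQ_auts eA_mem u v by simp
      \<comment> \<open>The restriction \<open>restriction (eQ j) (eA i)\<close> maps \<open>inv (eA i)\<close> to \<open>inv (eQ j (eA i))\<close>.\<close>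
      have undo: "restriction (eQ s) (eA t) (inv (eA t)) = inv (eQ s (eA t))" if "s < n" "t < m" for s t
        using eA_carrier[OF that(2)] cayley_autsD(3,4)[OF eQ_auts[OF that(1)]] by (simp add: restriction_def)
      have "restriction (eQ j) (eA i) (inv (eA i)) = restriction (eQ j) (eA i) (inv (eA k))"
        using undo[OF u(3,2)] undo[OF v(3,2)] r b by simp
      moreover have "inj (restriction (eQ j) (eA i))"
        using cayley_autsD(1)[OF restriction_closed[OF eQ_auts[OF u(3)] eA_carrier[OF u(2)]]] by (simp add: bij_def)
      ultimately have "inv (eA i) = inv (eA k)" by (simp add: inj_eq)
      then have "eA i = eA k" using eA_carrier u(2) v(2) by (metis inv_inv)
      then have ik: "i = k" using iA(3) u(2) v(2) by metis
      have "out_letter dual i j = out_letter dual i l" using eq u v ik by simp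
      then have "j = l"
        using dual_invertible u v by (auto simp: invertible_def bij_betw_def inj_on_def)
      with ik u v show "u = v" by simp
    qed
    moreover have "?f ` ?X \<subseteq> ?Y" using out_less next_less by auto
    moreover have "card ?X = card ?Y" by (simp add: card_cartesian_product)
    ultimately show ?thesis
      by (simp add: bij_betw_def card_image card_subset_eq)
  qed
  ultimately show ?thesis using dual_invertible by (simp add: bireversible_def)
qed

text \<open>The action of the states of the automaton on words makes sense for every element of \<open>G\<close>. It is
  restriction of the product of the word, computed letter by letter; in the product the first
  letter acts first.\<close>

primrec word_restriction :: "'a \<Rightarrow> nat list \<Rightarrow> nat list" where
  "word_restriction x [] = []"
| "word_restriction x (j # w) = iQ (restriction (eQ j) x) # word_restriction (eQ j x) w"

primrec word_prod :: "nat list \<Rightarrow> 'a \<Rightarrow> 'a" where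
  "word_prod [] x = x"
| "word_prod (j # w) x = word_prod w (eQ j x)"

lemma word_prod_Nil: "word_prod [] = id"
  by (rule ext) simp

lemma word_prod_Cons: "word_prod (j # w) = word_prod w \<circ> eQ j"
  by (rule ext) simp

lemma word_restriction_closed: "x \<in> carrier G \<Longrightarrow> w \<in> lists {..<n} \<Longrightarrow> word_restriction x w \<in> lists {..<n}"
proof (induction w arbitrary: x)
  case (Cons j w)
  then have j: "j < n" and w: "w \<in> lists {..<n}" by auto
  have "iQ (restriction (eQ j) x) < n" by (intro iQ(2) Q_restriction eQ_mem j Cons.prems)
  moreover have "eQ j x \<in> carrier G" by (rule cayley_autsD(3)[OF eQ_auts[OF j] Cons.prems(1)])
  ultimately show ?case using Cons.IH[OF _ w] by simp
qed simp

lemma word_restriction_mult: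
  "x \<in> carrier G \<Longrightarrow> y \<in> carrier G \<Longrightarrow> w \<in> lists {..<n} \<Longrightarrow> word_restriction (x \<otimes> y) w = word_restriction y (word_restriction x w)"
proof (induction w arbitrary: x y)
  case (Cons j w)
  then have j: "j < n" and w: "w \<in> lists {..<n}" by auto
  have r: "restriction (eQ j) x \<in> Q" by (rule Q_restriction[OF eQ_mem[OF j] Cons.prems(1)])
  have c: "eQ j x \<in> carrier G" "restriction (eQ j) x y \<in> carrier G"
    using cayley_autsD(3)[OF eQ_auts[OF j] Cons.prems(1)] cayley_autsD(3)[OF Q_auts[OF r] Cons.prems(2)] .
  show ?case
    using Cons.IH[OF c w] restriction_restriction[OF eQ_auts[OF j] Cons.prems(1,2)]
      restriction_apply[OF eQ_auts[OF j] Cons.prems(1,2)] iQ(1)[OF r] by simp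
qed simp

lemma word_restriction_one: "w \<in> lists {..<n} \<Longrightarrow> word_restriction \<one> w = w"
  by (induction w) (auto simp: restriction_one eQ_auts cayley_autsD(4) iQ(3))

lemma word_out_dual: "i < m \<Longrightarrow> w \<in> lists {..<n} \<Longrightarrow> word_out dual i w = word_restriction (eA i) w"
proof (induction w arbitrary: i)
  case (Cons j w)
  then have j: "j < n" and w: "w \<in> lists {..<n}" by auto
  have "eQ j (eA i) \<in> A" by (rule cayley_auts_A[OF eQ_auts[OF j] eA_mem[OF Cons.prems(1)]])
  then show ?case using Cons.IH[OF next_less[OF Cons.prems(1) j] w] iA(1) by simp
qed simp

lemma word_prod_auts: "w \<in> lists {..<n} \<Longrightarrow> word_prod w \<in> cayley_auts"
proof (induction w)
  case (Cons j w)
  then show ?case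
    unfolding word_prod_Cons by (intro perm_comp[OF subgroup_cayley_auts] eQ_auts) auto
qed (simp only: word_prod_Nil perm_id[OF subgroup_cayley_auts])

lemma restriction_word_prod:
  "x \<in> carrier G \<Longrightarrow> w \<in> lists {..<n} \<Longrightarrow> restriction (word_prod w) x = word_prod (word_restriction x w)"
proof (induction w arbitrary: x)
  case Nil
  then show ?case by (auto simp: restriction_def fun_eq_iff cancel_left)
next
  case (Cons j w)
  then have j: "j < n" and w: "w \<in> lists {..<n}" by auto
  have c: "eQ j x \<in> carrier G" by (rule cayley_autsD(3)[OF eQ_auts[OF j] Cons.prems(1)])
  show ?case
    unfolding word_restriction.simps word_prod_Cons restriction_comp[OF word_prod_auts[OF w] eQ_auts[OF j] Cons.prems(1)]
      Cons.IH[OF c w] iQ(1)[OF Q_restriction[OF eQ_mem[OF j] Cons.prems(1)]] ..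
qed

lemma word_prod_append: "word_prod (u @ v) = word_prod v \<circ> word_prod u"
  by (induction u) (auto simp: fun_eq_iff)

lemma L_word_prod:
  assumes "h \<in> L"
  shows "\<exists>w\<in>lists {..<n}. h = word_prod w"
  using assms
proof (induction h rule: generate.induct)
  case one
  then show ?case by (intro bexI[of _ "[]"]) auto
next
  case (incl q)
  then show ?case using iQ by (intro bexI[of _ "[iQ q]"]) auto
next
  case (inv q)
  then have "inv\<^bsub>perms\<^esub> q \<in> Q" using Q_inv inv_perms cayley_autsD(1)[OF Q_auts] by metis
  then show ?case using iQ by (intro bexI[of _ "[iQ (inv\<^bsub>perms\<^esub> q)]"]) auto
next
  case (eng h k)
  then obtain u v where "u \<in> lists {..<n}" "v \<in> lists {..<n}" "h = word_prod u" "k = word_prod v" by blast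
  then show ?case by (intro bexI[of _ "v @ u"]) (auto simp: word_prod_append)
qed

text \<open>Restriction is an action from the right, whence the inverse.\<close>

definition dual_action :: "'a \<Rightarrow> nat list \<Rightarrow> nat list" where
  "dual_action g = restrict (word_restriction (inv g)) (lists {..<n})"

lemma dual_action_Bij:
  assumes g: "g \<in> carrier G"
  shows "dual_action g \<in> Bij (lists {..<n})"
proof -
  have canc: "word_restriction y (word_restriction x w) = w"
    if "x \<in> carrier G" "y \<in> carrier G" "x \<otimes> y = \<one>" "w \<in> lists {..<n}" for x y w
    using word_restriction_mult[OF that(1,2,4)] word_restriction_one[OF that(4)] that(3) by simp
  have ginv: "inv g \<in> carrier G" "inv g \<otimes> g = \<one>" "g \<otimes> inv g = \<one>" using g by simp_all
  have val: "dual_action g w = word_restriction (inv g) w" if "w \<in> lists {..<n}" for w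
    unfolding dual_action_def using that by (rule restrict_apply')
  have "bij_betw (dual_action g) (lists {..<n}) (lists {..<n})"
  proof (rule bij_betw_byWitness[where f' = "word_restriction g"]; intro ballI image_subsetI)
    fix w assume w: "w \<in> lists {..<n}"
    have cl: "word_restriction g w \<in> lists {..<n}" by (rule word_restriction_closed[OF g w])
    show "word_restriction g (dual_action g w) = w" unfolding val[OF w] by (rule canc[OF ginv(1) g ginv(2) w])
    show "dual_action g (word_restriction g w) = w" unfolding val[OF cl] by (rule canc[OF g ginv(1,3) w])
    show "dual_action g w \<in> lists {..<n}" unfolding val[OF w] by (rule word_restriction_closed[OF ginv(1) w])
    show "word_restriction g w \<in> lists {..<n}" by (rule cl)
  qed
  then show ?thesis by (simp add: Bij_def dual_action_def)
qed

lemma dual_action_hom: "dual_action \<in> hom G (BijGroup (lists {..<n}))"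
proof (rule homI)
  fix g h assume g: "g \<in> carrier G" and h: "h \<in> carrier G"
  have "dual_action (g \<otimes> h) w = compose (lists {..<n}) (dual_action g) (dual_action h) w" for w
    using word_restriction_mult[of "inv h" "inv g" w] word_restriction_closed[of "inv h" w] g h
    by (simp add: dual_action_def compose_def inv_mult_group)
  then show "dual_action (g \<otimes> h) = dual_action g \<otimes>\<^bsub>BijGroup (lists {..<n})\<^esub> dual_action h"
    using dual_action_Bij[OF g] dual_action_Bij[OF h] by (simp add: BijGroup_def fun_eq_iff)
qed (simp add: BijGroup_def dual_action_Bij)

lemma group_hom_dual_action: "group_hom G (BijGroup (lists {..<n})) dual_action"
  by (intro group_hom.intro is_group group_BijGroup group_hom_axioms.intro dual_action_hom)

lemma group_hom_mealy_hom: "group_hom (free_group {..<m}) (BijGroup (lists {..<n})) (mealy_hom dual)"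
  using mealy_hom_hom[OF dual_mealy dual_invertible]
  by (intro group_hom.intro group_free_group group_BijGroup group_hom_axioms.intro) simp

lemma mealy_hom_image: "mealy_hom dual ` carrier (free_group {..<m}) = dual_action ` carrier G"
proof -
  let ?B = "BijGroup (lists {..<n})"
  interpret D: group_hom G ?B dual_action by (rule group_hom_dual_action)
  interpret F: group_hom "free_group {..<m}" ?B "mealy_hom dual" by (rule group_hom_mealy_hom)
  have gen: "restrict (word_out dual i) (lists {..<n}) = dual_action (inv (eA i))" if i: "i < m" for i
    using word_out_dual[OF i] eA_carrier[OF i] by (auto simp: dual_action_def restrict_def fun_eq_iff)
  have img: "subgroup (dual_action ` carrier G) ?B" by (rule D.img_is_subgroup)
  have sub: "mealy_hom dual w \<in> dual_action ` carrier G" if "w \<in> lists ({..<m} \<times> UNIV)" for w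
    using that
  proof (induction w)
    case Nil
    then show ?case using subgroup.one_closed[OF img] by (simp add: mealy_hom_def)
  next
    case (Cons l w)
    obtain i e where l: "l = (i, e)" by (cases l)
    have i: "i < m" using Cons.hyps l by auto
    have a: "dual_action (inv (eA i)) \<in> dual_action ` carrier G"
      by (rule imageI) (use eA_carrier[OF i] in simp)
    have "(if e then dual_action (inv (eA i)) else inv\<^bsub>?B\<^esub> (dual_action (inv (eA i)))) \<in> dual_action ` carrier G"
      using a subgroup.m_inv_closed[OF img a] by (cases e) (simp_all only: if_True if_False)
    moreover have "mealy_hom dual (l # w)
        = (if e then dual_action (inv (eA i)) else inv\<^bsub>?B\<^esub> (dual_action (inv (eA i)))) \<otimes>\<^bsub>?B\<^esub> mealy_hom dual w"
      unfolding l mealy_hom_def dual_sel by (simp only: free_lift.simps gen[OF i])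
    ultimately show ?case using subgroup.m_closed[OF img] Cons.IH by (simp only:)
  qed
  have img': "subgroup (mealy_hom dual ` carrier (free_group {..<m})) ?B" by (rule F.img_is_subgroup)
  let ?R = "{g \<in> carrier G. dual_action g \<in> mealy_hom dual ` carrier (free_group {..<m})}"
  have "subgroup ?R G"
  proof
    fix x y assume xy: "x \<in> ?R" "y \<in> ?R"
    then show "x \<otimes> y \<in> ?R" using subgroup.m_closed[OF img'] by simp
  next
    fix x assume "x \<in> ?R"
    then show "inv x \<in> ?R" using subgroup.m_inv_closed[OF img'] by simp
  qed (use subgroup.one_closed[OF img'] in auto)
  moreover have "A \<subseteq> ?R"
  proof
    fix a assume a: "a \<in> A"
    then have ai: "inv a \<in> A" by (rule A_inv)
    let ?i = "iA (inv a)"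
    have i: "?i < m" "eA ?i = inv a" using iA ai by auto
    have "[(?i, True)] \<in> carrier (free_group {..<m})" using i by (simp add: free_group_def)
    moreover have "mealy_hom dual [(?i, True)] = dual_action a"
      using gen[OF i(1)] i(2) a A(2) D.hom_closed[of a] by (auto simp: mealy_hom_def subset_iff)
    ultimately have "dual_action a \<in> mealy_hom dual ` carrier (free_group {..<m})" by (metis imageI)
    then show "a \<in> ?R" using a A(2) by blast
  qed
  ultimately have "carrier G \<subseteq> ?R" using generate_subgroup_incl[of A ?R] A(3) by simp
  moreover have "carrier (free_group {..<m}) \<subseteq> lists ({..<m} \<times> UNIV)" by (auto simp: free_group_def)
  ultimately show ?thesis using sub by (intro equalityI) (auto simp: subset_iff)
qed

lemma dual_action_kernel:
  assumes g: "g \<in> carrier G" and triv: "dual_action g = \<one>\<^bsub>BijGroup (lists {..<n})\<^esub>"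
  shows "inv g \<in> act.inert"
proof -
  have "word_restriction (inv g) w = w" if "w \<in> lists {..<n}" for w
    using fun_cong[OF triv, of w] that by (simp add: dual_action_def BijGroup_def)
  then have fixd: "restriction h (inv g) = h" if "h \<in> L" for h
    using L_word_prod[OF that] restriction_word_prod[of "inv g"] g by auto
  have "inv g \<in> act.St h" if h: "h \<in> L" for h
  proof -
    have "h \<in> cayley_auts" using h L_auts by blast
    from restriction_apply[OF this, of "inv g"] show ?thesis
      unfolding act.St_def fixd[OF h] using g by simp
  qed
  then show ?thesis unfolding act.inert_def using g by simp
qed

text \<open>The group of the dual automaton is the image of \<open>G\<close> under \<open>dual_action\<close>, and the kernel of
  \<open>dual_action\<close> is contained in \<open>inert\<close>.\<close>

theorem bireversible_dual:
  assumes "act.inert = {\<one>}"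
  shows "bireversible_group G"
proof -
  let ?B = "BijGroup (lists {..<n})" and ?F = "free_group {..<m}"
  let ?I = "dual_action ` carrier G"
  interpret D: group_hom G ?B dual_action by (rule group_hom_dual_action)
  have img: "subgroup ?I ?B" by (rule D.img_is_subgroup)
  have inj: "inj_on dual_action (carrier G)"
  proof (rule D.trivial_ker_imp_inj)
    have "g = \<one>" if "g \<in> carrier G" "dual_action g = \<one>\<^bsub>?B\<^esub>" for g
    proof -
      have "inv g = \<one>" using dual_action_kernel[OF that] assms by simp
      then show ?thesis using that(1) by simp
    qed
    then show "kernel G ?B dual_action = {\<one>}" by (auto simp: kernel_def)
  qed
  have iso1: "G \<cong> ?B\<lparr>carrier := ?I\<rparr>"
    unfolding is_iso_def iso_def using dual_action_hom inj
    by (auto simp: hom_def bij_betw_def)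
  interpret FI: group_hom ?F "?B\<lparr>carrier := ?I\<rparr>" "mealy_hom dual"
  proof (intro group_hom.intro group_free_group group_hom_axioms.intro)
    show "group (?B\<lparr>carrier := ?I\<rparr>)" by (rule D.H.subgroup_imp_group[OF img])
    show "mealy_hom dual \<in> hom ?F (?B\<lparr>carrier := ?I\<rparr>)"
      using group_hom.homh[OF group_hom_mealy_hom] mealy_hom_image by (auto simp: hom_def)
  qed
  have "?F Mod kernel ?F (?B\<lparr>carrier := ?I\<rparr>) (mealy_hom dual) \<cong> ?B\<lparr>carrier := ?I\<rparr>"
    using FI.FactGroup_iso_set mealy_hom_image unfolding is_iso_def by auto
  moreover have "kernel ?F (?B\<lparr>carrier := ?I\<rparr>) (mealy_hom dual) = kernel ?F ?B (mealy_hom dual)"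
    by (simp add: kernel_def)
  ultimately have "mealy_group dual \<cong> ?B\<lparr>carrier := ?I\<rparr>" by (simp add: mealy_group_def)
  moreover have "group (mealy_group dual)"
    unfolding mealy_group_def
    using normal.factorgroup_is_group[OF group_hom.normal_kernel[OF group_hom_mealy_hom]] by simp
  ultimately have "?B\<lparr>carrier := ?I\<rparr> \<cong> mealy_group dual" by (rule group.iso_sym[rotated])
  with iso1 have "G \<cong> mealy_group dual" by (rule iso_trans)
  then show ?thesis using dual_mealy dual_bireversible unfolding bireversible_group_def by blast
qed

end

lemma (in cayley_states) bireversible_if_inert_trivial:
  assumes "act.inert = {\<one>}"
  shows "bireversible_group G"
proof -
  obtain eQ where eQ: "bij_betw eQ {..<card Q} Q"
    using ex_bij_betw_nat_finite[OF Q(1)] by (auto simp: atLeast0LessThan)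
  obtain eA where eA: "bij_betw eA {..<card A} A"
    using ex_bij_betw_nat_finite[OF A(1)] by (auto simp: atLeast0LessThan)
  interpret dual_automaton G A Q "card Q" "card A" eQ eA
    by unfold_locales (rule eQ eA)+
  show ?thesis using assms by (rule bireversible_dual)
qed


section \<open>Commensurating automorphisms\<close>

context group
begin

lemma mem_conj_subgroup:
  assumes H: "subgroup H G" and k: "k \<in> carrier G"
  shows "x \<in> conj_subgroup G k H \<longleftrightarrow> x \<in> carrier G \<and> inv k \<otimes> x \<otimes> k \<in> H"
proof
  assume "x \<in> conj_subgroup G k H"
  then obtain h where h: "h \<in> H" "x = k \<otimes> h \<otimes> inv k"
    by (auto simp: conj_subgroup_def l_coset_def r_coset_def)
  have hc: "h \<in> carrier G" using h(1) subgroup.mem_carrier[OF H] by simp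
  have "inv k \<otimes> x \<otimes> k = h" unfolding h(2) using hc k by (simp add: m_assoc cancel_left)
  then show "x \<in> carrier G \<and> inv k \<otimes> x \<otimes> k \<in> H" using h hc k by simp
next
  assume *: "x \<in> carrier G \<and> inv k \<otimes> x \<otimes> k \<in> H"
  then have "x = k \<otimes> (inv k \<otimes> x \<otimes> k) \<otimes> inv k" using k by (simp add: m_assoc cancel_left)
  with * show "x \<in> conj_subgroup G k H"
    by (auto simp: conj_subgroup_def l_coset_def r_coset_def)
qed

lemma subgroup_conj_subgroup:
  assumes H: "subgroup H G" and k: "k \<in> carrier G"
  shows "subgroup (conj_subgroup G k H) G"
proof
  note mem = mem_conj_subgroup[OF H k]
  show "conj_subgroup G k H \<subseteq> carrier G" using mem by blast
  show "\<one> \<in> conj_subgroup G k H" unfolding mem using k subgroup.one_closed[OF H] by simp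
  fix x assume x: "x \<in> conj_subgroup G k H"
  then have xc: "x \<in> carrier G" and xH: "inv k \<otimes> x \<otimes> k \<in> H" unfolding mem by auto
  have "inv (inv k \<otimes> x \<otimes> k) = inv k \<otimes> inv x \<otimes> k" using xc k by (simp add: inv_mult_group m_assoc)
  then show "inv x \<in> conj_subgroup G k H" unfolding mem using xc subgroup.m_inv_closed[OF H xH] by simp
  fix y assume y: "y \<in> conj_subgroup G k H"
  then have yc: "y \<in> carrier G" and yH: "inv k \<otimes> y \<otimes> k \<in> H" unfolding mem by auto
  have "(inv k \<otimes> x \<otimes> k) \<otimes> (inv k \<otimes> y \<otimes> k) = inv k \<otimes> (x \<otimes> y) \<otimes> k"
    using xc yc k by (simp add: m_assoc cancel_left)
  then show "x \<otimes> y \<in> conj_subgroup G k H"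
    unfolding mem using xc yc subgroup.m_closed[OF H xH yH] by simp
qed

text \<open>Conjugation by \<open>inv k\<close> exchanges the two index conditions.\<close>

lemma Comm_inv:
  assumes H: "subgroup H G" and k: "k \<in> Comm G H"
  shows "inv k \<in> Comm G H"
proof -
  have kc: "k \<in> carrier G" and kc': "inv k \<in> carrier G"
    and fin1: "finite ((#>) (H \<inter> conj_subgroup G k H) ` H)"
    and fin2: "finite ((#>) (H \<inter> conj_subgroup G k H) ` conj_subgroup G k H)"
    using k by (auto simp: Comm_def finite_index_iff)
  note mem = mem_conj_subgroup[OF H kc] and mem' = mem_conj_subgroup[OF H kc', unfolded inv_inv[OF kc]]
  let ?J = "H \<inter> conj_subgroup G k H" and ?J' = "H \<inter> conj_subgroup G (inv k) H"
  have J: "subgroup ?J G" by (rule subgroups_Inter_pair[OF H subgroup_conj_subgroup[OF H kc]])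
  have J': "subgroup ?J' G" by (rule subgroups_Inter_pair[OF H subgroup_conj_subgroup[OF H kc']])
  have cj: "(k \<otimes> x \<otimes> inv k) \<otimes> inv (k \<otimes> y \<otimes> inv k) = k \<otimes> (x \<otimes> inv y) \<otimes> inv k"
    if "x \<in> carrier G" "y \<in> carrier G" for x y
    using that kc by (simp add: inv_mult_group m_assoc cancel_left)
  have undo: "inv k \<otimes> (k \<otimes> x \<otimes> inv k) \<otimes> k = x" if "x \<in> carrier G" for x
    using that kc by (simp add: m_assoc cancel_left)
  have Hc: "x \<in> carrier G" if "x \<in> H" for x using that subgroup.mem_carrier[OF H] by blast
  have "fi_subgroup G H ?J'"
  proof (rule fi_subgroupI[where F = "\<lambda>x. ?J #> (k \<otimes> x \<otimes> inv k)", OF J'])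
    have "(\<lambda>x. ?J #> (k \<otimes> x \<otimes> inv k)) ` H \<subseteq> (#>) ?J ` conj_subgroup G k H"
      using mem undo Hc kc by auto
    then show "finite ((\<lambda>x. ?J #> (k \<otimes> x \<otimes> inv k)) ` H)" using fin2 finite_subset by blast
  next
    fix x y assume xy: "x \<in> H" "y \<in> H" and eq: "?J #> (k \<otimes> x \<otimes> inv k) = ?J #> (k \<otimes> y \<otimes> inv k)"
    have c: "x \<in> carrier G" "y \<in> carrier G" using xy Hc by auto
    have "k \<otimes> (x \<otimes> inv y) \<otimes> inv k \<in> ?J"
      using r_coset_eq_iff[OF J, of "k \<otimes> x \<otimes> inv k" "k \<otimes> y \<otimes> inv k"] eq c kc cj by simp
    then have "x \<otimes> inv y \<in> conj_subgroup G (inv k) H" unfolding mem' using c by simp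
    then show "x \<otimes> inv y \<in> ?J'" using xy subgroup.m_closed[OF H] subgroup.m_inv_closed[OF H] by simp
  qed (use Hc in auto)
  moreover have "fi_subgroup G (conj_subgroup G (inv k) H) ?J'"
  proof (rule fi_subgroupI[where F = "\<lambda>x. ?J #> (k \<otimes> x \<otimes> inv k)", OF J'])
    have "(\<lambda>x. ?J #> (k \<otimes> x \<otimes> inv k)) ` conj_subgroup G (inv k) H \<subseteq> (#>) ?J ` H"
      using mem' by auto
    then show "finite ((\<lambda>x. ?J #> (k \<otimes> x \<otimes> inv k)) ` conj_subgroup G (inv k) H)"
      using fin1 finite_subset by blast
  next
    fix x y assume xy: "x \<in> conj_subgroup G (inv k) H" "y \<in> conj_subgroup G (inv k) H"
      and eq: "?J #> (k \<otimes> x \<otimes> inv k) = ?J #> (k \<otimes> y \<otimes> inv k)"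
    have c: "x \<in> carrier G" "y \<in> carrier G" using xy mem' by auto
    have *: "k \<otimes> (x \<otimes> inv y) \<otimes> inv k \<in> ?J"
      using r_coset_eq_iff[OF J, of "k \<otimes> x \<otimes> inv k" "k \<otimes> y \<otimes> inv k"] eq c kc cj by simp
    then have "x \<otimes> inv y \<in> conj_subgroup G (inv k) H" unfolding mem' using c by simp
    moreover have "k \<otimes> (x \<otimes> inv y) \<otimes> inv k \<in> conj_subgroup G k H" using * by blast
    then have "x \<otimes> inv y \<in> H" unfolding mem using undo[of "x \<otimes> inv y"] c by simp
    ultimately show "x \<otimes> inv y \<in> ?J'" by simp
  qed (use mem' in auto)
  ultimately show ?thesis using kc' by (simp add: Comm_def fi_subgroup_def)
qed

end

locale cayley_graph = group +
  fixes S
  assumes S: "finite S" "S \<subseteq> carrier G" "generate G S = carrier G"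
begin

sublocale cayley G "S \<union> set_inv S"
proof
  show "finite (S \<union> set_inv S)" using S(1) by (simp add: SET_INV_def)
  show sub: "S \<union> set_inv S \<subseteq> carrier G" using S(2) by (auto simp: SET_INV_def)
  show "generate G (S \<union> set_inv S) = carrier G"
    using mono_generate[of S "S \<union> set_inv S"] generate_incl[OF sub] S(3) by auto
  show "inv a \<in> S \<union> set_inv S" if "a \<in> S \<union> set_inv S" for a
    using that S(2) by (auto simp: SET_INV_def)
qed

abbreviation \<Gamma> where "\<Gamma> \<equiv> Cay G S"
abbreviation K where "K \<equiv> Aut \<Gamma>"

lemma pverts_Cay: "pverts \<Gamma> = carrier G"
  by (simp add: Cay_def)

lemma arc_iff:
  assumes "x \<in> carrier G" "y \<in> carrier G"
  shows "(x, y) \<in> parcs \<Gamma> \<longleftrightarrow> inv x \<otimes> y \<in> S \<union> set_inv S"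
proof
  assume "(x, y) \<in> parcs \<Gamma>"
  then obtain s where "s \<in> S \<union> set_inv S" "y = x \<otimes> s" by (auto simp: Cay_def)
  then show "inv x \<otimes> y \<in> S \<union> set_inv S" using assms A(2) by (auto simp: cancel_left)
next
  assume *: "inv x \<otimes> y \<in> S \<union> set_inv S"
  have "y = x \<otimes> (inv x \<otimes> y)" using assms by (simp add: cancel_left)
  with * show "(x, y) \<in> parcs \<Gamma>" unfolding Cay_def using assms(1) by auto
qed

lemma K_mem: "f \<in> carrier K \<longleftrightarrow> f \<in> Bij (carrier G) \<and>
    (\<forall>x\<in>carrier G. \<forall>y\<in>carrier G. inv x \<otimes> y \<in> S \<union> set_inv S \<longleftrightarrow> inv (f x) \<otimes> f y \<in> S \<union> set_inv S)"
proof -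
  have "f x \<in> carrier G" if "f \<in> Bij (carrier G)" "x \<in> carrier G" for x
    using Bij_imp_funcset[OF that(1)] that(2) by blast
  then show ?thesis
    by (simp add: Aut_def pverts_Cay arc_iff del: Un_iff cong: conj_cong ball_cong)
qed

lemma K_closed: "f \<in> carrier K \<Longrightarrow> x \<in> carrier G \<Longrightarrow> f x \<in> carrier G"
  unfolding K_mem using Bij_imp_funcset by blast

lemma K_mult: "f \<in> carrier K \<Longrightarrow> g \<in> carrier K \<Longrightarrow> x \<in> carrier G \<Longrightarrow> (f \<otimes>\<^bsub>K\<^esub> g) x = f (g x)"
  unfolding K_mem by (simp add: Aut_def BijGroup_def pverts_Cay compose_def)

lemma K_one: "x \<in> carrier G \<Longrightarrow> \<one>\<^bsub>K\<^esub> x = x"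
  by (simp add: Aut_def BijGroup_def pverts_Cay)

definition total :: "('a \<Rightarrow> 'a) \<Rightarrow> 'a \<Rightarrow> 'a" where
  "total f = (\<lambda>x. if x \<in> carrier G then f x else x)"

lemma total_mult: "f \<in> carrier K \<Longrightarrow> g \<in> carrier K \<Longrightarrow> total (f \<otimes>\<^bsub>K\<^esub> g) = total f \<circ> total g"
  by (rule ext) (simp add: total_def K_mult K_closed)

lemma total_one: "total \<one>\<^bsub>K\<^esub> = id"
  by (rule ext) (simp add: total_def K_one)

lemma bij_total:
  assumes f: "f \<in> carrier K"
  shows "bij (total f)"
proof -
  interpret K: group K by (rule group_Aut)
  have f': "inv\<^bsub>K\<^esub> f \<in> carrier K" by (rule K.inv_closed[OF f])
  show ?thesis
  proof (rule o_bij)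
    show "total (inv\<^bsub>K\<^esub> f) \<circ> total f = id"
      unfolding total_mult[OF f' f, symmetric] K.l_inv[OF f] total_one ..
    show "total f \<circ> total (inv\<^bsub>K\<^esub> f) = id"
      unfolding total_mult[OF f f', symmetric] K.r_inv[OF f] total_one ..
  qed
qed

lemma group_hom_total: "group_hom K perms total"
  by (intro group_hom.intro group_Aut group_perms group_hom_axioms.intro homI)
    (simp_all only: perms_simps mem_Collect_eq bij_total total_mult)

lemma restrict_total:
  assumes "f \<in> carrier K"
  shows "restrict (total f) (carrier G) = f"
proof -
  have "f \<in> extensional (carrier G)" using assms Bij_imp_extensional unfolding K_mem by blast
  then show ?thesis by (auto simp: total_def restrict_def extensional_def fun_eq_iff)
qed

lemma total_cayley_auts:
  assumes f: "f \<in> carrier K" and one: "f \<one> = \<one>"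
  shows "total f \<in> cayley_auts"
  using bij_total[OF f] one f K_closed[OF f]
  unfolding cayley_auts_def K_mem by (simp add: total_def del: Un_iff)

abbreviation lt :: "'a \<Rightarrow> 'a \<Rightarrow> 'a" where
  "lt g \<equiv> (\<lambda>x\<in>carrier G. g \<otimes> x)"

lemma lt_subgroup: "subgroup (left_translations G) K"
  by (rule subgroup_left_translations(1)[OF is_group])
    (use S in \<open>auto simp: cayley_graph_of_def finite_generating_set_def\<close>)

lemma lt_K: "g \<in> carrier G \<Longrightarrow> lt g \<in> carrier K"
  using subgroup.mem_carrier[OF lt_subgroup, of "lt g"] by (simp add: left_translations_def)

abbreviation C where "C \<equiv> comm_stabilizer G \<Gamma>"

lemma C_D:
  assumes "f \<in> C"
  shows "f \<in> carrier K" "f \<one> = \<one>" "f \<in> Comm K (left_translations G)"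
  using assms by (auto simp: comm_stabilizer_def Comm_def stabilizer_def)

lemma C_inv:
  assumes f: "f \<in> C"
  shows "inv\<^bsub>K\<^esub> f \<in> C"
proof -
  interpret K: group K by (rule group_Aut)
  note fD = C_D[OF f]
  have f': "inv\<^bsub>K\<^esub> f \<in> carrier K" by (rule K.inv_closed[OF fD(1)])
  have "(inv\<^bsub>K\<^esub> f \<otimes>\<^bsub>K\<^esub> f) \<one> = \<one>" using K.l_inv[OF fD(1)] K_one by simp
  then have "(inv\<^bsub>K\<^esub> f) \<one> = \<one>" using K_mult[OF f' fD(1) one_closed] fD(2) by simp
  then show ?thesis
    using K.Comm_inv[OF lt_subgroup fD(3)] f' by (simp add: comm_stabilizer_def stabilizer_def)
qed

text \<open>The restrictions of \<open>f\<close> at \<open>g\<close> and \<open>g'\<close> agree if \<open>f \<otimes> lt g \<otimes> inv f\<close> and \<open>f \<otimes> lt g' \<otimes> inv f\<close>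
  lie in the same coset of the intersection of the translations with their conjugate.\<close>

lemma C_restrictions:
  assumes f: "f \<in> C"
  shows "finite (restriction (total f) ` carrier G)"
proof -
  interpret K: group K by (rule group_Aut)
  note fD = C_D[OF f]
  have f': "inv\<^bsub>K\<^esub> f \<in> carrier K" by (rule K.inv_closed[OF fD(1)])
  let ?T = "left_translations G"
  let ?J = "?T \<inter> conj_subgroup K f ?T"
  have Tconj: "subgroup (conj_subgroup K f ?T) K" by (rule K.subgroup_conj_subgroup[OF lt_subgroup fD(1)])
  have J: "subgroup ?J K" by (rule K.subgroups_Inter_pair[OF lt_subgroup Tconj])
  have fin: "finite ((\<lambda>k. ?J #>\<^bsub>K\<^esub> k) ` conj_subgroup K f ?T)"
    using fD(3) by (simp add: Comm_def K.finite_index_iff)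
  let ?e = "\<lambda>g. f \<otimes>\<^bsub>K\<^esub> lt g \<otimes>\<^bsub>K\<^esub> inv\<^bsub>K\<^esub> f"
  have e_K: "?e g \<in> carrier K" if "g \<in> carrier G" for g using fD(1) lt_K[OF that] by simp
  have e_conj: "?e g \<in> conj_subgroup K f ?T" if g: "g \<in> carrier G" for g
  proof -
    have "inv\<^bsub>K\<^esub> f \<otimes>\<^bsub>K\<^esub> ?e g \<otimes>\<^bsub>K\<^esub> f = lt g"
      using fD(1) lt_K[OF g] by (simp add: K.m_assoc K.cancel_left)
    then show ?thesis
      unfolding K.mem_conj_subgroup[OF lt_subgroup fD(1)] using e_K[OF g] g
      by (simp add: left_translations_def)
  qed
  show ?thesis
  proof (rule finite_image_factor[where F = "\<lambda>g. ?J #>\<^bsub>K\<^esub> ?e g"])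
    have "(\<lambda>g. ?J #>\<^bsub>K\<^esub> ?e g) ` carrier G \<subseteq> (\<lambda>k. ?J #>\<^bsub>K\<^esub> k) ` conj_subgroup K f ?T"
      using e_conj by blast
    then show "finite ((\<lambda>g. ?J #>\<^bsub>K\<^esub> ?e g) ` carrier G)" using fin finite_subset by blast
  next
    fix g g' assume g: "g \<in> carrier G" and g': "g' \<in> carrier G" and eq: "?J #>\<^bsub>K\<^esub> ?e g = ?J #>\<^bsub>K\<^esub> ?e g'"
    have "?e g \<otimes>\<^bsub>K\<^esub> inv\<^bsub>K\<^esub> ?e g' \<in> ?T"
      using K.r_coset_eq_iff[OF J e_K[OF g] e_K[OF g']] eq by blast
    then obtain c where c: "c \<in> carrier G" and lc: "?e g \<otimes>\<^bsub>K\<^esub> inv\<^bsub>K\<^esub> ?e g' = lt c"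
      by (auto simp: left_translations_def)
    note Kc = fD(1) f' lt_K[OF g] lt_K[OF g'] lt_K[OF c]
    have "f \<otimes>\<^bsub>K\<^esub> lt g = (?e g \<otimes>\<^bsub>K\<^esub> inv\<^bsub>K\<^esub> ?e g') \<otimes>\<^bsub>K\<^esub> (f \<otimes>\<^bsub>K\<^esub> lt g')"
      using Kc by (simp add: K.inv_mult_group K.m_assoc K.cancel_left)
    then have eq': "f \<otimes>\<^bsub>K\<^esub> lt g = lt c \<otimes>\<^bsub>K\<^esub> (f \<otimes>\<^bsub>K\<^esub> lt g')" unfolding lc .
    have val: "f (g \<otimes> y) = c \<otimes> f (g' \<otimes> y)" if y: "y \<in> carrier G" for y
    proof -
      have "f (g \<otimes> y) = (f \<otimes>\<^bsub>K\<^esub> lt g) y" using K_mult[OF Kc(1,3) y] y by simp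
      also have "\<dots> = lt c ((f \<otimes>\<^bsub>K\<^esub> lt g') y)"
        unfolding eq' by (rule K_mult[OF Kc(5) K.m_closed[OF Kc(1,4)] y])
      also have "(f \<otimes>\<^bsub>K\<^esub> lt g') y = f (g' \<otimes> y)" using K_mult[OF Kc(1,4) y] y by simp
      finally show ?thesis using K_closed[OF fD(1)] g' y by simp
    qed
    show "restriction (total f) g = restriction (total f) g'"
    proof
      fix y
      show "restriction (total f) g y = restriction (total f) g' y"
      proof (cases "y \<in> carrier G")
        case True
        have cl: "f g' \<in> carrier G" "f (g' \<otimes> y) \<in> carrier G" using K_closed[OF fD(1)] g' True by simp_all
        have "f g = c \<otimes> f g'" using val[OF one_closed] g g' by simp
        then show ?thesis
          using True g g' c cl val[OF True] by (simp add: restriction_def total_def inv_mult_group m_assoc cancel_left)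
      qed (simp add: restriction_def)
    qed
  qed
qed

lemma C_subgroup_in_K:
  assumes "subgroup H (K\<lparr>carrier := C\<rparr>)"
  shows "subgroup H K"
proof
  interpret K: group K by (rule group_Aut)
  have HC: "H \<subseteq> C" using subgroup.subset[OF assms] by simp
  show "H \<subseteq> carrier K" using HC C_D(1) by blast
  show "x \<otimes>\<^bsub>K\<^esub> y \<in> H" if "x \<in> H" "y \<in> H" for x y using subgroup.m_closed[OF assms that] by simp
  show "\<one>\<^bsub>K\<^esub> \<in> H" using subgroup.one_closed[OF assms] by simp
  fix x assume x: "x \<in> H"
  then have xC: "x \<in> C" and xK: "x \<in> carrier K" using HC C_D(1) by auto
  have "inv\<^bsub>K\<lparr>carrier := C\<rparr>\<^esub> x = inv\<^bsub>K\<^esub> x"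
    unfolding m_inv_def[of "K\<lparr>carrier := C\<rparr>"]
  proof (rule the_equality)
    show "inv\<^bsub>K\<^esub> x \<in> carrier (K\<lparr>carrier := C\<rparr>) \<and>
        x \<otimes>\<^bsub>K\<lparr>carrier := C\<rparr>\<^esub> inv\<^bsub>K\<^esub> x = \<one>\<^bsub>K\<lparr>carrier := C\<rparr>\<^esub> \<and>
        inv\<^bsub>K\<^esub> x \<otimes>\<^bsub>K\<lparr>carrier := C\<rparr>\<^esub> x = \<one>\<^bsub>K\<lparr>carrier := C\<rparr>\<^esub>"
      using C_inv[OF xC] xK by simp
    fix y assume "y \<in> carrier (K\<lparr>carrier := C\<rparr>) \<and>
        x \<otimes>\<^bsub>K\<lparr>carrier := C\<rparr>\<^esub> y = \<one>\<^bsub>K\<lparr>carrier := C\<rparr>\<^esub> \<and>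
        y \<otimes>\<^bsub>K\<lparr>carrier := C\<rparr>\<^esub> x = \<one>\<^bsub>K\<lparr>carrier := C\<rparr>\<^esub>"
    then have "y \<in> C" "y \<otimes>\<^bsub>K\<^esub> x = \<one>\<^bsub>K\<^esub>" by simp_all
    then show "y = inv\<^bsub>K\<^esub> x" using K.inv_equality xK C_D(1) by metis
  qed
  then show "inv\<^bsub>K\<^esub> x \<in> H" using subgroup.m_inv_closed[OF assms x] by simp
qed

lemma states_of_finite_set:
  assumes T: "finite T" "T \<subseteq> C"
  obtains Q where "cayley_states G (S \<union> set_inv S) Q" "total ` T \<subseteq> Q"
proof -
  interpret K: group K by (rule group_Aut)
  interpret t: group_hom K perms total by (rule group_hom_total)
  define T' where "T' = T \<union> (\<lambda>f. inv\<^bsub>K\<^esub> f) ` T"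
  have T': "finite T'" "T' \<subseteq> C" unfolding T'_def using T C_inv by auto
  have T'_inv: "inv\<^bsub>K\<^esub> f \<in> T'" if "f \<in> T'" for f
    using that T(2) C_D(1) unfolding T'_def by auto
  have aut: "total f \<in> cayley_auts" if "f \<in> T'" for f
    using total_cayley_auts C_D(1,2) T'(2) that by blast
  define Q where "Q = (\<Union>f\<in>T'. restriction (total f) ` carrier G)"
  have QE: "\<exists>f x. f \<in> T' \<and> x \<in> carrier G \<and> q = restriction (total f) x" if "q \<in> Q" for q
    using that unfolding Q_def by blast
  have QI: "restriction (total f) x \<in> Q" if "f \<in> T'" "x \<in> carrier G" for f x
    using that unfolding Q_def by blast
  have "cayley_states G (S \<union> set_inv S) Q"
  proof
    show "finite Q" unfolding Q_def using T' C_restrictions by blast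
    show "Q \<subseteq> cayley_auts" using QE restriction_closed[OF aut] by blast
  next
    fix q x assume q: "q \<in> Q" and x: "x \<in> carrier G"
    obtain f y where f: "f \<in> T'" "y \<in> carrier G" "q = restriction (total f) y" using QE[OF q] by blast
    have "restriction q x = restriction (total f) (y \<otimes> x)" unfolding f(3) by (rule restriction_restriction[OF aut[OF f(1)] f(2) x])
    then show "restriction q x \<in> Q" using QI[OF f(1)] f(2) x by simp
  next
    fix q assume q: "q \<in> Q"
    obtain f y where f: "f \<in> T'" "y \<in> carrier G" "q = restriction (total f) y" using QE[OF q] by blast
    have fK: "f \<in> carrier K" using f(1) T'(2) C_D(1) by blast
    have inv: "inv_into UNIV (total f) = total (inv\<^bsub>K\<^esub> f)"
      using t.hom_inv[OF fK] inv_perms[OF bij_total[OF fK]] by simp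
    have "inv_into UNIV q = restriction (inv_into UNIV (total f)) (total f y)"
      unfolding f(3) by (rule inv_unique_comp[OF restriction_inv(2,1)[OF aut[OF f(1)] f(2)]])
    then show "inv_into UNIV q \<in> Q"
      unfolding inv using QI[OF T'_inv[OF f(1)]] cayley_autsD(3)[OF aut[OF f(1)] f(2)] by simp
  qed
  moreover have "total ` T \<subseteq> Q"
  proof (rule image_subsetI)
    fix f assume "f \<in> T"
    then have f: "f \<in> T'" by (simp add: T'_def)
    show "total f \<in> Q" using QI[OF f one_closed] restriction_one[OF aut[OF f]] by simp
  qed
  ultimately show ?thesis by (rule that)
qed

end

theorem corollaryB:
  fixes G :: "('g, 'b) monoid_scheme"
  assumes "group G"
    and "infinite (carrier G)"
    and "finitely_generated G"
    and "\<And>N. N \<lhd> G \<Longrightarrow> N \<noteq> {\<one>\<^bsub>G\<^esub>} \<Longrightarrow> virtually_nilpotent (G Mod N)"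
  shows "bireversible_group G \<or>
    (\<forall>\<Gamma>. cayley_graph_of G \<Gamma> \<longrightarrow>
      locally_finite (Aut \<Gamma>\<lparr>carrier := comm_stabilizer G \<Gamma>\<rparr>))"
proof (cases "bireversible_group G")
  case not_bireversible: False
  have "\<forall>\<Gamma>. cayley_graph_of G \<Gamma> \<longrightarrow> locally_finite (Aut \<Gamma>\<lparr>carrier := comm_stabilizer G \<Gamma>\<rparr>)"
  proof (intro allI impI)
    fix \<Gamma> assume "cayley_graph_of G \<Gamma>"
    then obtain S where S: "finite S" "S \<subseteq> carrier G" "generate G S = carrier G" and \<Gamma>: "\<Gamma> = Cay G S"
      by (auto simp: cayley_graph_of_def finite_generating_set_def)
    interpret X: cayley_graph G S
      by (intro cayley_graph.intro cayley_graph_axioms.intro assms(1) S)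
    show "locally_finite (Aut \<Gamma>\<lparr>carrier := comm_stabilizer G \<Gamma>\<rparr>)"
      unfolding locally_finite_def \<Gamma>
    proof (intro allI impI, elim conjE)
      fix H
      assume H: "subgroup H (X.K\<lparr>carrier := X.C\<rparr>)"
        and fg: "finitely_generated (X.K\<lparr>carrier := X.C\<rparr>\<lparr>carrier := H\<rparr>)"
      interpret K: group X.K by (rule group_Aut)
      interpret t: group_hom X.K perms X.total by (rule X.group_hom_total)
      have HK: "subgroup H X.K" by (rule X.C_subgroup_in_K[OF H])
      obtain T where T: "finite T" "T \<subseteq> H" and gen: "generate (X.K\<lparr>carrier := H\<rparr>) T = H"
        using fg by (auto simp: finitely_generated_def finite_generating_set_def)
      have gen': "generate X.K T = H" using K.generate_consistent[OF T(2) HK] gen by simp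
      have TK: "T \<subseteq> carrier X.K" using T(2) subgroup.subset[OF HK] by blast
      have "T \<subseteq> X.C" using T(2) subgroup.subset[OF H] by simp
      then obtain Q where Q: "cayley_states G (S \<union> set_inv\<^bsub>G\<^esub> S) Q" and TQ: "X.total ` T \<subseteq> Q"
        by (rule X.states_of_finite_set[OF T(1)]) (rule that)
      interpret Q: cayley_states G "S \<union> set_inv\<^bsub>G\<^esub> S" Q by (rule Q)
      have "Q.act.inert \<noteq> {\<one>\<^bsub>G\<^esub>}"
        using Q.bireversible_if_inert_trivial not_bireversible by blast
      then have "virtually_nilpotent (G Mod Q.act.inert)"
        by (rule assms(4)[OF Q.act.inert_normal])
      then have fin: "finite ((\<lambda>h. restrict h (carrier G)) ` Q.L)"
        by (rule Q.act.finite_action_of_virtually_nilpotent_quotient[OF assms(3) Q.Q(1) Q.Q_perms refl])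
      have "X.total ` H = generate perms (X.total ` T)"
        using t.generate_img[OF TK] gen' by simp
      also have "\<dots> \<subseteq> Q.L" by (rule group.mono_generate[OF group_perms TQ])
      finally have sub: "X.total ` H \<subseteq> Q.L" .
      have "H \<subseteq> (\<lambda>h. restrict h (carrier G)) ` Q.L"
      proof
        fix f assume f: "f \<in> H"
        then have "f = restrict (X.total f) (carrier G)"
          using X.restrict_total[symmetric] subgroup.mem_carrier[OF HK] by blast
        then show "f \<in> (\<lambda>h. restrict h (carrier G)) ` Q.L" using sub f by blast
      qed
      then show "finite H" using fin by (rule finite_subset)
    qed
  qed
  then show ?thesis ..
qed simp

end
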